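(* (i) For each integer $d\ge 1$ there is a random infinite tree $\hat{\mathsf{F}}_d$, depending on $d$, such that $$\mathsf{F}_{d,n} \overset{\mathrm{d}}{\longrightarrow} \hat{\mathsf{F}}_d \qquad (n\to\infty)$$ in the local topology (around the root). (ii) There is a random tree $\bar{\mathsf{F}}$ with a marked vertex, whose law does not depend on $d$, such that for each integer $d\ge1$, if $v_n$ denotes a uniformly at random selected vertex of $\mathsf{F}_{d,n}$, then $$(\mathsf{F}_{d,n},v_n) \overset{\mathrm{d}}{\longrightarrow} \bar{\mathsf{F}} \qquad (n\to\infty)$$ in the local topology around the marked vertex. (iii) The convergence in (ii) also holds in the quenched sense: for each $d \ge 1$, $$\mathfrak{L}\left((\mathsf{F}_{d,n},v_n) \mid \mathsf{F}_{d,n}\right) \overset{\mathrm{p}}{\longrightarrow} \mathfrak{L}(\bar{\mathsf{F}}) \qquad (n\to\infty).$$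
   Context: **$d$-dimensional binary trees.** Let $\mathcal{F}_1$ be the class of finite (unlabelled, non-empty) rooted trees in which each vertex has either no child, or only a left child, or only a right child, or both a left and a right child. For $d \ge 2$, an element of the class $\mathcal{F}_d$ consists of a tree $T$ from $\mathcal{F}_1$ (the first level) together with, for each vertex $v$ of $T$, a tree $T_v$ from $\mathcal{F}_{d-1}$, where $v$ is joined by an additional edge to the root of $T_v$. The root of the resulting tree is the root of $T$, and its size is its total number of vertices. Equivalently, the generating series $F_d(x)=\sum_n f_{d,n}x^n$ of the numbers $f_{d,n}$ of $n$-vertex trees in $\mathcal{F}_d$ satisfy $F_1(x)=x(1+2F_1(x)+F_1(x)^2)$ and $F_d(x)=F_1(xF_{d-1}(x))$ for $d\ge 2$. For $n$ such that $f_{d,n}>0$ (i.e. $n \ge d$), $\mathsf{F}_{d,n}$ denotes a uniformly random $n$-vertex tree in $\mathcal{F}_d$. **Local topology.** For a locally finite tree with a marked vertex (the root of $\mathsf{F}_{d,n}$ in (i), the vertex $v_n$ in (ii) and (iii)), consider for each $r\ge0$ the subtree induced by all vertices at graph distance at most $r$ from the marked vertex, together with the marked vertex and the tree structure (which endpoint of each edge is the parent, and whether each edge is a left edge, a right edge, or an edge attaching a tree of the next level). The local topology is the one in which a sequence converges if and only if for each fixed $r$ these radius-$r$ neighbourhoods are eventually equal (up to isomorphism) to that of the limit; convergence in distribution thus means convergence in distribution of the radius-$r$ neighbourhoods for each fixed $r$. **Quenched convergence.** $\mathfrak{L}((\mathsf{F}_{d,n},v_n)\mid\mathsf{F}_{d,n})$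 is the conditional law, given $\mathsf{F}_{d,n}$, of the tree marked at the uniform random vertex $v_n$; it is a random probability measure on the space of locally finite marked trees. $\mathfrak{L}(\bar{\mathsf{F}})$ is the law of $\bar{\mathsf{F}}$. The arrow $\overset{\mathrm{p}}{\longrightarrow}$ denotes convergence in probability with respect to the weak topology on probability measures on that space. *)

theory Defs
  imports "HOL-Probability.Probability"
begin

section \<open>Binary trees of dimension d\<close>

text \<open>
  Rooted trees are given in Ulam-Harris form. A vertex is the word of edge types read along the path
  from the root to it, so that the root is the empty word and the edges are the pairs
  (parent \<open>u\<close>, child \<open>u @ [e]\<close>). A \<open>NextE\<close> edge attaches a tree of the next level.
\<close>

datatype edge = LeftE | RightE | NextE

type_synonym vertex = "edge list"
type_synonym rtree = "vertex set"

definition prefix_closed :: "'a list set \<Rightarrow> bool" where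
  "prefix_closed S \<longleftrightarrow> (\<forall>s x. s @ [x] \<in> S \<longrightarrow> s \<in> S)"

definition bintrees :: "rtree set" where
  "bintrees = {T. finite T \<and> [] \<in> T \<and> prefix_closed T \<and> (\<forall>v\<in>T. set v \<subseteq> {LeftE, RightE})}"

text \<open>The tree \<open>\<tau> v\<close> is joined to each vertex \<open>v\<close> of \<open>T\<close> by an edge from \<open>v\<close> to the root of \<open>\<tau> v\<close>.\<close>

definition attach :: "rtree \<Rightarrow> (vertex \<Rightarrow> rtree) \<Rightarrow> rtree" where
  "attach T \<tau> = T \<union> {v @ [NextE] @ w | v w. v \<in> T \<and> w \<in> \<tau> v}"

text \<open>Dimension 0 does not occur; it is given the empty class.\<close>

fun dtrees :: "nat \<Rightarrow> rtree set" where
  "dtrees 0 = {}"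
| "dtrees (Suc 0) = bintrees"
| "dtrees (Suc (Suc d)) =
     {attach T \<tau> | T \<tau>. T \<in> bintrees \<and> (\<forall>v\<in>T. \<tau> v \<in> dtrees (Suc d))}"

text \<open>The uniform law on the trees with \<open>n\<close> vertices; meaningful when there is one, that is, \<open>n \<ge> d\<close>.\<close>

definition random_dtree :: "nat \<Rightarrow> nat \<Rightarrow> rtree pmf" where
  "random_dtree d n = pmf_of_set {T \<in> dtrees d. card T = n}"


section \<open>Marked trees\<close>

text \<open>
  A marked tree need not have a root, since the ancestral line of the marked vertex may be
  infinite. We therefore name its vertices by their position relative to the marked vertex: the
  address of a vertex is the sequence of steps of the shortest path from the marked vertex to it.
  \<open>Up e\<close> goes from a vertex to its parent along an edge of type \<open>e\<close>, and \<open>Down e\<close> from a vertex to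
  its child of type \<open>e\<close>. The graph distance to the marked vertex is the length of the address.

  Every vertex has at most one parent and at most one child of each type, so a marked tree is
  determined up to isomorphism by its set of addresses. The type below has exactly one element for
  each isomorphism class; its elements are automatically locally finite. That equality of address
  sets up to length \<open>r\<close> amounts to isomorphism of neighbourhoods of radius \<open>r\<close> is
  \<open>truncate_view_eq_iff_isomorphic\<close> below.
\<close>

datatype step = Up edge | Down edge

text \<open>
  Shortest paths first go up and then down, never descending along the edge just ascended.
  The last condition says that the ancestors of the marked vertex are unique.
\<close>

definition address_set :: "step list set \<Rightarrow> bool" where
  "address_set S \<longleftrightarrow>
     [] \<in> S \<and> prefix_closed S \<and>
     (\<forall>s\<in>S. \<exists>a b. s = map Up a @ map Down b \<and> (a = [] \<or> b = [] \<or> last a \<noteq> hd b)) \<and>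
     (\<forall>a e e'. map Up a @ [Up e] \<in> S \<and> map Up a @ [Up e'] \<in> S \<longrightarrow> e = e')"

typedef marked_tree = "{S. address_set S}" morphisms addresses Abs_marked_tree
  by (rule exI[of _ "{[]}"]) (auto simp: address_set_def prefix_closed_def)

text \<open>The address of \<open>w\<close> relative to \<open>v\<close>: cancel the common prefix, ascend from \<open>v\<close>, descend to \<open>w\<close>.\<close>

fun address :: "vertex \<Rightarrow> vertex \<Rightarrow> step list" where
  "address (a # v) (b # w) =
     (if a = b then address v w else map Up (rev (a # v)) @ map Down (b # w))"
| "address v w = map Up (rev v) @ map Down w"

text \<open>The rooted tree \<open>T\<close> with marked vertex \<open>v \<in> T\<close>.\<close>

definition view :: "rtree \<Rightarrow> vertex \<Rightarrow> marked_tree" where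
  "view T v = Abs_marked_tree (address v ` T)"

definition truncate :: "nat \<Rightarrow> marked_tree \<Rightarrow> step list set" where
  "truncate r t = {s \<in> addresses t. length s \<le> r}"

definition marked_at_root :: "marked_tree \<Rightarrow> bool" where
  "marked_at_root t \<longleftrightarrow> (\<forall>e. [Up e] \<notin> addresses t)"


subsection \<open>Addresses and isomorphism\<close>

fun walk :: "vertex \<Rightarrow> step list \<Rightarrow> vertex" where
  "walk v [] = v"
| "walk v (Up e # s) = walk (butlast v) s"
| "walk v (Down e # s) = walk (v @ [e]) s"

lemma walk_append: "walk v (s @ s') = walk (walk v s) s'"
  by (induction v s rule: walk.induct) auto

lemma walk_Up: "walk (p @ v) (map Up (rev v)) = p"
  by (induction v rule: rev_induct) (auto simp flip: append_assoc)

lemma walk_Down: "walk v (map Down w) = v @ w"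
  by (induction w arbitrary: v) auto

lemma address_self [simp]: "address v v = []"
  by (induction v) auto

lemma address_form:
  "\<exists>p a b. v = p @ a \<and> w = p @ b \<and> address v w = map Up (rev a) @ map Down b \<and>
     (a = [] \<or> b = [] \<or> hd a \<noteq> hd b)"
proof (induction v w rule: address.induct)
  case (1 a v b w)
  show ?case
  proof (cases "a = b")
    case True
    with 1 obtain p a' b' where "v = p @ a'" "w = p @ b'"
      "address v w = map Up (rev a') @ map Down b'" "a' = [] \<or> b' = [] \<or> hd a' \<noteq> hd b'" by auto
    with True show ?thesis by (intro exI[of _ "a # p"] exI[of _ a'] exI[of _ b']) auto
  next
    case False
    then show ?thesis by (intro exI[of _ "[]"] exI[of _ "a # v"] exI[of _ "b # w"]) auto
  qed
next
  case ("2_1" w)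
  then show ?case by auto
next
  case ("2_2" v)
  then show ?case by auto
qed

lemma walk_address: "walk v (address v w) = w"
proof -
  obtain p a b where *: "v = p @ a" "w = p @ b" "address v w = map Up (rev a) @ map Down b"
    using address_form by blast
  show ?thesis unfolding *(3) unfolding walk_append *(1,2) walk_Up walk_Down ..
qed

lemma inj_address: "address v w = address v w' \<longleftrightarrow> w = w'"
  using walk_address by metis

lemma address_child:
  "(\<exists>z. v = w @ e # z) \<and> address v w = address v (w @ [e]) @ [Up e] \<or>
   (\<nexists>z. v = w @ e # z) \<and> address v (w @ [e]) = address v w @ [Down e]"
proof (induction v w rule: address.induct)
  case (1 a v b w)
  then show ?case by (cases "a = b") auto
next
  case ("2_1" w)
  then show ?case by auto
next
  case ("2_2" v)
  then show ?case by (cases v) auto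
qed

lemma address_snoc_Up: "address v w = s @ [Up e] \<longleftrightarrow> (\<exists>z. v = w @ e # z) \<and> s = address v (w @ [e])"
proof
  assume *: "address v w = s @ [Up e]"
  obtain p a b where f: "v = p @ a" "w = p @ b" "address v w = map Up (rev a) @ map Down b"
    using address_form by blast
  have "b = []" using * f(3) by (cases b rule: rev_cases) auto
  with * f have "a \<noteq> []" by (cases a) auto
  then obtain e' z where z: "v = w @ e' # z" using f \<open>b = []\<close> by (cases a) auto
  then have "address v w = address v (w @ [e']) @ [Up e']"
    using address_child[of v w e'] by auto
  with * z show "(\<exists>z. v = w @ e # z) \<and> s = address v (w @ [e])" by auto
next
  assume "(\<exists>z. v = w @ e # z) \<and> s = address v (w @ [e])"
  then show "address v w = s @ [Up e]" using address_child[of v w e] by auto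
qed

lemma address_snoc_Down:
  "address v w = s @ [Down e] \<longleftrightarrow> (\<exists>u. w = u @ [e] \<and> s = address v u \<and> (\<nexists>z. v = w @ z))"
proof
  assume *: "address v w = s @ [Down e]"
  obtain p a b where f: "v = p @ a" "w = p @ b" "address v w = map Up (rev a) @ map Down b"
    and hd: "a = [] \<or> b = [] \<or> hd a \<noteq> hd b"
    using address_form by blast
  obtain b' where b: "b = b' @ [e]" using * f(3)
    by (cases b rule: rev_cases; cases a) auto
  have np: "\<nexists>z. v = (p @ b') @ e # z" using f hd b by (cases b') auto
  have w: "w = (p @ b') @ [e]" using f b by simp
  then have "s = address v (p @ b')" using address_child[of v "p @ b'" e] np * by auto
  with w np show "\<exists>u. w = u @ [e] \<and> s = address v u \<and> (\<nexists>z. v = w @ z)"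
    by (intro exI[of _ "p @ b'"]) simp
next
  assume "\<exists>u. w = u @ [e] \<and> s = address v u \<and> (\<nexists>z. v = w @ z)"
  then obtain u where "w = u @ [e]" "s = address v u" "\<nexists>z. v = w @ z" by blast
  then show "address v w = s @ [Down e]" using address_child[of v u e] by auto
qed

lemma prefix_closedD: "prefix_closed T \<Longrightarrow> u @ z \<in> T \<Longrightarrow> u \<in> T"
  by (induction z rule: rev_induct)
     (auto simp: prefix_closed_def simp flip: append_assoc)

lemma address_set_view:
  assumes "prefix_closed T" "v \<in> T"
  shows "address_set (address v ` T)"
  unfolding address_set_def
proof (intro conjI ballI allI impI)
  show "[] \<in> address v ` T" using assms(2) by force
  show "prefix_closed (address v ` T)"
    unfolding prefix_closed_def
  proof (intro allI impI)
    fix s x assume "s @ [x] \<in> address v ` T"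
    then obtain w where w: "w \<in> T" "address v w = s @ [x]" by force
    show "s \<in> address v ` T"
    proof (cases x)
      case (Up e)
      with w obtain z where "v = (w @ [e]) @ z" "s = address v (w @ [e])"
        using address_snoc_Up by auto
      with assms show ?thesis using prefix_closedD by blast
    next
      case (Down e)
      with w obtain u where "w = u @ [e]" "s = address v u" using address_snoc_Down by auto
      with assms w show ?thesis using prefix_closedD by blast
    qed
  qed
next
  fix s assume "s \<in> address v ` T"
  then obtain w where w: "s = address v w" by auto
  obtain p a b where "address v w = map Up (rev a) @ map Down b" "a = [] \<or> b = [] \<or> hd a \<noteq> hd b"
    using address_form by blast
  then show "\<exists>a b. s = map Up a @ map Down b \<and> (a = [] \<or> b = [] \<or> last a \<noteq> hd b)"
    unfolding w by (intro exI[of _ "rev a"] exI[of _ b]) (auto simp: last_rev)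
next
  fix a e e' assume "map Up a @ [Up e] \<in> address v ` T \<and> map Up a @ [Up e'] \<in> address v ` T"
  then obtain w w' where "address v w = map Up a @ [Up e]" "address v w' = map Up a @ [Up e']"
    by (metis imageE)
  then have "address v (w @ [e]) = address v (w' @ [e'])" by (auto simp: address_snoc_Up)
  then show "e = e'" by (simp add: inj_address)
qed

lemma addresses_view:
  "prefix_closed T \<Longrightarrow> v \<in> T \<Longrightarrow> addresses (view T v) = address v ` T"
  unfolding view_def by (simp add: Abs_marked_tree_inverse address_set_view)

text \<open>The vertices of \<open>T\<close> at graph distance at most \<open>r\<close> from \<open>v\<close>.\<close>

fun neighbourhood :: "rtree \<Rightarrow> vertex \<Rightarrow> nat \<Rightarrow> vertex set" where
  "neighbourhood T v 0 = {v}"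
| "neighbourhood T v (Suc r) = neighbourhood T v r \<union>
     {w \<in> T. \<exists>u\<in>neighbourhood T v r. \<exists>e. w = u @ [e] \<or> u = w @ [e]}"

lemma neighbourhood_eq:
  assumes "prefix_closed T" "v \<in> T"
  shows "neighbourhood T v r = {w \<in> T. length (address v w) \<le> r}"
proof (induction r)
  case 0
  have "address v w = [] \<longleftrightarrow> w = v" for w using inj_address[of v w v] by simp
  with assms(2) show ?case by auto
next
  case (Suc r)
  show ?case
  proof (intro equalityI subsetI)
    fix w assume "w \<in> neighbourhood T v (Suc r)"
    then consider "w \<in> neighbourhood T v r"
      | u e where "w \<in> T" "u \<in> neighbourhood T v r" "w = u @ [e] \<or> u = w @ [e]" by auto
    then show "w \<in> {w \<in> T. length (address v w) \<le> Suc r}"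
    proof cases
      case 1
      then show ?thesis using Suc by auto
    next
      case 2
      then show ?thesis using Suc address_child[of v u e] address_child[of v w e] by auto
    qed
  next
    fix w assume w: "w \<in> {w \<in> T. length (address v w) \<le> Suc r}"
    show "w \<in> neighbourhood T v (Suc r)"
    proof (cases "address v w" rule: rev_cases)
      case Nil
      with w Suc show ?thesis by auto
    next
      case (snoc s x)
      show ?thesis
      proof (cases x)
        case (Up e)
        with snoc obtain z where z: "v = (w @ [e]) @ z" "s = address v (w @ [e])"
          using address_snoc_Up by auto
        then have "w @ [e] \<in> T" using assms prefix_closedD by blast
        with w z snoc Suc show ?thesis by auto
      next
        case (Down e)
        with snoc obtain u where u: "w = u @ [e]" "s = address v u" using address_snoc_Down by auto
        then have "u \<in> T" using assms w prefix_closedD by blast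
        with w u snoc Suc show ?thesis by auto
      qed
    qed
  qed
qed

theorem truncate_view_eq_iff_isomorphic:
  assumes T: "prefix_closed T" "v \<in> T" and T': "prefix_closed T'" "v' \<in> T'"
  shows "truncate r (view T v) = truncate r (view T' v') \<longleftrightarrow>
    (\<exists>\<phi>. bij_betw \<phi> (neighbourhood T v r) (neighbourhood T' v' r) \<and> \<phi> v = v' \<and>
       (\<forall>u\<in>neighbourhood T v r. \<forall>w\<in>neighbourhood T v r. \<forall>e.
          w = u @ [e] \<longleftrightarrow> \<phi> w = \<phi> u @ [e]))"
    (is "?L \<longleftrightarrow> (\<exists>\<phi>. ?iso \<phi>)")
proof -
  let ?N = "neighbourhood T v r" and ?N' = "neighbourhood T' v' r"
  have tr: "truncate r (view T v) = address v ` ?N"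
    unfolding truncate_def addresses_view[OF T] neighbourhood_eq[OF T] by auto
  have tr': "truncate r (view T' v') = address v' ` ?N'"
    unfolding truncate_def addresses_view[OF T'] neighbourhood_eq[OF T'] by auto
  have edge: "w = u @ [e] \<longleftrightarrow> address x w = address x u @ [Down e] \<or> address x u = address x w @ [Up e]"
    for x u w e
  proof
    assume "w = u @ [e]"
    then show "address x w = address x u @ [Down e] \<or> address x u = address x w @ [Up e]"
      using address_child[of x u e] by blast
  next
    assume "address x w = address x u @ [Down e] \<or> address x u = address x w @ [Up e]"
    then show "w = u @ [e]" by (auto simp: address_snoc_Up address_snoc_Down inj_address)
  qed
  show ?thesis
  proof
    assume ?L
    then have im: "address v ` ?N = address v' ` ?N'" unfolding tr tr' .
    define \<phi> where "\<phi> w = walk v' (address v w)" for w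
    have \<phi>: "\<phi> w \<in> ?N' \<and> address v' (\<phi> w) = address v w" if "w \<in> ?N" for w
    proof -
      have "address v w \<in> address v' ` ?N'" unfolding im[symmetric] using that by (rule imageI)
      then obtain w' where "w' \<in> ?N'" "address v w = address v' w'" by (rule imageE)
      then show ?thesis unfolding \<phi>_def by (simp add: walk_address)
    qed
    have "bij_betw \<phi> ?N ?N'"
      unfolding bij_betw_def
    proof (intro conjI equalityI)
      show "inj_on \<phi> ?N" by (rule inj_onI) (metis \<phi> inj_address)
      show "\<phi> ` ?N \<subseteq> ?N'" using \<phi> by auto
      show "?N' \<subseteq> \<phi> ` ?N"
      proof
        fix w' assume "w' \<in> ?N'"
        then have "address v' w' \<in> address v ` ?N" unfolding im by (rule imageI)
        then obtain w where w: "w \<in> ?N" "address v' w' = address v w" by (rule imageE)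
        then have "w' = \<phi> w" using \<phi>[of w] inj_address[of v' w' "\<phi> w"] by simp
        then show "w' \<in> \<phi> ` ?N" using w(1) by (rule image_eqI)
      qed
    qed
    moreover have "\<phi> v = v'" by (simp add: \<phi>_def)
    moreover have "w = u @ [e] \<longleftrightarrow> \<phi> w = \<phi> u @ [e]" if "u \<in> ?N" "w \<in> ?N" for u w e
      using edge[of w u e v] edge[of "\<phi> w" "\<phi> u" e v'] \<phi> that by auto
    ultimately show "\<exists>\<phi>. ?iso \<phi>" by blast
  next
    assume "\<exists>\<phi>. ?iso \<phi>"
    then obtain \<phi> where bij: "bij_betw \<phi> ?N ?N'" and v: "\<phi> v = v'"
      and iso: "\<And>u w e. u \<in> ?N \<Longrightarrow> w \<in> ?N \<Longrightarrow> w = u @ [e] \<longleftrightarrow> \<phi> w = \<phi> u @ [e]" by blast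
    have mem: "w \<in> ?N \<longleftrightarrow> w \<in> T \<and> length (address v w) \<le> r" for w
      unfolding neighbourhood_eq[OF T] by blast
    have "address v' (\<phi> w) = s" if "w \<in> ?N" "address v w = s" for w s
      using that
    proof (induction s arbitrary: w rule: rev_induct)
      case Nil
      then have "w = v" using inj_address[of v w v] by simp
      then show ?case using v by simp
    next
      case (snoc x s)
      show ?case
      proof (cases x)
        case (Up e)
        with snoc obtain z where z: "v = (w @ [e]) @ z" "s = address v (w @ [e])"
          using address_snoc_Up by auto
        then have "w @ [e] \<in> T" using T prefix_closedD by blast
        moreover have "length (address v (w @ [e])) \<le> r"
          using snoc.prems(2) snoc.prems(1)[unfolded mem] unfolding z(2)[symmetric] by simp
        ultimately have N: "w @ [e] \<in> ?N" unfolding mem by blast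
        then have s: "address v' (\<phi> (w @ [e])) = s" using snoc.IH[OF N] z(2) by blast
        have \<phi>: "\<phi> (w @ [e]) = \<phi> w @ [e]" using iso[OF snoc.prems(1) N, of e] by simp
        have "s \<noteq> s' @ [Down e]" for s'
          using address_snoc_Down[of v "w @ [e]" s' e] z(1) unfolding z(2) by blast
        then show ?thesis using address_child[of v' "\<phi> w" e] s \<phi> Up by auto
      next
        case (Down e)
        with snoc obtain u where u: "w = u @ [e]" "s = address v u" and np: "\<nexists>z. v = w @ z"
          using address_snoc_Down by auto
        then have "u \<in> T" using snoc.prems(1)[unfolded mem] T(1) prefix_closedD by blast
        moreover have "length (address v u) \<le> r"
          using snoc.prems(2) snoc.prems(1)[unfolded mem] unfolding u(2)[symmetric] by simp
        ultimately have N: "u \<in> ?N" unfolding mem by blast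
        then have s: "address v' (\<phi> u) = s" using snoc.IH[OF N] u(2) by blast
        have \<phi>: "\<phi> w = \<phi> u @ [e]" using iso[OF N snoc.prems(1), of e] u(1) by blast
        have "s \<noteq> s' @ [Up e]" for s'
          using address_snoc_Up[of v u s' e] np unfolding u by auto
        then show ?thesis using address_child[of v' "\<phi> u" e] s \<phi> Down by auto
      qed
    qed
    then have "address v ` ?N = address v' ` \<phi> ` ?N" unfolding image_image by (intro image_cong) auto
    with bij show ?L unfolding tr tr' by (simp add: bij_betw_imp_surj_on)
  qed
qed


section \<open>The local topology\<close>

instantiation marked_tree :: topological_space
begin

definition open_marked_tree :: "marked_tree set \<Rightarrow> bool" where
  "open_marked_tree U \<longleftrightarrow> (\<forall>t\<in>U. \<exists>r. \<forall>t'. truncate r t' = truncate r t \<longrightarrow> t' \<in> U)"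

instance
proof
  show "open (UNIV :: marked_tree set)" by (simp add: open_marked_tree_def)
next
  fix A B :: "marked_tree set" assume AB: "open A" "open B"
  have mono: "truncate r t' = truncate r t" if "truncate q t' = truncate q t" "r \<le> q" for r q t t'
  proof -
    have "truncate r t = {s \<in> truncate q t. length s \<le> r}" for t
      using that(2) by (auto simp: truncate_def)
    with that(1) show ?thesis by simp
  qed
  show "open (A \<inter> B)"
    unfolding open_marked_tree_def
  proof
    fix t assume "t \<in> A \<inter> B"
    then obtain r q where r: "\<forall>t'. truncate r t' = truncate r t \<longrightarrow> t' \<in> A"
      and q: "\<forall>t'. truncate q t' = truncate q t \<longrightarrow> t' \<in> B"
      using AB unfolding open_marked_tree_def by blast
    have "t' \<in> A \<inter> B" if "truncate (max r q) t' = truncate (max r q) t" for t'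
      using r q mono[OF that, of r] mono[OF that, of q] by simp
    then show "\<exists>r. \<forall>t'. truncate r t' = truncate r t \<longrightarrow> t' \<in> A \<inter> B" by blast
  qed
next
  fix K :: "marked_tree set set" assume "\<forall>U\<in>K. open U"
  then show "open (\<Union>K)" unfolding open_marked_tree_def by (meson Union_iff)
qed

end

theorem tendsto_marked_tree_iff:
  fixes X :: "nat \<Rightarrow> marked_tree"
  shows "X \<longlonglongrightarrow> t \<longleftrightarrow> (\<forall>r. \<forall>\<^sub>F n in sequentially. truncate r (X n) = truncate r t)"
proof
  assume *: "X \<longlonglongrightarrow> t"
  show "\<forall>r. \<forall>\<^sub>F n in sequentially. truncate r (X n) = truncate r t"
  proof
    fix r
    have "open {t'. truncate r t' = truncate r t}" unfolding open_marked_tree_def by auto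
    with * show "\<forall>\<^sub>F n in sequentially. truncate r (X n) = truncate r t"
      by (auto dest: topological_tendstoD)
  qed
next
  assume *: "\<forall>r. \<forall>\<^sub>F n in sequentially. truncate r (X n) = truncate r t"
  show "X \<longlonglongrightarrow> t"
  proof (rule topological_tendstoI)
    fix U assume "open U" "t \<in> U"
    then obtain r where r: "\<forall>t'. truncate r t' = truncate r t \<longrightarrow> t' \<in> U"
      unfolding open_marked_tree_def by blast
    from *[rule_format, of r] show "\<forall>\<^sub>F n in sequentially. X n \<in> U"
      by eventually_elim (use r in blast)
  qed
qed


section \<open>Weak convergence\<close>

definition borel_probs :: "'a::topological_space measure set" where
  "borel_probs = {M. prob_space M \<and> sets M = sets borel}"

text \<open>The coarsest topology on \<open>borel_probs\<close> for which integration of each bounded continuous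
  real function is continuous.\<close>

definition weak_topology :: "'a::topological_space measure topology" where
  "weak_topology = topology_generated_by
     {{M \<in> borel_probs. (\<integral>x. f x \<partial>M) \<in> U} | (f :: 'a \<Rightarrow> real) U.
        continuous_on UNIV f \<and> bounded (range f) \<and> open U}"

text \<open>Convergence in probability of \<open>Y n\<close>, a random point of \<open>X\<close> defined on the sample space
  \<open>P n\<close>, to a deterministic point \<open>c\<close>. No metric is needed, as the limit is constant.\<close>

definition converges_in_prob ::
    "'b topology \<Rightarrow> (nat \<Rightarrow> 'a pmf) \<Rightarrow> (nat \<Rightarrow> 'a \<Rightarrow> 'b) \<Rightarrow> 'b \<Rightarrow> bool" where
  "converges_in_prob X P Y c \<longleftrightarrow> c \<in> topspace X \<and>
     (\<forall>U. openin X U \<and> c \<in> U \<longrightarrow>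
        (\<lambda>n. measure_pmf.prob (P n) {\<omega>. Y n \<omega> \<in> U}) \<longlonglongrightarrow> 1)"


section \<open>The laws of the marked random trees\<close>

definition law_at_root :: "nat \<Rightarrow> nat \<Rightarrow> marked_tree measure" where
  "law_at_root d n = distr (measure_pmf (random_dtree d n)) borel (\<lambda>T. view T [])"

definition law_at_uniform_vertex :: "nat \<Rightarrow> nat \<Rightarrow> marked_tree measure" where
  "law_at_uniform_vertex d n =
     distr (measure_pmf (do { T \<leftarrow> random_dtree d n; v \<leftarrow> pmf_of_set T; return_pmf (T, v) }))
       borel (\<lambda>(T, v). view T v)"

text \<open>The conditional law given the tree \<open>T\<close>.\<close>

definition quenched_law :: "rtree \<Rightarrow> marked_tree measure" where
  "quenched_law T = distr (measure_pmf (pmf_of_set T)) borel (view T)"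

end

theory Submission
  imports Defs "HOL-Complex_Analysis.Complex_Analysis" "HOL-Real_Asymp.Real_Asymp"
begin

text \<open>
  The series \<open>F_d\<close>, with the tree sizes weighted by \<open>4^-n\<close>, satisfies \<open>F_d = z/4 (1 + F_d)^2 F_(d-1)\<close> with
  \<open>F_0 = 1\<close>, so \<open>F_d = (1 - s_d) / (1 + s_d)\<close> where \<open>s_d = sqrt (1 - z F_(d-1))\<close>. On the closed unit disc
  \<open>s_d\<close> has positive real part except at \<open>z = 1\<close>, where it is an analytic function of
  \<open>t = (1 - z)^(1/2^d)\<close> with a simple zero. Hence the coefficients of \<open>F_d\<close> are of exact order
  \<open>n^(-1 - 1/2^d)\<close>. In a product of such series a single factor takes almost the whole size, which
  gives the convergence around the root.

  Around a uniform vertex \<open>v\<close>, the neighbourhood of radius \<open>r\<close> is determined by the subtree at the \<open>r\<close>-th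
  ancestor of \<open>v\<close>. Cutting off a copy of a binary tree \<open>S\<close> leaves a smaller tree with a free slot on
  the last level, and almost all vertices are on the last level. The first two moments then show that
  the proportion of vertices whose subtree is \<open>S\<close> concentrates at \<open>4^-|S|\<close>. These limits sum to 1,
  so all fringe statistics converge, to values that do not depend on \<open>d\<close>.
\<close>


section \<open>Recursive structure of the trees\<close>

text \<open>The weight 4^-n is critical in every dimension at once. F_1 is singular at x = 1/4 with
  F_1(1/4) = 1, so x F_(d-1)(x) reaches 1/4 exactly at x = 1/4. Each level therefore composes one
  more square root with the previous singularity, whence the exponent 1/2^d. The nested roots are
  controlled only near the closed disc punctured at 1, so no contour in a larger common domain is
  used. Subtracting finitely many singular terms leaves a function whose second derivative is
  bounded in the open disc. The error O(n^-2) is good enough because 1 + 1/2^d < 2. At a uniform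
  vertex, lower bounds for two complementary families of fringe trees suffice. Criticality, in the
  form that the weights 4^-|S| sum to 1, turns the second bound into an upper bound for the first
  family. The limit laws exist because degrees are bounded: the space of marked trees is compact,
  and convergence of all cylinder masses already defines a measure.\<close>

definition level :: "vertex \<Rightarrow> nat" where
  "level v = count_list v NextE"

lemma level_simps [simp]:
  "level [] = 0" "level (LeftE # v) = level v" "level (RightE # v) = level v"
  "level (NextE # v) = Suc (level v)" "level (v @ w) = level v + level w"
  by (auto simp: level_def)

lemma level_eq_0_iff: "level v = 0 \<longleftrightarrow> set v \<subseteq> {LeftE, RightE}"
proof -
  have "UNIV = {LeftE, RightE, NextE}" by (auto intro: edge.exhaust)
  then show ?thesis by (auto simp: level_def count_list_0_iff)
qed

text \<open>
  A local description of \<open>dtrees d\<close>. The convention that \<open>etrees 0\<close> only contains the empty tree makes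
  the recursive decomposition at the root uniform in \<open>d\<close>.
\<close>

definition etrees :: "nat \<Rightarrow> rtree set" where
  "etrees d = {T. finite T \<and> prefix_closed T \<and> ([] \<in> T \<longleftrightarrow> 0 < d) \<and>
     (\<forall>v\<in>T. level v < d \<and> (v @ [NextE] \<in> T \<longleftrightarrow> Suc (level v) < d))}"

lemma etrees_0: "etrees 0 = {{}}"
  by (auto simp: etrees_def prefix_closed_def)

lemma bintrees_eq: "bintrees = etrees 1"
  unfolding bintrees_def etrees_def
  by (force simp flip: level_eq_0_iff)

lemma split_at_first_NextE:
  assumes "0 < level v"
  obtains b w where "v = b @ NextE # w" "level b = 0"
proof -
  have "NextE \<in> set v" using assms count_list_0_iff[of v NextE] by (auto simp: level_def)
  then obtain b w where "v = b @ NextE # w" "NextE \<notin> set b" by (metis split_list_first)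
  then show ?thesis using that by (metis count_list_0_iff level_def)
qed

lemma first_NextE_unique:
  "level b = 0 \<Longrightarrow> level b' = 0 \<Longrightarrow> b @ NextE # w = b' @ NextE # w' \<Longrightarrow> b = b' \<and> w = w'"
proof (induction b arbitrary: b')
  case Nil
  then show ?case by (cases b') auto
next
  case (Cons e b)
  have "e \<noteq> NextE" using Cons.prems(1) by auto
  then obtain c where b': "b' = e # c" using Cons.prems(3) by (cases b') auto
  then have "level b = 0" "level c = 0" using Cons.prems(1,2) by (cases e; simp)+
  then have "b = c \<and> w = w'" using Cons.IH[of c] Cons.prems(3) b' by simp
  then show ?case using b' by simp
qed

lemma mem_attach:
  assumes "\<forall>v\<in>T. level v = 0" "level b = 0"
  shows "b @ NextE # w \<in> attach T \<tau> \<longleftrightarrow> b \<in> T \<and> w \<in> \<tau> b"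
proof
  assume "b @ NextE # w \<in> attach T \<tau>"
  moreover have "b @ NextE # w \<notin> T" using assms(1) by force
  ultimately obtain v w' where "b @ NextE # w = v @ NextE # w'" "v \<in> T" "w' \<in> \<tau> v"
    by (auto simp: attach_def)
  then show "b \<in> T \<and> w \<in> \<tau> b" using first_NextE_unique assms by blast
qed (auto simp: attach_def)

lemma mem_attach_level_0:
  assumes "level b = 0"
  shows "b \<in> attach T \<tau> \<longleftrightarrow> b \<in> T"
  using assms by (auto simp: attach_def)

text \<open>A vertex belongs to the first-level tree exactly when its word has no
  \<open>NextE\<close>. Otherwise the first \<open>NextE\<close> separates the vertex of attachment
  from a word in the attached tree, and cutting words there inverts \<open>attach\<close>.\<close>

lemma dtrees_eq_etrees: "dtrees (Suc d) = etrees (Suc d)"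
proof (induction d)
  case 0
  then show ?case by (simp add: bintrees_eq)
next
  case (Suc d)
  show ?case
  proof (intro equalityI subsetI)
    fix A assume "A \<in> dtrees (Suc (Suc d))"
    then obtain T \<tau> where A: "A = attach T \<tau>" and T: "T \<in> etrees 1"
      and \<tau>: "\<And>v. v \<in> T \<Longrightarrow> \<tau> v \<in> etrees (Suc d)"
      by (auto simp: Suc bintrees_eq)
    have T0: "\<forall>v\<in>T. level v = 0" using T by (auto simp: etrees_def)
    have "finite A"
    proof -
      have "A = T \<union> (\<Union>v\<in>T. (\<lambda>w. v @ [NextE] @ w) ` \<tau> v)" by (auto simp: A attach_def)
      moreover have "finite (\<Union>v\<in>T. (\<lambda>w. v @ [NextE] @ w) ` \<tau> v)"
        using T \<tau> by (auto simp: etrees_def)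
      ultimately show ?thesis using T by (auto simp: etrees_def)
    qed
    moreover have "[] \<in> A" using T by (auto simp: A attach_def etrees_def)
    moreover have "prefix_closed A"
      unfolding prefix_closed_def
    proof (intro allI impI)
      fix s x assume sx: "s @ [x] \<in> A"
      show "s \<in> A"
      proof (cases "level (s @ [x]) = 0")
        case True
        then have "s @ [x] \<in> T" using sx mem_attach_level_0 A by blast
        then have "s \<in> T" using T by (auto simp: etrees_def prefix_closed_def)
        then show ?thesis by (auto simp: A attach_def)
      next
        case False
        then obtain b w where bw: "s @ [x] = b @ NextE # w" "level b = 0"
          using split_at_first_NextE by blast
        then have b: "b \<in> T" "w \<in> \<tau> b" using sx mem_attach[OF T0, of b w \<tau>] A by auto
        show ?thesis
        proof (cases w rule: rev_cases)
          case Nil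
          then show ?thesis using bw b by (simp add: A attach_def)
        next
          case (snoc w' y)
          then have "w' \<in> \<tau> b" using b \<tau>[OF b(1)] by (auto simp: etrees_def prefix_closed_def)
          then show ?thesis using bw b snoc by (auto simp: A attach_def)
        qed
      qed
    qed
    moreover have "level v < Suc (Suc d) \<and> (v @ [NextE] \<in> A \<longleftrightarrow> Suc (level v) < Suc (Suc d))"
      if v: "v \<in> A" for v
    proof (cases "level v = 0")
      case True
      then have "v \<in> T" using v mem_attach_level_0 A by blast
      moreover have "v @ NextE # [] \<in> A \<longleftrightarrow> v \<in> T \<and> [] \<in> \<tau> v"
        unfolding A by (rule mem_attach[OF T0 True])
      ultimately show ?thesis using \<tau>[of v] True by (auto simp: etrees_def)
    next
      case False
      then obtain b w where bw: "v = b @ NextE # w" "level b = 0"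
        using split_at_first_NextE by blast
      then have b: "b \<in> T" "w \<in> \<tau> b" using v mem_attach[OF T0, of b w \<tau>] A by auto
      have "v @ [NextE] \<in> A \<longleftrightarrow> w @ [NextE] \<in> \<tau> b"
        using mem_attach[OF T0 bw(2), of "w @ [NextE]" \<tau>] b A bw by simp
      then show ?thesis using \<tau>[OF b(1)] b bw by (auto simp: etrees_def)
    qed
    ultimately show "A \<in> etrees (Suc (Suc d))" unfolding etrees_def by blast
  next
    fix A assume A: "A \<in> etrees (Suc (Suc d))"
    define T where "T = {v \<in> A. level v = 0}"
    define \<tau> where "\<tau> b = {w. b @ NextE # w \<in> A}" for b
    have pc: "prefix_closed A" using A by (simp add: etrees_def)
    have "A = attach T \<tau>"
    proof (intro equalityI subsetI)
      fix v assume v: "v \<in> A"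
      show "v \<in> attach T \<tau>"
      proof (cases "level v = 0")
        case True
        then show ?thesis using v by (simp add: mem_attach_level_0 T_def)
      next
        case False
        then obtain b w where bw: "v = b @ NextE # w" "level b = 0"
          using split_at_first_NextE by blast
        then show ?thesis using v prefix_closedD[OF pc, of b "NextE # w"]
          by (auto simp: attach_def T_def \<tau>_def)
      qed
    qed (auto simp: attach_def T_def \<tau>_def)
    moreover have "T \<in> bintrees"
      using A unfolding bintrees_eq
      by (auto simp: T_def etrees_def prefix_closed_def)
    moreover have "\<tau> b \<in> etrees (Suc d)" if b: "b \<in> T" for b
    proof -
      have "inj_on (\<lambda>w. b @ NextE # w) (\<tau> b)" by (auto simp: inj_on_def)
      moreover have "(\<lambda>w. b @ NextE # w) ` \<tau> b \<subseteq> A" by (auto simp: \<tau>_def)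
      ultimately have "finite (\<tau> b)" using A unfolding etrees_def
        by (metis (mono_tags, lifting) finite_imageD finite_subset mem_Collect_eq)
      moreover have "prefix_closed (\<tau> b)"
        using pc unfolding prefix_closed_def \<tau>_def by (metis append_Cons append_assoc mem_Collect_eq)
      moreover have "[] \<in> \<tau> b" using A b by (auto simp: \<tau>_def T_def etrees_def)
      moreover have "level v < Suc d \<and> (v @ [NextE] \<in> \<tau> b \<longleftrightarrow> Suc (level v) < Suc d)"
        if v: "v \<in> \<tau> b" for v
      proof -
        have m: "b @ NextE # v \<in> A" "level b = 0" using v b by (auto simp: \<tau>_def T_def)
        have "level (b @ NextE # v) < Suc (Suc d) \<and> ((b @ NextE # v) @ [NextE] \<in> A \<longleftrightarrow>
            Suc (level (b @ NextE # v)) < Suc (Suc d))"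
          using A m(1) unfolding etrees_def by blast
        then show ?thesis using m by (simp add: \<tau>_def)
      qed
      ultimately show ?thesis unfolding etrees_def by blast
    qed
    ultimately show "A \<in> dtrees (Suc (Suc d))" using Suc by auto
  qed
qed

lemma dtrees_eq: "1 \<le> d \<Longrightarrow> dtrees d = etrees d"
  using dtrees_eq_etrees by (cases d) auto

section \<open>Decomposition at the root and finiteness of each size class\<close>

definition subtree :: "rtree \<Rightarrow> vertex \<Rightarrow> rtree" where
  "subtree T u = {w. u @ w \<in> T}"

definition node :: "rtree \<Rightarrow> rtree \<Rightarrow> rtree \<Rightarrow> rtree" where
  "node L R N = insert [] ((#) LeftE ` L \<union> (#) RightE ` R \<union> (#) NextE ` N)"

lemma mem_node [simp]:
  "[] \<in> node L R N" "LeftE # v \<in> node L R N \<longleftrightarrow> v \<in> L"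
  "RightE # v \<in> node L R N \<longleftrightarrow> v \<in> R" "NextE # v \<in> node L R N \<longleftrightarrow> v \<in> N"
  by (auto simp: node_def)

lemma prefix_closed_subtree: "prefix_closed T \<Longrightarrow> prefix_closed (subtree T u)"
  unfolding prefix_closed_def subtree_def by (metis append_assoc mem_Collect_eq)

lemma finite_subtree: "finite T \<Longrightarrow> finite (subtree T u)"
proof -
  assume "finite T"
  moreover have "(@) u ` subtree T u \<subseteq> T" by (auto simp: subtree_def)
  ultimately show ?thesis by (metis finite_imageD finite_subset inj_on_def same_append_eq)
qed

lemma subtree_in_etrees:
  assumes "T \<in> etrees d" "u \<in> T"
  shows "subtree T u \<in> etrees (d - level u)"
proof -
  have *: "\<And>v. v \<in> T \<Longrightarrow> level v < d \<and> (v @ [NextE] \<in> T \<longleftrightarrow> Suc (level v) < d)"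
    using assms by (auto simp: etrees_def)
  have "level v < d - level u \<and> (v @ [NextE] \<in> subtree T u \<longleftrightarrow> Suc (level v) < d - level u)"
    if "v \<in> subtree T u" for v
    using *[of "u @ v"] that by (auto simp: subtree_def)
  moreover have "[] \<in> subtree T u" "0 < d - level u" using assms *[of u] by (auto simp: subtree_def)
  moreover have "finite (subtree T u)" "prefix_closed (subtree T u)"
    using assms by (auto simp: etrees_def finite_subtree prefix_closed_subtree)
  ultimately show ?thesis unfolding etrees_def by blast
qed

text \<open>The empty tree stands for an absent child.\<close>

definition otrees :: "nat \<Rightarrow> rtree set" where
  "otrees d = insert {} (etrees d)"

lemma prefix_closed_node:
  "prefix_closed (node L R N) \<longleftrightarrow> prefix_closed L \<and> prefix_closed R \<and> prefix_closed N"
proof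
  assume *: "prefix_closed (node L R N)"
  have "subtree (node L R N) [LeftE] = L" "subtree (node L R N) [RightE] = R"
    "subtree (node L R N) [NextE] = N" by (auto simp: subtree_def)
  then show "prefix_closed L \<and> prefix_closed R \<and> prefix_closed N"
    using prefix_closed_subtree[OF *] by metis
next
  assume *: "prefix_closed L \<and> prefix_closed R \<and> prefix_closed N"
  show "prefix_closed (node L R N)"
    unfolding prefix_closed_def
  proof (intro allI impI)
    fix s x assume "s @ [x] \<in> node L R N"
    then show "s \<in> node L R N"
    proof (cases s)
      case (Cons e w)
      then show ?thesis using * \<open>s @ [x] \<in> node L R N\<close>
        by (cases e) (auto simp: prefix_closed_def)
    qed auto
  qed
qed

lemma node_subtrees:
  assumes "[] \<in> T"
  shows "node (subtree T [LeftE]) (subtree T [RightE]) (subtree T [NextE]) = T"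
proof (intro set_eqI)
  fix v
  show "v \<in> node (subtree T [LeftE]) (subtree T [RightE]) (subtree T [NextE]) \<longleftrightarrow> v \<in> T"
  proof (cases v)
    case (Cons e w)
    then show ?thesis by (cases e) (auto simp: subtree_def)
  qed (use assms in auto)
qed

lemma node_inject: "node L R N = node L' R' N' \<longleftrightarrow> L = L' \<and> R = R' \<and> N = N'"
proof
  assume *: "node L R N = node L' R' N'"
  have "subtree (node L R N) [LeftE] = L" "subtree (node L R N) [RightE] = R"
    "subtree (node L R N) [NextE] = N" for L R N by (auto simp: subtree_def)
  then show "L = L' \<and> R = R' \<and> N = N'" using * by metis
qed auto

lemma finite_node: "finite (node L R N) \<longleftrightarrow> finite L \<and> finite R \<and> finite N"
  by (auto simp: node_def finite_image_iff)

lemma card_node: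
  assumes "finite L" "finite R" "finite N"
  shows "card (node L R N) = Suc (card L + card R + card N)"
proof -
  have "card ((#) LeftE ` L \<union> (#) RightE ` R \<union> (#) NextE ` N) = card L + card R + card N"
    using assms by (subst card_Un_disjoint; (subst card_Un_disjoint)?) (auto simp: card_image)
  then show ?thesis using assms unfolding node_def by (subst card_insert_disjoint) auto
qed

lemma subtree_Cons_in_otrees:
  assumes "T \<in> etrees (Suc d)"
  shows "subtree T [LeftE] \<in> otrees (Suc d)" "subtree T [RightE] \<in> otrees (Suc d)"
    "subtree T [NextE] \<in> etrees d"
proof -
  have pc: "prefix_closed T" using assms by (simp add: etrees_def)
  have e: "subtree T [e] = {}" if "[e] \<notin> T" for e
    using that prefix_closedD[OF pc, of "[e]"] by (auto simp: subtree_def)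
  show "subtree T [LeftE] \<in> otrees (Suc d)"
    using subtree_in_etrees[OF assms, of "[LeftE]"] e by (cases "[LeftE] \<in> T") (auto simp: otrees_def)
  show "subtree T [RightE] \<in> otrees (Suc d)"
    using subtree_in_etrees[OF assms, of "[RightE]"] e by (cases "[RightE] \<in> T") (auto simp: otrees_def)
  show "subtree T [NextE] \<in> etrees d"
  proof (cases "[NextE] \<in> T")
    case True
    then show ?thesis using subtree_in_etrees[OF assms, of "[NextE]"] by auto
  next
    case False
    moreover have "[] @ [NextE] \<in> T \<longleftrightarrow> Suc (level []) < Suc d"
      using assms unfolding etrees_def by blast
    ultimately show ?thesis using e by (auto simp: etrees_0)
  qed
qed

lemma node_in_etrees:
  assumes "L \<in> otrees (Suc d)" "R \<in> otrees (Suc d)" "N \<in> etrees d"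
  shows "node L R N \<in> etrees (Suc d)"
proof -
  have LR: "finite S \<and> prefix_closed S \<and>
      (\<forall>v\<in>S. level v < Suc d \<and> (v @ [NextE] \<in> S \<longleftrightarrow> Suc (level v) < Suc d))"
    if "S \<in> otrees (Suc d)" for S
    using that by (auto simp: otrees_def etrees_def prefix_closed_def)
  have N: "finite N" "prefix_closed N" "[] \<in> N \<longleftrightarrow> 0 < d"
      "\<forall>v\<in>N. level v < d \<and> (v @ [NextE] \<in> N \<longleftrightarrow> Suc (level v) < d)"
    using assms(3) unfolding etrees_def by auto
  have "level v < Suc d \<and> (v @ [NextE] \<in> node L R N \<longleftrightarrow> Suc (level v) < Suc d)"
    if "v \<in> node L R N" for v
  proof (cases v)
    case (Cons e w)
    then show ?thesis using that LR[OF assms(1)] LR[OF assms(2)] N by (cases e) auto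
  qed (use N in auto)
  then show ?thesis
    using LR[OF assms(1)] LR[OF assms(2)] N
    unfolding etrees_def by (auto simp: finite_node prefix_closed_node)
qed

text \<open>Decomposing at the root, rather than into a first-level tree with attachments, replaces
  the composition F_1(x F_(d-1)) by a product. Only the \<open>NextE\<close> subtree drops a
  dimension. Whether it is present is forced by \<open>d\<close>, so it ranges over
  \<open>etrees d\<close> and not over \<open>otrees d\<close>.\<close>

lemma bij_betw_node:
  "bij_betw (\<lambda>(L, R, N). node L R N) (otrees (Suc d) \<times> otrees (Suc d) \<times> etrees d) (etrees (Suc d))"
proof (rule bij_betw_imageI)
  show "inj_on (\<lambda>(L, R, N). node L R N) (otrees (Suc d) \<times> otrees (Suc d) \<times> etrees d)"
    by (auto simp: inj_on_def node_inject)
  have "T \<in> (\<lambda>(L, R, N). node L R N) ` (otrees (Suc d) \<times> otrees (Suc d) \<times> etrees d)"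
    if "T \<in> etrees (Suc d)" for T
  proof (rule image_eqI)
    show "T = (\<lambda>(L, R, N). node L R N) (subtree T [LeftE], subtree T [RightE], subtree T [NextE])"
      using that node_subtrees[of T] by (auto simp: etrees_def)
  qed (use subtree_Cons_in_otrees[OF that] in auto)
  then show "(\<lambda>(L, R, N). node L R N) ` (otrees (Suc d) \<times> otrees (Suc d) \<times> etrees d) = etrees (Suc d)"
    using node_in_etrees by auto
qed

lemma finite_etrees: "T \<in> etrees d \<Longrightarrow> finite T"
  by (simp add: etrees_def)

lemma finite_otrees: "T \<in> otrees d \<Longrightarrow> finite T"
  by (auto simp: otrees_def etrees_def)

text \<open>The prefixes of \<open>v\<close> are \<open>length v + 1\<close> different vertices.
  Trees of a given size thus use words of bounded length, of which there are finitely many.\<close>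

lemma length_less_card:
  assumes "finite T" "prefix_closed T" "v \<in> T"
  shows "length v < card T"
proof -
  have "(\<lambda>i. take i v) ` {..length v} \<subseteq> T"
  proof
    fix w assume "w \<in> (\<lambda>i. take i v) ` {..length v}"
    then obtain i where "w = take i v" by blast
    moreover have "take i v @ drop i v \<in> T" using assms(3) by simp
    ultimately show "w \<in> T" using prefix_closedD[OF assms(2)] by blast
  qed
  moreover have "inj_on (\<lambda>i. take i v) {..length v}"
    proof (rule inj_onI)
    fix i j assume "i \<in> {..length v}" "j \<in> {..length v}" "take i v = take j v"
    then have "min (length v) i = min (length v) j" by (metis length_take)
    then show "i = j" using \<open>i \<in> _\<close> \<open>j \<in> _\<close> by simp
  qed
  ultimately have "card {..length v} \<le> card T" using card_inj_on_le assms(1) by blast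
  then show ?thesis by simp
qed

instance edge :: finite
proof
  show "finite (UNIV :: edge set)"
    by (rule finite_subset[of _ "{LeftE, RightE, NextE}"]) (use edge.exhaust in auto)
qed

lemma finite_length_le: "finite {v :: 'a::finite list. length v \<le> n}"
  using finite_lists_length_le[of "UNIV :: 'a set" n] by simp

lemma finite_prefix_closed_card: "finite {T :: rtree. finite T \<and> prefix_closed T \<and> card T = n}"
proof (rule finite_subset)
  show "{T :: rtree. finite T \<and> prefix_closed T \<and> card T = n} \<subseteq> Pow {v. length v \<le> n}"
    using length_less_card by fastforce
qed (simp add: finite_length_le)

lemma finite_etrees_card: "finite {T \<in> etrees d. card T = n}"
  by (rule finite_subset[OF _ finite_prefix_closed_card[of n]]) (auto simp: etrees_def)

lemma finite_otrees_card: "finite {T \<in> otrees d. card T = n}"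
  by (rule finite_subset[OF _ finite_prefix_closed_card[of n]])
     (auto simp: otrees_def etrees_def prefix_closed_def)


section \<open>Generating functions\<close>

text \<open>The weight \<open>4^-n\<close> makes the dominant singularity of all series lie at 1.\<close>

definition gf :: "'b set \<Rightarrow> ('b \<Rightarrow> nat) \<Rightarrow> ('b \<Rightarrow> real) \<Rightarrow> 'a::real_field fps" where
  "gf A sz \<phi> = Abs_fps (\<lambda>n. of_real ((\<Sum>x\<in>{x \<in> A. sz x = n}. \<phi> x) / 4 ^ n))"

lemma gf_nth: "fps_nth (gf A sz \<phi>) n = of_real ((\<Sum>x\<in>{x \<in> A. sz x = n}. \<phi> x) / 4 ^ n)"
  by (simp add: gf_def)

lemma gf_times:
  assumes "\<And>n. finite {x \<in> A. sz x = n}" "\<And>n. finite {y \<in> B. sz' y = n}"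
  shows "gf A sz f * gf B sz' g = gf (A \<times> B) (\<lambda>(x, y). sz x + sz' y) (\<lambda>(x, y). f x * g y)"
proof (rule fps_ext)
  fix n
  let ?A = "\<lambda>i. {x \<in> A. sz x = i}" and ?B = "\<lambda>i. {y \<in> B. sz' y = i}"
  let ?h = "\<lambda>(x, y). f x * g y"
  have "(\<Sum>p\<in>{p \<in> A \<times> B. (\<lambda>(x, y). sz x + sz' y) p = n}. ?h p)
      = (\<Sum>p\<in>(\<Union>i\<in>{..n}. ?A i \<times> ?B (n - i)). ?h p)"
    by (rule sum.cong) auto
  also have "\<dots> = (\<Sum>i\<le>n. \<Sum>p\<in>?A i \<times> ?B (n - i). ?h p)"
    by (rule sum.UNION_disjoint) (use assms in auto)
  also have "\<dots> = (\<Sum>i\<le>n. (\<Sum>x\<in>?A i. f x) * (\<Sum>y\<in>?B (n - i). g y))"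
    by (simp add: sum_product sum.cartesian_product)
  finally have "(\<Sum>p\<in>{p \<in> A \<times> B. (\<lambda>(x, y). sz x + sz' y) p = n}. ?h p) / 4 ^ n =
      (\<Sum>i\<le>n. (\<Sum>x\<in>?A i. f x) * (\<Sum>y\<in>?B (n - i). g y) / 4 ^ n)"
    by (simp only: sum_divide_distrib)
  also have "\<dots> = (\<Sum>i\<le>n. (\<Sum>x\<in>?A i. f x) / 4 ^ i * ((\<Sum>y\<in>?B (n - i). g y) / 4 ^ (n - i)))"
    by (rule sum.cong) (auto simp flip: power_add)
  finally have *: "(\<Sum>p\<in>{p \<in> A \<times> B. (\<lambda>(x, y). sz x + sz' y) p = n}. ?h p) / 4 ^ n =
      (\<Sum>i\<le>n. (\<Sum>x\<in>?A i. f x) / 4 ^ i * ((\<Sum>y\<in>?B (n - i). g y) / 4 ^ (n - i)))" .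
  show "fps_nth (gf A sz f * gf B sz' g) n =
      fps_nth (gf (A \<times> B) (\<lambda>(x, y). sz x + sz' y) ?h :: 'c fps) n"
    unfolding gf_nth * fps_mult_nth by (simp add: atLeast0AtMost)
qed

lemma gf_bij:
  assumes "bij_betw h A B" "\<And>x. x \<in> A \<Longrightarrow> sz' (h x) = Suc (sz x)" "\<And>x. x \<in> A \<Longrightarrow> \<phi>' (h x) = \<phi> x"
  shows "gf B sz' \<phi>' = fps_const (1 / 4) * fps_X * gf A sz \<phi>"
proof (rule fps_ext)
  fix n
  have B: "B = h ` A" and inj: "inj_on h A" using assms(1) by (auto simp: bij_betw_def)
  show "fps_nth (gf B sz' \<phi>') n = fps_nth (fps_const (1 / 4) * fps_X * gf A sz \<phi> :: 'c fps) n"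
  proof (cases n)
    case 0
    have e: "{y \<in> B. sz' y = 0} = {}" using assms(2) B by auto
    show ?thesis unfolding 0 gf_nth e by (simp add: mult.assoc)
  next
    case (Suc m)
    have "{y \<in> B. sz' y = Suc m} = h ` {x \<in> A. sz x = m}" using assms(2) B by auto
    moreover have "inj_on h {x \<in> A. sz x = m}" using inj by (rule inj_on_subset) auto
    ultimately have "(\<Sum>y\<in>{y \<in> B. sz' y = Suc m}. \<phi>' y) = (\<Sum>x\<in>{x \<in> A. sz x = m}. \<phi> x)"
      using assms(3) by (simp add: sum.reindex)
    then show ?thesis unfolding Suc gf_nth by (simp add: mult.assoc gf_nth)
  qed
qed

lemma gf_add: "gf A sz (\<lambda>x. f x + g x) = gf A sz f + gf A sz g"
  by (rule fps_ext) (simp add: gf_nth sum.distrib add_divide_distrib)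

lemma gf_cong: "(\<And>x. x \<in> A \<Longrightarrow> f x = g x) \<Longrightarrow> gf A sz f = gf A sz g"
  by (rule fps_ext) (simp add: gf_nth)

lemma gf_zero: "gf A sz (\<lambda>_. 0) = 0"
  by (rule fps_ext) (simp add: gf_nth)

abbreviation tgf :: "rtree set \<Rightarrow> (rtree \<Rightarrow> real) \<Rightarrow> 'a::real_field fps" where
  "tgf A \<equiv> gf A card"

text \<open>The three weights are independent because the rule serves several purposes: constant
  weights give the series itself, \<open>branchings\<close> in one factor marks a vertex in one
  subtree, and indicators prescribe the truncation of each subtree.\<close>

lemma tgf_node:
  assumes "\<And>L R N. L \<in> otrees (Suc d) \<Longrightarrow> R \<in> otrees (Suc d) \<Longrightarrow> N \<in> etrees d \<Longrightarrow>
    \<phi> (node L R N) = f L * g R * h N"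
  shows "tgf (etrees (Suc d)) \<phi> =
    fps_const (1 / 4) * fps_X * (tgf (otrees (Suc d)) f * tgf (otrees (Suc d)) g * tgf (etrees d) h)"
proof -
  have fin: "finite {p \<in> otrees (Suc d) \<times> etrees d. (case p of (R, N) \<Rightarrow> card R + card N) = n}" for n
    by (rule finite_subset[of _ "(\<Union>i\<le>n. {T \<in> otrees (Suc d). card T = i}) \<times>
      (\<Union>i\<le>n. {T \<in> etrees d. card T = i})"]) (auto simp: finite_otrees_card finite_etrees_card)
  have "tgf (etrees (Suc d)) \<phi> = fps_const (1 / 4) * fps_X *
      (tgf (otrees (Suc d)) f * (tgf (otrees (Suc d)) g * tgf (etrees d) h))"
    unfolding gf_times[OF finite_otrees_card finite_etrees_card] gf_times[OF finite_otrees_card fin]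
    by (rule gf_bij[OF bij_betw_node])
       (use assms finite_otrees finite_etrees in \<open>auto simp: card_node\<close>)
  then show ?thesis by (simp add: mult.assoc)
qed

lemma tgf_etrees_0: "tgf (etrees 0) f = fps_const (of_real (f {}))"
proof (rule fps_ext)
  fix n
  have *: "{x \<in> {{} :: rtree}. card x = n} = (if n = 0 then {{}} else {})" by auto
  show "fps_nth (tgf (etrees 0) f) n = fps_nth (fps_const (of_real (f {})) :: 'a fps) n"
    unfolding gf_nth etrees_0 * by simp
qed

lemma tgf_otrees: "tgf (otrees (Suc d)) f = fps_const (of_real (f {})) + tgf (etrees (Suc d)) f"
proof (rule fps_ext)
  fix n
  have 0: "{} \<notin> etrees (Suc d)" by (simp add: etrees_def)
  have *: "{x \<in> otrees (Suc d). card x = n} =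
      (if n = 0 then {{}} else {x \<in> etrees (Suc d). card x = n})"
    using 0 finite_etrees[of _ "Suc d"] by (auto simp: otrees_def card_eq_0_iff)
  have e: "{x \<in> etrees (Suc d). card x = 0} = {}"
    using 0 finite_etrees[of _ "Suc d"] by (auto simp: card_eq_0_iff)
  show "fps_nth (tgf (otrees (Suc d)) f) n =
      fps_nth (fps_const (of_real (f {})) + tgf (etrees (Suc d)) f :: 'a fps) n"
    unfolding fps_add_nth gf_nth * by (cases n) (simp_all only: e, simp_all)
qed

section \<open>Functional equations for the trees and for their branchings\<close>

definition Fgf :: "nat \<Rightarrow> 'a::real_field fps" where
  "Fgf d = tgf (etrees d) (\<lambda>_. 1)"

lemma Fgf_0: "Fgf 0 = 1"
  by (simp add: Fgf_def tgf_etrees_0)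

lemma tgf_otrees_1: "tgf (otrees (Suc d)) (\<lambda>_. 1) = 1 + Fgf (Suc d)"
  by (simp add: tgf_otrees Fgf_def)

lemma Fgf_Suc:
  "Fgf (Suc d) = fps_const (1 / 4) * fps_X * ((1 + Fgf (Suc d)) * (1 + Fgf (Suc d)) * Fgf d)"
proof -
  have "Fgf (Suc d) = fps_const (1 / 4) * fps_X * (tgf (otrees (Suc d)) (\<lambda>_. 1) *
      tgf (otrees (Suc d)) (\<lambda>_. 1) * tgf (etrees d) (\<lambda>_. 1))"
    unfolding Fgf_def by (rule tgf_node) simp
  then show ?thesis unfolding tgf_otrees_1 by (simp add: Fgf_def)
qed

text \<open>In a tree of \<open>etrees d\<close> this counts the vertices outside the last level.\<close>

definition branchings :: "rtree \<Rightarrow> real" where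
  "branchings T = real (card {v. v @ [NextE] \<in> T})"

lemma finite_branchings: "finite T \<Longrightarrow> finite {v. v @ [NextE] \<in> T}"
proof -
  assume "finite T"
  moreover have "(\<lambda>v. v @ [NextE]) ` {v. v @ [NextE] \<in> T} \<subseteq> T" by auto
  ultimately show ?thesis by (metis finite_imageD finite_subset inj_on_def append_same_eq)
qed

lemma branchings_empty: "branchings {} = 0"
  by (simp add: branchings_def)

lemma branchings_node:
  assumes "finite L" "finite R" "N \<in> etrees d"
  shows "branchings (node L R N) = branchings L + branchings R + branchings N + (if d = 0 then 0 else 1)"
proof -
  let ?B = "\<lambda>T. {v. v @ [NextE] \<in> T}"
  have fin: "finite (?B L)" "finite (?B R)" "finite (?B N)"
    using assms finite_etrees finite_branchings by auto
  have "?B (node L R N) = ((#) LeftE ` ?B L \<union> (#) RightE ` ?B R \<union> (#) NextE ` ?B N) \<union>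
      (if d = 0 then {} else {[]})" (is "?l = ?r")
  proof (intro set_eqI)
    fix v show "v \<in> ?l \<longleftrightarrow> v \<in> ?r"
    proof (cases v)
      case Nil
      then show ?thesis using assms(3) by (auto simp: etrees_def)
    next
      case (Cons e w)
      then show ?thesis by (cases e) auto
    qed
  qed
  moreover have "card ((#) LeftE ` ?B L \<union> (#) RightE ` ?B R \<union> (#) NextE ` ?B N) =
      card (?B L) + card (?B R) + card (?B N)"
    using fin by (subst card_Un_disjoint; (subst card_Un_disjoint)?) (auto simp: card_image)
  moreover have "card (((#) LeftE ` ?B L \<union> (#) RightE ` ?B R \<union> (#) NextE ` ?B N) \<union>
      (if d = 0 then {} else {[]})) =
    card ((#) LeftE ` ?B L \<union> (#) RightE ` ?B R \<union> (#) NextE ` ?B N) + (if d = 0 then 0 else 1)"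
    using fin by (subst card_Un_disjoint) auto
  ultimately show ?thesis unfolding branchings_def by simp
qed

definition Mgf :: "nat \<Rightarrow> 'a::real_field fps" where
  "Mgf d = tgf (etrees d) branchings"

lemma Mgf_0: "Mgf 0 = 0"
  by (simp add: Mgf_def tgf_etrees_0 branchings_empty)

lemma tgf_otrees_branchings: "tgf (otrees (Suc d)) branchings = Mgf (Suc d)"
  by (simp add: tgf_otrees Mgf_def branchings_empty)

text \<open>\<open>branchings\<close> is additive over the subtrees at the root, and each summand
  alone is a product weight with two constant factors. The root adds 1 unless it is on the last
  level. The equation is linear in \<open>Mgf (Suc d)\<close>.\<close>

lemma Mgf_Suc:
  "Mgf (Suc d) = (if d = 0 then 0 else Fgf (Suc d)) +
     fps_const (1 / 4) * fps_X * (2 * (1 + Fgf (Suc d)) * Fgf d * Mgf (Suc d)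
       + (1 + Fgf (Suc d)) * (1 + Fgf (Suc d)) * Mgf d)"
proof -
  let ?E = "etrees (Suc d)" and ?O = "otrees (Suc d)"
  define s where "s i T = branchings (subtree T [i])" for i T
  have sub: "subtree (node L R N) [LeftE] = L" "subtree (node L R N) [RightE] = R"
    "subtree (node L R N) [NextE] = N" for L R N by (auto simp: subtree_def)
  have "tgf ?E branchings = (tgf ?E (\<lambda>T. s LeftE T + s RightE T + s NextE T + (if d = 0 then 0 else 1)) :: 'a fps)"
  proof (rule gf_cong)
    fix T assume T: "T \<in> ?E"
    have "[] \<in> T" using T by (simp add: etrees_def)
    then show "branchings T = s LeftE T + s RightE T + s NextE T + (if d = 0 then 0 else 1)"
      unfolding s_def using branchings_node[of "subtree T [LeftE]" "subtree T [RightE]" "subtree T [NextE]" d]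
        subtree_Cons_in_otrees[OF T] finite_otrees by (simp add: node_subtrees)
  qed
  also have "\<dots> = tgf ?E (s LeftE) + tgf ?E (s RightE) + tgf ?E (s NextE) + (if d = 0 then 0 else Fgf (Suc d))"
    by (simp add: gf_add gf_zero Fgf_def)
  also have "tgf ?E (s LeftE) = fps_const (1 / 4) * fps_X * (tgf ?O branchings * tgf ?O (\<lambda>_. 1) * tgf (etrees d) (\<lambda>_. 1))"
    by (rule tgf_node) (simp add: s_def sub)
  also have "tgf ?E (s RightE) = fps_const (1 / 4) * fps_X * (tgf ?O (\<lambda>_. 1) * tgf ?O branchings * tgf (etrees d) (\<lambda>_. 1))"
    by (rule tgf_node) (simp add: s_def sub)
  also have "tgf ?E (s NextE) = fps_const (1 / 4) * fps_X * (tgf ?O (\<lambda>_. 1) * tgf ?O (\<lambda>_. 1) * tgf (etrees d) branchings)"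
    by (rule tgf_node) (simp add: s_def sub)
  finally show ?thesis
    unfolding tgf_otrees_1 tgf_otrees_branchings Mgf_def[symmetric] Fgf_def[symmetric]
    by (simp add: algebra_simps)
qed


section \<open>Singular expansions at 1\<close>

definition puiseux :: "nat \<Rightarrow> complex \<Rightarrow> complex" where
  "puiseux d z = (1 - z) powr (1 / 2 ^ d)"

lemma Re_one_minus_pos: "norm z \<le> 1 \<Longrightarrow> z \<noteq> 1 \<Longrightarrow> 0 < Re (1 - z)"
proof (rule ccontr)
  assume *: "norm z \<le> 1" "z \<noteq> 1" "\<not> 0 < Re (1 - z)"
  then have "1 \<le> Re z" by simp
  moreover have "Re z \<le> 1" using *(1) complex_Re_le_cmod[of z] by linarith
  ultimately have Re: "Re z = 1" by simp
  have "(Re z)\<^sup>2 + (Im z)\<^sup>2 \<le> 1" using *(1) by (simp add: cmod_def)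
  then have "Im z = 0" using Re by simp
  then show False using *(2) Re by (simp add: complex_eq_iff)
qed

lemma puiseux_power:
  assumes "z \<noteq> 1"
  shows "puiseux d z ^ k = (1 - z) powr (of_nat k / 2 ^ d)"
proof (induction k)
  case 0
  then show ?case using assms by simp
next
  case (Suc k)
  then have "puiseux d z ^ Suc k = (1 - z) powr (1 / 2 ^ d + of_nat k / 2 ^ d)"
    by (simp add: powr_add puiseux_def)
  then show ?case by (simp add: add_divide_distrib)
qed

lemma puiseux_Suc: "z \<noteq> 1 \<Longrightarrow> puiseux (Suc d) z ^ 2 = puiseux d z"
  unfolding puiseux_power by (simp add: puiseux_def)

lemma puiseux_nonzero: "z \<noteq> 1 \<Longrightarrow> puiseux d z \<noteq> 0"
  by (simp add: puiseux_def)

lemma puiseux_full_power: "z \<noteq> 1 \<Longrightarrow> puiseux d z ^ (2 ^ d) = 1 - z"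
  by (simp add: puiseux_power)

lemma norm_puiseux: "norm (puiseux d z) = norm (1 - z) powr (1 / 2 ^ d)"
proof -
  have "(1 / 2 ^ d :: complex) = of_real (1 / 2 ^ d)" by simp
  then show ?thesis unfolding puiseux_def
    by (metis Re_complex_of_real Reals_of_real norm_powr_real_powr')
qed

text \<open>The principal argument of 1 - z is below pi/2 in modulus, and taking the root divides it
  by 2^d.\<close>

lemma Re_puiseux_pos:
  assumes "0 < Re (1 - z)"
  shows "0 < Re (puiseux d z)"
proof -
  have nz: "1 - z \<noteq> 0" using assms by auto
  have "\<bar>Im (Ln (1 - z))\<bar> < pi / 2" using Re_Ln_pos_lt[OF nz] assms by blast
  moreover have "\<bar>Im (Ln (1 - z)) / 2 ^ d\<bar> \<le> \<bar>Im (Ln (1 - z))\<bar> / 1"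
    unfolding abs_divide by (intro divide_left_mono) auto
  ultimately have "\<bar>Im (Ln (1 - z)) / 2 ^ d\<bar> < pi / 2" by linarith
  then have "0 < cos (Im (Ln (1 - z)) / 2 ^ d)" by (intro cos_gt_zero_pi) linarith+
  moreover have "puiseux d z = exp (Ln (1 - z) / of_real (2 ^ d))" using nz by (simp add: puiseux_def powr_def)
  then have "Re (puiseux d z) = exp (Re (Ln (1 - z)) / 2 ^ d) * cos (Im (Ln (1 - z)) / 2 ^ d)"
    by (simp only: Re_exp Re_divide_of_real Im_divide_of_real)
  ultimately show ?thesis by simp
qed

abbreviation disc_at_1 :: "complex filter" where
  "disc_at_1 \<equiv> at 1 within ball 0 1"

lemma eventually_disc_at_1: "\<forall>\<^sub>F z in disc_at_1. norm z < 1 \<and> z \<noteq> 1 \<and> 0 < Re (1 - z)"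
  unfolding eventually_at_filter using Re_one_minus_pos
  by (intro always_eventually) (auto dest: less_imp_le)

lemma tendsto_puiseux: "(puiseux d \<longlongrightarrow> 0) disc_at_1"
proof -
  have "((\<lambda>z::complex. norm (1 - z)) \<longlongrightarrow> norm (1 - 1 :: complex)) disc_at_1"
    by (intro tendsto_intros)
  then have "((\<lambda>z. norm (1 - z) powr (1 / 2 ^ d)) \<longlongrightarrow> 0 powr (1 / 2 ^ d)) disc_at_1"
    by (intro tendsto_powr') auto
  then have "((\<lambda>z. norm (puiseux d z)) \<longlongrightarrow> 0) disc_at_1" by (simp add: norm_puiseux)
  then show ?thesis by (rule tendsto_norm_zero_cancel)
qed

text \<open>A convergent Puiseux expansion at 1, with a pole of order at most \<open>p\<close> in \<open>puiseux d z\<close>.\<close>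

definition expands :: "nat \<Rightarrow> nat \<Rightarrow> (complex \<Rightarrow> complex) \<Rightarrow> (complex \<Rightarrow> complex) \<Rightarrow> bool" where
  "expands d p H \<Psi> \<longleftrightarrow> \<Psi> analytic_on {0} \<and>
     (\<forall>\<^sub>F z in disc_at_1. H z * puiseux d z ^ p = \<Psi> (puiseux d z))"

lemma expands_const: "expands d 0 (\<lambda>_. c) (\<lambda>_. c)"
  by (simp add: expands_def)

lemma expands_ident: "expands d 0 (\<lambda>z. z) (\<lambda>t. 1 - t ^ (2 ^ d))"
  unfolding expands_def
  by (auto intro!: analytic_intros eventually_mono[OF eventually_disc_at_1] simp: puiseux_full_power)

lemma expands_add:
  assumes "expands d p H \<Psi>" "expands d p G \<Phi>"
  shows "expands d p (\<lambda>z. H z + G z) (\<lambda>t. \<Psi> t + \<Phi> t)"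
proof -
  have "\<forall>\<^sub>F z in disc_at_1. (H z + G z) * puiseux d z ^ p = \<Psi> (puiseux d z) + \<Phi> (puiseux d z)"
    using assms[unfolded expands_def, THEN conjunct2] by eventually_elim (simp add: algebra_simps)
  then show ?thesis using assms by (simp add: expands_def analytic_on_add)
qed

lemma expands_mult:
  assumes "expands d p H \<Psi>" "expands d q G \<Phi>"
  shows "expands d (p + q) (\<lambda>z. H z * G z) (\<lambda>t. \<Psi> t * \<Phi> t)"
proof -
  have "\<forall>\<^sub>F z in disc_at_1. (H z * G z) * puiseux d z ^ (p + q) = \<Psi> (puiseux d z) * \<Phi> (puiseux d z)"
    using assms[unfolded expands_def, THEN conjunct2]
  proof eventually_elim
    case (elim z)
    have "(H z * G z) * puiseux d z ^ (p + q) = (H z * puiseux d z ^ p) * (G z * puiseux d z ^ q)"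
      by (simp add: power_add)
    then show ?case unfolding elim .
  qed
  then show ?thesis using assms by (simp add: expands_def analytic_on_mult)
qed

lemma expands_weaken:
  "expands d p H \<Psi> \<Longrightarrow> expands d (p + k) H (\<lambda>t. \<Psi> t * t ^ k)"
  unfolding expands_def power_add
  by (auto intro!: analytic_intros elim!: eventually_mono simp: algebra_simps)

text \<open>Since \<open>puiseux d\<close> is the square of \<open>puiseux (Suc d)\<close>, an
  expansion in one dimension becomes an expansion in the next, with doubled pole order.\<close>

lemma expands_refine:
  assumes "expands d p H \<Psi>"
  shows "expands (Suc d) (2 * p) H (\<lambda>t. \<Psi> (t ^ 2))"
proof -
  have "\<Psi> \<circ> (\<lambda>t. t ^ 2) analytic_on {0}"
    using assms by (intro analytic_on_compose analytic_intros) (auto simp: expands_def)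
  moreover have "\<forall>\<^sub>F z in disc_at_1. H z * puiseux (Suc d) z ^ (2 * p) = \<Psi> (puiseux (Suc d) z ^ 2)"
    using assms[unfolded expands_def, THEN conjunct2] eventually_disc_at_1
    by eventually_elim (simp add: power_mult puiseux_Suc)
  ultimately show ?thesis unfolding expands_def o_def by blast
qed

section \<open>The closed form of the series on the closed disc\<close>

fun sfun :: "nat \<Rightarrow> complex \<Rightarrow> complex" where
  "sfun 0 z = 0"
| "sfun (Suc d) z = csqrt (1 - z * ((1 - sfun d z) * inverse (1 + sfun d z)))"

text \<open>The base value 0 of \<open>sfun\<close> makes \<open>Ffun 0\<close> the constant 1. The
  principal root gives \<open>sfun (Suc d) 0 = 1\<close>, which selects the solution of the
  quadratic equation that vanishes at 0, as a series without a constant term must.\<close>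

definition Ffun :: "nat \<Rightarrow> complex \<Rightarrow> complex" where
  "Ffun d z = (1 - sfun d z) * inverse (1 + sfun d z)"

declare sfun.simps(2) [simp del]

lemma sfun_Suc: "sfun (Suc d) z = csqrt (1 - z * Ffun d z)"
  unfolding Ffun_def sfun.simps(2) ..

lemma Re_csqrt_nonneg: "0 \<le> Re (csqrt w)"
  using csqrt_principal[of w] by linarith

lemma Re_sfun_nonneg: "0 \<le> Re (sfun d z)"
proof (cases d)
  case (Suc k)
  show ?thesis unfolding Suc sfun_Suc by (rule Re_csqrt_nonneg)
qed simp

lemma one_plus_sfun_nonzero: "1 + sfun d z \<noteq> 0"
  using Re_sfun_nonneg[of d z] by (auto simp: complex_eq_iff)

lemma norm_one_minus_plus:
  fixes s :: complex
  shows "(norm (1 + s))\<^sup>2 - (norm (1 - s))\<^sup>2 = 4 * Re s"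
  unfolding cmod_power2 plus_complex.sel minus_complex.sel one_complex.sel
  by algebra

lemma norm_Ffun: "norm (Ffun d z) = norm (1 - sfun d z) / norm (1 + sfun d z)"
  unfolding Ffun_def norm_mult norm_inverse by (rule divide_inverse[symmetric])

lemma norm_one_plus_sfun_pos: "0 < norm (1 + sfun d z)"
  unfolding zero_less_norm_iff by (rule one_plus_sfun_nonzero)

text \<open>The Cayley transform (1 - s) / (1 + s) maps the right half plane into the unit
  disc.\<close>

lemma norm_Ffun_less:
  assumes "0 < Re (sfun d z)"
  shows "norm (Ffun d z) < 1"
proof -
  have "(norm (1 - sfun d z))\<^sup>2 < (norm (1 + sfun d z))\<^sup>2"
    using norm_one_minus_plus[of "sfun d z"] assms by linarith
  then have "norm (1 - sfun d z) < norm (1 + sfun d z)"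
    by (rule power2_less_imp_less) (rule norm_ge_zero)
  then show ?thesis unfolding norm_Ffun using norm_one_plus_sfun_pos by (simp only: divide_less_eq_1_pos)
qed

lemma Re_pos_csqrt:
  assumes "0 < Re w"
  shows "0 < Re (csqrt w)"
proof (rule ccontr)
  assume "\<not> 0 < Re (csqrt w)"
  then have "Re (csqrt w) = 0" using Re_csqrt_nonneg[of w] by linarith
  moreover have "Re w = (Re (csqrt w))\<^sup>2 - (Im (csqrt w))\<^sup>2"
    using Re_power2[of "csqrt w"] unfolding power2_csqrt .
  ultimately have "Re w \<le> 0" by (metis diff_le_0_iff_le zero_power2 zero_le_power2)
  then show False using assms by linarith
qed

text \<open>The bounds feed each other along \<open>d\<close>: if s has positive real part, its
  Cayley transform F has modulus below 1, so 1 - z F has positive real part, and so has its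
  principal root. The assumption \<open>z \<noteq> 1\<close> enters only at the start, where F is
  the constant 1. Hence the radicands avoid the branch cut everywhere on the closed disc except at
  1.\<close>

lemma Re_sfun_pos:
  assumes "norm z \<le> 1" "z \<noteq> 1"
  shows "0 < Re (sfun (Suc d) z)" "0 < Re (1 - z * Ffun d z)"
proof -
  have "0 < Re (1 - z * Ffun d z) \<and> 0 < Re (sfun (Suc d) z)"
  proof (induction d)
    case 0
    have "0 < Re (1 - z)" using assms by (rule Re_one_minus_pos)
    moreover have "1 - z * Ffun 0 z = 1 - z" by (simp add: Ffun_def)
    ultimately show ?case unfolding sfun_Suc using Re_pos_csqrt[of "1 - z"] by (metis)
  next
    case (Suc d)
    have "norm (z * Ffun (Suc d) z) < 1"
    proof -
      have "norm (z * Ffun (Suc d) z) \<le> norm (Ffun (Suc d) z)"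
        using assms by (simp add: norm_mult mult_left_le_one_le)
      then show ?thesis using norm_Ffun_less[of "Suc d" z] Suc by linarith
    qed
    then have "Re (z * Ffun (Suc d) z) < 1"
      using complex_Re_le_cmod[of "z * Ffun (Suc d) z"] by linarith
    then have "0 < Re (1 - z * Ffun (Suc d) z)" by simp
    then show ?case unfolding sfun_Suc[of "Suc d"] using Re_pos_csqrt by blast
  qed
  then show "0 < Re (sfun (Suc d) z)" "0 < Re (1 - z * Ffun d z)" by auto
qed

lemma notin_nonpos_Reals_if_Re_pos: "0 < Re w \<Longrightarrow> w \<notin> \<real>\<^sub>\<le>\<^sub>0"
  by (auto simp: complex_nonpos_Reals_iff)

lemma sfun_analytic: "sfun d analytic_on cball 0 1 - {1}"
proof (induction d)
  case 0
  have "sfun 0 = (\<lambda>_. 0)" by auto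
  then show ?case by simp
next
  case (Suc d)
  have "(\<lambda>z. csqrt (1 - z * ((1 - sfun d z) * inverse (1 + sfun d z)))) analytic_on cball 0 1 - {1}"
  proof (intro analytic_intros Suc)
    fix z :: complex assume "z \<in> cball 0 1 - {1}"
    then have "1 - z * Ffun d z \<notin> \<real>\<^sub>\<le>\<^sub>0"
      by (intro notin_nonpos_Reals_if_Re_pos Re_sfun_pos(2)) auto
    then show "1 - z * ((1 - sfun d z) * inverse (1 + sfun d z)) \<notin> \<real>\<^sub>\<le>\<^sub>0"
      unfolding Ffun_def .
  qed (rule one_plus_sfun_nonzero)
  then show ?case unfolding sfun.simps(2) .
qed

lemma Ffun_analytic: "Ffun d analytic_on cball 0 1 - {1}"
proof -
  have "(\<lambda>z. (1 - sfun d z) * inverse (1 + sfun d z)) analytic_on cball 0 1 - {1}"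
    using sfun_analytic[of d] one_plus_sfun_nonzero by (intro analytic_intros) auto
  then show ?thesis unfolding Ffun_def .
qed

text \<open>Both factors have argument below pi/4 in modulus: \<open>\<tau>\<close> because it and
  its square have positive real part, \<open>\<sigma>\<close> because it tends to a positive real.
  Their product thus has positive real part and is the principal root of its square.\<close>

lemma csqrt_times_near:
  assumes "(\<sigma> \<longlongrightarrow> of_real c) F" "0 < c" "\<forall>\<^sub>F z in F. 0 < Re (\<tau> z) \<and> 0 < Re (\<tau> z ^ 2)"
  shows "\<forall>\<^sub>F z in F. csqrt (\<tau> z ^ 2 * \<sigma> z ^ 2) = \<tau> z * \<sigma> z"
proof -
  have "((\<lambda>z. Re (\<sigma> z) - \<bar>Im (\<sigma> z)\<bar>) \<longlongrightarrow> Re (of_real c) - \<bar>Im (of_real c)\<bar>) F"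
    using assms(1) by (intro tendsto_intros)
  then have "\<forall>\<^sub>F z in F. 0 < Re (\<sigma> z) - \<bar>Im (\<sigma> z)\<bar>"
    using assms(2) by (intro order_tendstoD(1)) auto
  with assms(3) show ?thesis
  proof eventually_elim
    case (elim z)
    have "(Im (\<tau> z))\<^sup>2 < (Re (\<tau> z))\<^sup>2" using elim(1) by (simp add: Re_power2)
    then have "\<bar>Im (\<tau> z)\<bar> < Re (\<tau> z)" using elim(1)
      by (metis abs_of_pos power2_abs power2_less_imp_less less_imp_le)
    moreover have "\<bar>Im (\<sigma> z)\<bar> < Re (\<sigma> z)" using elim(2) by simp
    ultimately have "\<bar>Im (\<tau> z)\<bar> * \<bar>Im (\<sigma> z)\<bar> < Re (\<tau> z) * Re (\<sigma> z)"
      by (intro mult_strict_mono') auto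
    then have "0 < Re (\<tau> z * \<sigma> z)" by (auto simp: abs_mult[symmetric])
    then show ?case by (intro csqrt_unique) (auto simp: power_mult_distrib)
  qed
qed

text \<open>If s = t \<sigma>(t) with \<sigma>(0) = c, then the next radicand is t \<psi>(t) with
  \<psi>(0) = 2 c. Writing t as the square of the next local parameter \<tau> gives \<tau>
  sqrt(\<psi>(\<tau>^2)), with constant sqrt(2 c). Positivity of c is carried along because it keeps
  this root analytic at 0.\<close>

lemma sfun_expansion:
  "\<exists>\<sigma> c. \<sigma> analytic_on {0} \<and> \<sigma> 0 = of_real c \<and> 0 < c \<and>
     (\<forall>\<^sub>F z in disc_at_1. sfun (Suc d) z = puiseux (Suc d) z * \<sigma> (puiseux (Suc d) z))"
proof (induction d)
  case 0
  have "sfun (Suc 0) z = puiseux (Suc 0) z" for z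
    unfolding sfun_Suc puiseux_def csqrt_conv_powr by (simp add: Ffun_def)
  then show ?case by (intro exI[of _ "\<lambda>_. 1"] exI[of _ 1]) auto
next
  case (Suc d)
  then obtain \<sigma> c where \<sigma>: "\<sigma> analytic_on {0}" "\<sigma> 0 = of_real c" "0 < c"
    "\<forall>\<^sub>F z in disc_at_1. sfun (Suc d) z = puiseux (Suc d) z * \<sigma> (puiseux (Suc d) z)" by blast
  define N :: nat where "N = 2 ^ Suc d - 2"
  have "(2::nat) \<le> 2 ^ Suc d" by simp
  then have N: "2 ^ Suc d = N + 2" unfolding N_def by linarith
  \<comment> \<open>Obtained from 1 - (1 - t^(N+2)) (1 - t \<sigma>) / (1 + t \<sigma>) by dividing
    out t. Here z = 1 - t^(N+2), and N only serves to write the exponents without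
    subtraction.\<close>
  define \<psi> where "\<psi> t = (2 * \<sigma> t + t ^ (N + 1) - t ^ (N + 2) * \<sigma> t) * inverse (1 + t * \<sigma> t)" for t
  have \<psi>: "\<psi> analytic_on {0}"
    unfolding \<psi>_def using \<sigma>(1) by (intro analytic_intros) auto
  have \<psi>0: "\<psi> 0 = of_real (2 * c)" by (simp add: \<psi>_def \<sigma>(2))
  define \<sigma>' where "\<sigma>' \<tau> = csqrt (\<psi> (\<tau> ^ 2))" for \<tau>
  have "\<psi> \<circ> (\<lambda>\<tau>. \<tau> ^ 2) analytic_on {0}"
    using \<psi> by (intro analytic_on_compose analytic_intros) auto
  then have \<sigma>'_an: "\<sigma>' analytic_on {0}"
    unfolding \<sigma>'_def o_def using \<psi>0 \<sigma>(3)
    by (intro analytic_intros) (auto simp: complex_nonpos_Reals_iff)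
  have \<sigma>'0: "\<sigma>' 0 = of_real (sqrt (2 * c))"
    unfolding \<sigma>'_def using \<psi>0 \<sigma>(3) of_real_sqrt[of "2 * c"] by simp
  have "isCont \<sigma>' 0" using \<sigma>'_an by (simp add: analytic_at_imp_isCont)
  then have "((\<lambda>z. \<sigma>' (puiseux (Suc (Suc d)) z)) \<longlongrightarrow> of_real (sqrt (2 * c))) disc_at_1"
    using tendsto_puiseux \<sigma>'0 isCont_tendsto_compose by fastforce
  moreover have "\<forall>\<^sub>F z in disc_at_1. 0 < Re (puiseux (Suc (Suc d)) z) \<and> 0 < Re (puiseux (Suc (Suc d)) z ^ 2)"
    using eventually_disc_at_1 by eventually_elim (auto simp: puiseux_Suc Re_puiseux_pos)
  ultimately have "\<forall>\<^sub>F z in disc_at_1. csqrt (puiseux (Suc (Suc d)) z ^ 2 * \<sigma>' (puiseux (Suc (Suc d)) z) ^ 2)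
      = puiseux (Suc (Suc d)) z * \<sigma>' (puiseux (Suc (Suc d)) z)"
    using \<sigma>(3) by (intro csqrt_times_near[where c = "sqrt (2 * c)"]) auto
  then have "\<forall>\<^sub>F z in disc_at_1. sfun (Suc (Suc d)) z = puiseux (Suc (Suc d)) z * \<sigma>' (puiseux (Suc (Suc d)) z)"
    using \<sigma>(4) eventually_disc_at_1
  proof eventually_elim
    case (elim z)
    let ?t = "puiseux (Suc d) z"
    have t: "puiseux (Suc (Suc d)) z ^ 2 = ?t" using elim by (simp add: puiseux_Suc)
    have z: "z = 1 - ?t ^ (N + 2)" using elim puiseux_full_power[of z "Suc d"] by (simp only: N) simp
    have nz: "1 + ?t * \<sigma> ?t \<noteq> 0" using one_plus_sfun_nonzero[of "Suc d" z] elim(2) by simp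
    have "1 - z * Ffun (Suc d) z = 1 - (1 - ?t ^ (N + 2)) * ((1 - ?t * \<sigma> ?t) * inverse (1 + ?t * \<sigma> ?t))"
      unfolding Ffun_def elim(2) using z by simp
    also have "\<dots> = ?t * \<psi> ?t"
      using nz unfolding \<psi>_def by (simp add: divide_simps) (simp add: algebra_simps)
    finally have "1 - z * Ffun (Suc d) z = puiseux (Suc (Suc d)) z ^ 2 * \<sigma>' (puiseux (Suc (Suc d)) z) ^ 2"
      by (simp add: t \<sigma>'_def)
    then show ?case unfolding sfun_Suc[of "Suc d"] using elim(1) by simp
  qed
  then show ?case using \<sigma>'_an \<sigma>'0 \<sigma>(3) by (intro exI[of _ \<sigma>'] exI[of _ "sqrt (2 * c)"]) auto
qed

text \<open>To first order F is 1 - 2 c t. The nonzero linear coefficient is what later makes the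
  order of the coefficients exact.\<close>

lemma Ffun_expansion:
  "\<exists>\<Phi> b. expands (Suc d) 0 (Ffun (Suc d)) \<Phi> \<and> deriv \<Phi> 0 = of_real b \<and> b < 0"
proof -
  obtain \<sigma> c where \<sigma>: "\<sigma> analytic_on {0}" "\<sigma> 0 = of_real c" "0 < c"
    "\<forall>\<^sub>F z in disc_at_1. sfun (Suc d) z = puiseux (Suc d) z * \<sigma> (puiseux (Suc d) z)"
    using sfun_expansion by blast
  define \<Phi> where "\<Phi> t = (1 - t * \<sigma> t) * inverse (1 + t * \<sigma> t)" for t
  have "\<Phi> analytic_on {0}" unfolding \<Phi>_def using \<sigma>(1) by (intro analytic_intros) auto
  then have "expands (Suc d) 0 (Ffun (Suc d)) \<Phi>"
    unfolding expands_def using \<sigma>(4) by (auto elim!: eventually_mono simp: \<Phi>_def Ffun_def)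
  moreover have "(\<sigma> has_field_derivative deriv \<sigma> 0) (at 0)"
    using \<sigma>(1) by (simp add: analytic_on_imp_differentiable_at DERIV_deriv_iff_field_differentiable)
  then have "(\<Phi> has_field_derivative - 2 * \<sigma> 0) (at 0)"
    unfolding \<Phi>_def by (auto intro!: derivative_eq_intros)
  then have "deriv \<Phi> 0 = of_real (- 2 * c)" by (simp add: DERIV_imp_deriv \<sigma>(2))
  ultimately show ?thesis using \<sigma>(3) by (intro exI[of _ \<Phi>] exI[of _ "- 2 * c"]) auto
qed

lemma inverse_sfun_expansion: "\<exists>\<Phi>. expands (Suc d) 1 (\<lambda>z. inverse (sfun (Suc d) z)) \<Phi>"
proof -
  obtain \<sigma> c where \<sigma>: "\<sigma> analytic_on {0}" "\<sigma> 0 = of_real c" "0 < c"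
    "\<forall>\<^sub>F z in disc_at_1. sfun (Suc d) z = puiseux (Suc d) z * \<sigma> (puiseux (Suc d) z)"
    using sfun_expansion by blast
  have "(\<lambda>t. inverse (\<sigma> t)) analytic_on {0}" using \<sigma> by (intro analytic_intros) auto
  moreover have "\<forall>\<^sub>F z in disc_at_1. inverse (sfun (Suc d) z) * puiseux (Suc d) z ^ 1 = inverse (\<sigma> (puiseux (Suc d) z))"
    using \<sigma>(4) eventually_disc_at_1
    by eventually_elim (simp add: puiseux_nonzero)
  ultimately show ?thesis unfolding expands_def by blast
qed

section \<open>Transfer from the expansion at 1 to the coefficients\<close>

definition dquot :: "(complex \<Rightarrow> complex) \<Rightarrow> complex \<Rightarrow> complex" where
  "dquot f t = (if t = 0 then deriv f 0 else (f t - f 0) / t)"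

lemma dquot_eq: "f t = f 0 + t * dquot f t"
  by (simp add: dquot_def)

lemma dquot_0: "dquot f 0 = deriv f 0"
  by (simp add: dquot_def)

lemma dquot_analytic:
  assumes "f analytic_on {0}"
  shows "dquot f analytic_on {0}"
proof (rule pole_theorem_analytic_0)
  show "(\<lambda>t. f t - f 0) analytic_on {0}" using assms by (intro analytic_intros)
  show "\<exists>d>0. \<forall>w\<in>ball z d - {0}. f w - f 0 = (w - 0) * dquot f w" if "z \<in> {0}" for z
    using dquot_eq[of f] by (intro exI[of _ 1]) (auto simp: dquot_def)
  have "deriv (\<lambda>t. f t - f 0) 0 = deriv f 0 - deriv (\<lambda>_. f 0) 0"
    using assms by (intro deriv_diff) (auto simp: analytic_on_imp_differentiable_at)
  then show "dquot f 0 = deriv (\<lambda>t. f t - f 0) 0" by (simp add: dquot_0)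
qed simp

lemma dquot_pow_analytic: "f analytic_on {0} \<Longrightarrow> (dquot ^^ K) f analytic_on {0}"
  by (induction K) (auto intro: dquot_analytic)

text \<open>\<open>dquot\<close> is the backward shift on power series at 0. Its iterates, evaluated
  at 0, are the Taylor coefficients, and the \<open>K\<close>-th iterate is the Taylor remainder
  divided by t^K, still analytic at 0.\<close>

lemma dquot_taylor:
  "f t = (\<Sum>k<K. (dquot ^^ k) f 0 * t ^ k) + t ^ K * (dquot ^^ K) f t"
proof (induction K)
  case (Suc K)
  have "(dquot ^^ K) f t = (dquot ^^ K) f 0 + t * (dquot ^^ Suc K) f t"
    using dquot_eq[of "(dquot ^^ K) f" t] by simp
  then show ?case using Suc by (simp add: algebra_simps)
qed simp

text \<open>Cauchy's inequality is applied to the second derivative on circles of radius x < 1, and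
  x tends to 1. Undoing the two differentiations yields the denominator, so nothing is assumed on
  the unit circle itself.\<close>

lemma fps_nth_bound_of_second_deriv:
  assumes hol: "R holomorphic_on ball 0 1" and R: "R has_fps_expansion r"
    and B: "\<And>z. norm z < 1 \<Longrightarrow> norm ((deriv ^^ 2) R z) \<le> B"
  shows "norm (fps_nth r (n + 2)) \<le> B / ((real n + 1) * (real n + 2))"
proof -
  let ?f = "(deriv ^^ 2) R"
  have holf: "?f holomorphic_on ball 0 1" using hol by (intro holomorphic_higher_deriv) auto
  have "B * fact n \<ge> norm ((deriv ^^ n) ?f 0)"
  proof (rule tendsto_lowerbound)
    show "((\<lambda>x. fact n * B / x ^ n) \<longlongrightarrow> B * fact n) (at_left (1::real))"
      by (auto intro!: tendsto_eq_intros)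
    have "\<forall>\<^sub>F x in at_left (1::real). x \<in> {0<..<1}"
      by (rule eventually_at_left_real) simp
    then show "\<forall>\<^sub>F x in at_left (1::real). norm ((deriv ^^ n) ?f 0) \<le> fact n * B / x ^ n"
    proof eventually_elim
      case (elim x)
      show ?case
      proof (rule Cauchy_inequality)
        show "?f holomorphic_on ball 0 x" "continuous_on (cball 0 x) ?f"
          using holf elim by (auto elim!: holomorphic_on_subset
              intro!: holomorphic_on_imp_continuous_on holomorphic_on_subset[OF holf])
        show "norm (?f z) \<le> B" if "norm (0 - z) = x" for z using B that elim by simp
      qed (use elim in auto)
    qed
  qed simp
  moreover have "fps_nth r (n + 2) = (deriv ^^ (n + 2)) R 0 / fact (n + 2)"
    by (rule fps_nth_fps_expansion[OF R])
  moreover have "(deriv ^^ (n + 2)) R 0 = (deriv ^^ n) ?f 0" by (simp only: funpow_add o_apply)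
  ultimately have "norm (fps_nth r (n + 2)) \<le> B * fact n / fact (n + 2)"
    by (simp only: norm_divide norm_fact) (intro divide_right_mono, auto)
  also have "(fact (n + 2) :: real) = (real n + 1) * (real n + 2) * fact n" by (simp add: algebra_simps)
  also have "B * fact n / ((real n + 1) * (real n + 2) * fact n) = B / ((real n + 1) * (real n + 2))"
    by (rule nonzero_mult_divide_mult_cancel_right) simp
  finally show ?thesis .
qed

text \<open>The point 1 is a branch point, so the radius of a Cauchy estimate must shrink with |1 -
  z|. On such a disc the function is O(|1 - z|^2), because \<open>\<Psi>\<close> is bounded near 0,
  and this cancels the inverse square of the radius.\<close>

lemma second_deriv_bound_near_1:
  assumes \<Psi>: "\<Psi> analytic_on {0}"
  shows "\<exists>\<delta>>0. \<exists>B. \<forall>z. norm z < 1 \<and> norm (1 - z) < \<delta> \<longrightarrow>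
    norm ((deriv ^^ 2) (\<lambda>z. (1 - z)\<^sup>2 * \<Psi> (puiseux d z)) z) \<le> B"
proof -
  define G where "G z = (1 - z)\<^sup>2 * \<Psi> (puiseux d z)" for z
  obtain \<epsilon>0 where \<epsilon>0: "\<epsilon>0 > 0" "\<Psi> holomorphic_on ball 0 \<epsilon>0" using \<Psi> by (auto simp: analytic_on_def)
  define \<epsilon> where "\<epsilon> = \<epsilon>0 / 2"
  have \<epsilon>: "0 < \<epsilon>" "\<epsilon> < \<epsilon>0" using \<epsilon>0(1) by (auto simp: \<epsilon>_def)
  have "compact (\<Psi> ` cball 0 \<epsilon>)"
    using \<epsilon> by (intro compact_continuous_image holomorphic_on_imp_continuous_on
        holomorphic_on_subset[OF \<epsilon>0(2)]) auto
  then obtain M where "\<forall>x\<in>\<Psi> ` cball 0 \<epsilon>. norm x \<le> M" using compact_imp_bounded bounded_iff by metis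
  then have M: "norm (\<Psi> t) \<le> M" if "norm t \<le> \<epsilon>" for t using that by simp
  have M0: "0 \<le> M" using order_trans[OF norm_ge_zero M[of 0]] \<epsilon>(1) by simp
  define \<delta>1 where "\<delta>1 = \<epsilon> powr (2 ^ d)"
  have \<delta>1: "0 < \<delta>1" using \<epsilon>(1) by (simp add: \<delta>1_def)
  have t: "norm (puiseux d z) < \<epsilon>" if "norm (1 - z) < \<delta>1" for z
  proof (cases "z = 1")
    case True
    then show ?thesis using \<epsilon>(1) by (simp add: puiseux_def)
  next
    case False
    then have "norm (1 - z) powr (1 / 2 ^ d) < \<delta>1 powr (1 / 2 ^ d)"
      using that by (intro powr_less_mono2) auto
    then show ?thesis using \<epsilon>(1) by (simp add: norm_puiseux \<delta>1_def powr_powr)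
  qed
  define U :: "complex set" where "U = {z. norm (1 - z) < \<delta>1 \<and> 1 - z \<notin> \<real>\<^sub>\<le>\<^sub>0}"
  have holp: "puiseux d holomorphic_on U"
    unfolding puiseux_def U_def by (intro holomorphic_intros) auto
  have holG: "G holomorphic_on U"
  proof -
    have "\<Psi> \<circ> puiseux d holomorphic_on U"
      using t \<epsilon> by (intro holomorphic_on_compose_gen[OF holp \<epsilon>0(2)]) (force simp: U_def)
    then show ?thesis unfolding G_def o_def by (intro holomorphic_intros)
  qed
  \<comment> \<open>The function is at most 9 M \<rho>^2, relaxed to 12 (M + 1) \<rho>^2 so that the
    inequality is strict even for M = 0, as the open ball requires. The factor 2! of Cauchy's
    estimate makes 24.\<close>
  have "norm ((deriv ^^ 2) G z) \<le> 24 * (M + 1)" if z: "norm z < 1" "norm (1 - z) < \<delta>1 / 2" for z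
  proof -
    \<comment> \<open>A point z with Re z < 1 has distance |1 - z| from the cut, the real ray
      starting at 1. Half of it keeps the closed disc away from the cut and within 3 |1 - z| / 2 of
      1, which is below \<open>\<delta>1\<close>.\<close>
    define \<rho> where "\<rho> = norm (1 - z) / 2"
    have z1: "z \<noteq> 1" using z by auto
    have Rez: "0 < Re (1 - z)" using z z1 Re_one_minus_pos by simp
    have \<rho>: "0 < \<rho>" using z1 by (simp add: \<rho>_def)
    have near: "norm (1 - w) \<le> 3 * \<rho>" if "w \<in> cball z \<rho>" for w
    proof -
      have "norm (1 - w) \<le> norm (1 - z) + norm (z - w)"
        using norm_triangle_ineq[of "1 - z" "z - w"] by simp
      then show ?thesis using that by (simp add: \<rho>_def dist_norm)
    qed
    have sub: "cball z \<rho> \<subseteq> U"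
    proof
      fix w assume w: "w \<in> cball z \<rho>"
      have "1 - w \<notin> \<real>\<^sub>\<le>\<^sub>0"
      proof
        assume "1 - w \<in> \<real>\<^sub>\<le>\<^sub>0"
        then have w1: "Im (1 - w) = 0" "Re (1 - w) \<le> 0" by (auto simp: complex_nonpos_Reals_iff)
        have "norm (1 - z) \<le> norm ((1 - z) - (1 - w))"
        proof (rule power2_le_imp_le)
          have "(Re (1 - z))\<^sup>2 \<le> (Re ((1 - z) - (1 - w)))\<^sup>2"
            using Rez w1(2) by (intro power_mono) auto
          moreover have "Im ((1 - z) - (1 - w)) = Im (1 - z)" using w1(1) by simp
          ultimately show "(norm (1 - z))\<^sup>2 \<le> (norm ((1 - z) - (1 - w)))\<^sup>2"
            unfolding cmod_power2 by simp
        qed simp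
        also have "\<dots> = norm (z - w)" by (simp add: norm_minus_commute)
        also have "\<dots> \<le> \<rho>" using w by (simp add: dist_norm)
        finally show False using \<rho> by (simp add: \<rho>_def)
      qed
      moreover have "norm (1 - w) < \<delta>1" using near[OF w] z(2) \<delta>1 by (simp add: \<rho>_def)
      ultimately show "w \<in> U" by (simp add: U_def)
    qed
    have "norm ((deriv ^^ 2) G z) \<le> fact 2 * (12 * \<rho>\<^sup>2 * (M + 1)) / \<rho> ^ 2"
    proof (rule Cauchy_higher_deriv_bound[where y = 0])
      show "G holomorphic_on ball z \<rho>" "continuous_on (cball z \<rho>) G"
        using sub holG by (auto intro!: holomorphic_on_imp_continuous_on holomorphic_on_subset[OF holG])
      show "G w \<in> ball 0 (12 * \<rho>\<^sup>2 * (M + 1))" if "w \<in> ball z \<rho>" for w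
      proof -
        have w: "w \<in> cball z \<rho>" using that by simp
        have "norm (G w) = (norm (1 - w))\<^sup>2 * norm (\<Psi> (puiseux d w))"
          by (simp add: G_def norm_mult norm_power)
        also have "\<dots> \<le> (3 * \<rho>)\<^sup>2 * M"
          using near[OF w] M[of "puiseux d w"] t[of w] sub w M0
          by (intro mult_mono power_mono) (auto simp: U_def)
        also have "\<dots> = \<rho>\<^sup>2 * (9 * M)" by (simp add: power_mult_distrib)
        also have "\<dots> < \<rho>\<^sup>2 * (12 * (M + 1))"
          using \<rho> M0 by (intro mult_strict_left_mono) auto
        also have "\<dots> = 12 * \<rho>\<^sup>2 * (M + 1)" by simp
        finally show ?thesis by simp
      qed
    qed (use \<rho> in auto)
    also have "\<dots> = 24 * (M + 1)" using \<rho> by (simp add: fact_numeral)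
    finally show ?thesis .
  qed
  then show ?thesis unfolding G_def using \<delta>1
    by (intro exI[of _ "\<delta>1 / 2"] conjI exI[of _ "24 * (M + 1)"]) auto
qed

text \<open>What is left of the closed disc is compact, and \<open>R\<close> is analytic at each of
  its points, those on the circle included.\<close>

lemma second_deriv_bound_away:
  assumes "R analytic_on cball 0 1 - {1}" "0 < \<delta>"
  shows "\<exists>B. \<forall>z. norm z < 1 \<and> \<delta> \<le> norm (1 - z) \<longrightarrow> norm ((deriv ^^ 2) R z) \<le> B"
proof -
  have "(deriv ^^ 2) R analytic_on cball 0 1 - {1}" using assms by (intro analytic_higher_deriv)
  then have "continuous_on (cball 0 1 - ball 1 \<delta>) ((deriv ^^ 2) R)"
    using assms(2) by (intro holomorphic_on_imp_continuous_on analytic_imp_holomorphic)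
      (auto elim: analytic_on_subset)
  then have "compact ((deriv ^^ 2) R ` (cball 0 1 - ball 1 \<delta>))"
    by (intro compact_continuous_image compact_diff) auto
  then obtain B where "\<forall>x\<in>(deriv ^^ 2) R ` (cball 0 1 - ball 1 \<delta>). norm x \<le> B"
    using compact_imp_bounded bounded_iff by metis
  then show ?thesis by (intro exI[of _ B]) (auto simp: dist_norm)
qed

lemma one_minus_powr_expansion:
  "(\<lambda>z :: complex. (1 - z) powr c) has_fps_expansion Abs_fps (\<lambda>n. (- 1) ^ n * (c gchoose n))"
proof -
  have "((\<lambda>z :: complex. (1 + z) powr c) \<circ> (\<lambda>z. - z)) has_fps_expansion (fps_binomial c oo (- fps_X))"
    by (intro has_fps_expansion_compose fps_expansion_intros) auto
  moreover have "fps_binomial c oo (- fps_X) = Abs_fps (\<lambda>n. (- 1) ^ n * (c gchoose n))"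
    by (rule fps_ext) (simp add: fps_compose_uminus')
  ultimately show ?thesis by (simp add: o_def)
qed

text \<open>
  After subtraction of the first \<open>K\<close> terms of the expansion, \<open>(1 - z)^2\<close> can be factored out. The second
  derivative of the remainder is then bounded, so that its coefficients are \<open>O(n^-2)\<close>.
\<close>

theorem expands_coefficients:
  assumes an: "H analytic_on cball 0 1 - {1}" and ex: "expands d p H \<Psi>" and h: "H has_fps_expansion h"
  defines "K \<equiv> 2 * 2 ^ d + p"
  shows "\<exists>B. \<forall>n\<ge>2. norm (fps_nth h n -
    (\<Sum>k<K. (dquot ^^ k) \<Psi> 0 * ((- 1) ^ n * (((of_nat k - of_nat p) / 2 ^ d) gchoose n)))) \<le> B / (real n * (real n - 1))"
proof -
  let ?c = "\<lambda>k. (of_nat k - of_nat p) / 2 ^ d :: complex"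
  let ?\<psi> = "\<lambda>k. (dquot ^^ k) \<Psi> 0"
  define R where "R z = H z - (\<Sum>k<K. ?\<psi> k * (1 - z) powr ?c k)" for z
  define r where "r = h - (\<Sum>k<K. fps_const (?\<psi> k) * Abs_fps (\<lambda>n. (- 1) ^ n * (?c k gchoose n)))"
  have \<Psi>: "\<Psi> analytic_on {0}" using ex by (simp add: expands_def)
  have Rr: "R has_fps_expansion r"
    unfolding R_def r_def by (intro fps_expansion_intros h one_minus_powr_expansion)
  have anR: "R analytic_on cball 0 1 - {1}"
    unfolding R_def using an Re_one_minus_pos notin_nonpos_Reals_if_Re_pos
    by (intro analytic_intros) auto
  have holR: "R holomorphic_on ball 0 1"
    by (rule analytic_imp_holomorphic, rule analytic_on_subset[OF anR]) auto
  define G where "G z = (1 - z)\<^sup>2 * (dquot ^^ K) \<Psi> (puiseux d z)" for z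
  have "\<forall>\<^sub>F z in disc_at_1. R z = G z"
    using ex[unfolded expands_def, THEN conjunct2] eventually_disc_at_1
  proof eventually_elim
    case (elim z)
    let ?t = "puiseux d z"
    have t: "?t \<noteq> 0" using elim puiseux_nonzero by blast
    have z1: "z \<noteq> 1" using elim by blast
    have tk: "(1 - z) powr ?c k = ?t ^ k / ?t ^ p" for k
      unfolding puiseux_power[OF z1] by (simp add: powr_diff diff_divide_distrib)
    have "H z = \<Psi> ?t / ?t ^ p" using elim(1) t by (simp add: field_simps)
    also have "\<Psi> ?t = (\<Sum>k<K. ?\<psi> k * ?t ^ k) + ?t ^ K * (dquot ^^ K) \<Psi> ?t"
      by (rule dquot_taylor)
    finally have "H z = (\<Sum>k<K. ?\<psi> k * (1 - z) powr ?c k) + ?t ^ K / ?t ^ p * (dquot ^^ K) \<Psi> ?t"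
      unfolding tk by (simp add: add_divide_distrib sum_divide_distrib)
    \<comment> \<open>The choice of \<open>K\<close>: after division by t^p the remainder retains
      t^(2 * 2^d), which is the square of 1 - z.\<close>
    moreover have "?t ^ K / ?t ^ p = (1 - z)\<^sup>2"
      using t puiseux_full_power[OF z1, of d] by (simp add: K_def power_add power_mult mult.commute[of 2])
    ultimately show ?case by (simp add: R_def G_def)
  qed
  then obtain \<delta>1 where \<delta>1: "0 < \<delta>1" "\<And>z. z \<in> ball 0 1 \<Longrightarrow> z \<noteq> 1 \<Longrightarrow> dist z 1 < \<delta>1 \<Longrightarrow> R z = G z"
    unfolding eventually_at by blast
  obtain \<delta>2 B1 where \<delta>2: "0 < \<delta>2"
    "\<And>z. norm z < 1 \<Longrightarrow> norm (1 - z) < \<delta>2 \<Longrightarrow> norm ((deriv ^^ 2) G z) \<le> B1"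
    using second_deriv_bound_near_1[OF dquot_pow_analytic[OF \<Psi>, of K], of d] unfolding G_def by blast
  obtain B2 where B2: "\<And>z. norm z < 1 \<Longrightarrow> min \<delta>1 \<delta>2 \<le> norm (1 - z) \<Longrightarrow> norm ((deriv ^^ 2) R z) \<le> B2"
    using second_deriv_bound_away[OF anR, of "min \<delta>1 \<delta>2"] \<delta>1(1) \<delta>2(1) by auto
  have bound: "norm ((deriv ^^ 2) R z) \<le> max B1 B2" if z: "norm z < 1" for z
  proof (cases "norm (1 - z) < min \<delta>1 \<delta>2")
    case True
    have "\<forall>\<^sub>F w in nhds z. w \<in> ball 0 1 \<inter> ball 1 \<delta>1"
      using True z by (intro eventually_nhds_in_open) (auto simp: dist_norm)
    then have "\<forall>\<^sub>F w in nhds z. R w = G w"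
    proof eventually_elim
      case (elim w)
      then have "w \<noteq> 1" by auto
      then show ?case using elim \<delta>1(2) by (auto simp: dist_commute)
    qed
    then have "(deriv ^^ 2) R z = (deriv ^^ 2) G z" by (rule higher_deriv_cong_ev) auto
    then show ?thesis using \<delta>2(2)[OF z] True by simp
  next
    case False
    then have "min \<delta>1 \<delta>2 \<le> norm (1 - z)" by linarith
    then show ?thesis by (rule max.coboundedI2[OF B2[OF z]])
  qed
  have "norm (fps_nth h n - (\<Sum>k<K. ?\<psi> k * ((- 1) ^ n * (?c k gchoose n)))) \<le> max B1 B2 / (real n * (real n - 1))"
    if n: "2 \<le> n" for n
  proof -
    obtain m where m: "n = m + 2" using n by (metis add.commute le_Suc_ex)
    have "fps_nth r n = fps_nth h n - (\<Sum>k<K. ?\<psi> k * ((- 1) ^ n * (?c k gchoose n)))"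
      by (simp add: r_def fps_sum_nth)
    moreover have "norm (fps_nth r (m + 2)) \<le> max B1 B2 / ((real m + 1) * (real m + 2))"
      by (rule fps_nth_bound_of_second_deriv[OF holR Rr bound])
    moreover have "(real m + 1) * (real m + 2) = real n * (real n - 1)" by (simp add: m algebra_simps)
    ultimately show ?thesis by (simp only: m[symmetric])
  qed
  then show ?thesis by blast
qed


section \<open>Coefficient asymptotics\<close>

text \<open>Convergence to the reciprocal Gamma value is used only as boundedness, so the bound also
  covers the case where that limit is 0, that is, where c is a natural number.\<close>

lemma gbinomial_bigo:
  assumes "Re c = a" "Im c = 0"
  shows "(\<lambda>n. norm (c gchoose n)) \<in> O(\<lambda>n. real n powr (- 1 - a))"
proof -
  have c: "c = of_real a" using assms by (simp add: complex_eq_iff)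
  let ?X = "\<lambda>n. (c gchoose n) / ((- 1) ^ n / exp ((c + 1) * of_real (ln (real n))))"
  have "Bseq ?X" using gbinomial_asymptotic[of c] by (rule convergent_imp_Bseq[OF convergentI])
  then obtain K where K: "\<And>n. norm (?X n) \<le> K" by (auto simp: Bseq_def)
  have "norm (norm (c gchoose n)) \<le> K * norm (real n powr (- 1 - a))" if "n > 0" for n
  proof -
    have "norm (?X n) = norm (c gchoose n) * exp ((a + 1) * ln (real n))"
      by (simp add: norm_divide norm_mult norm_power norm_exp_eq_Re c)
    moreover have "exp ((a + 1) * ln (real n)) * real n powr (- 1 - a) = 1"
      using that by (simp add: powr_def flip: exp_add) (simp add: algebra_simps)
    ultimately have "norm (c gchoose n) = norm (?X n) * real n powr (- 1 - a)"
      by (simp only: mult.assoc)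
    also have "\<dots> \<le> K * real n powr (- 1 - a)" by (intro mult_right_mono K) simp
    finally show ?thesis by simp
  qed
  then show ?thesis
    by (intro bigoI[of _ K]) (auto intro: eventually_mono[OF eventually_gt_at_top[of 0]])
qed

lemma inverse_square_bigo:
  assumes "\<And>n. 2 \<le> n \<Longrightarrow> norm (f n) \<le> B / (real n * (real n - 1))"
  shows "(\<lambda>n. norm (f n)) \<in> O(\<lambda>n. real n powr (- 2))"
proof (rule landau_o.big_trans)
  show "(\<lambda>n. norm (f n)) \<in> O(\<lambda>n. 1 / (real n * (real n - 1)))"
  proof (rule bigoI[of _ B])
    show "\<forall>\<^sub>F n in sequentially. norm (norm (f n)) \<le> B * norm (1 / (real n * (real n - 1)))"
      using eventually_ge_at_top[of 2] by eventually_elim (use assms in simp)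
  qed
  show "(\<lambda>n. 1 / (real n * (real n - 1))) \<in> O(\<lambda>n. real n powr (- 2))"
    by real_asymp
qed

lemma powr_bigo_mono: "a \<le> b \<Longrightarrow> (\<lambda>n. real n powr a) \<in> O(\<lambda>n. real n powr b)"
  by (intro bigoI[of _ 1] eventually_mono[OF eventually_ge_at_top[of 1]]) (auto intro: powr_mono)

text \<open>The worst term is k = 0, with exponent - p / 2^d in 1 - z. All later terms and the
  O(n^-2) remainder are dominated by it.\<close>

theorem expands_bound:
  assumes an: "H analytic_on cball 0 1 - {1}" and ex: "expands d p H \<Psi>" and h: "H has_fps_expansion h"
  shows "(\<lambda>n. norm (fps_nth h n)) \<in> O(\<lambda>n. real n powr (real p / 2 ^ d - 1))"
proof -
  define K where "K = 2 * 2 ^ d + p"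
  let ?c = "\<lambda>k. (of_nat k - of_nat p) / 2 ^ d :: complex"
  let ?\<psi> = "\<lambda>k. (dquot ^^ k) \<Psi> 0"
  let ?b = "\<lambda>n. real n powr (real p / 2 ^ d - 1)"
  define f where "f n = fps_nth h n - (\<Sum>k<K. ?\<psi> k * ((- 1) ^ n * (?c k gchoose n)))" for n
  obtain B where "\<And>n. 2 \<le> n \<Longrightarrow> norm (f n) \<le> B / (real n * (real n - 1))"
    using expands_coefficients[OF an ex h] unfolding f_def K_def by blast
  then have "(\<lambda>n. norm (f n)) \<in> O(\<lambda>n. real n powr (- 2))" by (rule inverse_square_bigo)
  then have f: "(\<lambda>n. norm (f n)) \<in> O(?b)"
    by (rule landau_o.big_trans[OF _ powr_bigo_mono]) (simp add: add_increasing2)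
  have k: "(\<lambda>n. norm (?\<psi> k) * norm (?c k gchoose n)) \<in> O(?b)" for k
  proof (rule landau_o.big_trans)
    show "(\<lambda>n. norm (?\<psi> k) * norm (?c k gchoose n)) \<in> O(\<lambda>n. norm (?c k gchoose n))"
      by (rule bigoI[of _ "norm (?\<psi> k)"]) (auto simp: norm_mult)
    show "(\<lambda>n. norm (?c k gchoose n)) \<in> O(?b)"
    proof (rule landau_o.big_trans)
      have "?c k = of_real ((real k - real p) / 2 ^ d)" by simp
      then show "(\<lambda>n. norm (?c k gchoose n)) \<in> O(\<lambda>n. real n powr (- 1 - (real k - real p) / 2 ^ d))"
        by (intro gbinomial_bigo) (metis Re_complex_of_real, metis Im_complex_of_real)
      show "(\<lambda>n. real n powr (- 1 - (real k - real p) / 2 ^ d)) \<in> O(?b)"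
        by (rule powr_bigo_mono) (simp add: diff_divide_distrib)
    qed
  qed
  have "(\<lambda>n. norm (f n) + (\<Sum>k<K. norm (?\<psi> k) * norm (?c k gchoose n))) \<in> O(?b)"
    by (intro sum_in_bigo(1) f big_sum_in_bigo k)
  moreover have "(\<lambda>n. norm (fps_nth h n)) \<in> O(\<lambda>n. norm (f n) + (\<Sum>k<K. norm (?\<psi> k) * norm (?c k gchoose n)))"
  proof (rule landau_o.big_mono, rule always_eventually, rule allI)
    fix n
    have "norm (fps_nth h n) = norm (f n + (\<Sum>k<K. ?\<psi> k * ((- 1) ^ n * (?c k gchoose n))))"
      by (simp add: f_def)
    also have "\<dots> \<le> norm (f n) + norm (\<Sum>k<K. ?\<psi> k * ((- 1) ^ n * (?c k gchoose n)))"
      by (rule norm_triangle_ineq)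
    also have "\<dots> \<le> norm (f n) + (\<Sum>k<K. norm (?\<psi> k * ((- 1) ^ n * (?c k gchoose n))))"
      by (intro add_left_mono norm_sum)
    finally show "norm (norm (fps_nth h n)) \<le> norm (norm (f n) + (\<Sum>k<K. norm (?\<psi> k) * norm (?c k gchoose n)))"
      by (simp add: norm_mult norm_power)
  qed
  ultimately show ?thesis by (rule landau_o.big_trans[rotated])
qed

lemma bigo_tendsto_zero:
  fixes f g :: "nat \<Rightarrow> real"
  assumes "f \<in> O(g)" "g \<longlonglongrightarrow> 0"
  shows "f \<longlonglongrightarrow> 0"
proof -
  obtain c where c: "\<forall>\<^sub>F n in sequentially. norm (f n) \<le> c * norm (g n)"
    using assms(1) by (elim landau_o.bigE)
  have "(\<lambda>n. c * norm (g n)) \<longlonglongrightarrow> 0"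
    using assms(2) by (intro tendsto_mult_right_zero tendsto_norm_zero)
  then show ?thesis by (rule Lim_null_comparison[OF c])
qed

text \<open>The term k = 0 is a constant function and has no coefficient of positive index. The term
  k = 1 is the leading one, later terms are of smaller order, and the remainder n^-2 is smaller
  because 1/2^d < 1 for positive d. Taking norms avoids determining the sign of the limit.\<close>

theorem expands_asymptotics:
  assumes an: "H analytic_on cball 0 1 - {1}" and ex: "expands d 0 H \<Psi>" and h: "H has_fps_expansion h"
    and d: "0 < d"
  shows "(\<lambda>n. norm (fps_nth h n) * real n powr (1 + 1 / 2 ^ d)) \<longlonglongrightarrow>
    norm (deriv \<Psi> 0 * inverse (Gamma (- (1 / 2 ^ d))))"
proof -
  \<comment> \<open>The number of terms after the first two, which are treated separately.\<close>
  define K :: nat where "K = 2 * 2 ^ d - 2"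
  have K: "2 * 2 ^ d + 0 = Suc (Suc K)"
  proof -
    have "(2::nat) \<le> 2 * 2 ^ d" by simp
    then show ?thesis unfolding K_def by linarith
  qed
  let ?c = "\<lambda>k. (of_nat k - of_nat 0) / 2 ^ d :: complex"
  let ?\<psi> = "\<lambda>k. (dquot ^^ k) \<Psi> 0"
  let ?w = "\<lambda>n. real n powr (1 + 1 / 2 ^ d)"
  define f where "f n = fps_nth h n - (\<Sum>k<Suc (Suc K). ?\<psi> k * ((- 1) ^ n * (?c k gchoose n)))" for n
  obtain B where "\<And>n. 2 \<le> n \<Longrightarrow> norm (f n) \<le> B / (real n * (real n - 1))"
    using expands_coefficients[OF an ex h] unfolding f_def K by blast
  then have "(\<lambda>n. norm (f n)) \<in> O(\<lambda>n. real n powr (- 2))" by (rule inverse_square_bigo)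
  have small: "(\<lambda>n. g n * of_real (?w n)) \<longlonglongrightarrow> 0"
    if "(\<lambda>n. norm (g n)) \<in> O(\<lambda>n. real n powr b)" "b + 1 + 1 / 2 ^ d < 0" for g :: "nat \<Rightarrow> complex" and b
  proof -
    have "(\<lambda>n. norm (g n) * ?w n) \<in> O(\<lambda>n. real n powr b * ?w n)"
      using that(1) by (intro landau_o.big.mult) auto
    moreover have "(\<lambda>n. real n powr b * ?w n) \<longlonglongrightarrow> 0"
    proof -
      have "(\<lambda>n. real n powr (b + 1 + 1 / 2 ^ d)) \<longlonglongrightarrow> 0"
        using that(2) by (intro tendsto_neg_powr filterlim_real_sequentially)
      then show ?thesis by (simp add: powr_add[symmetric] add.assoc)
    qed
    ultimately have "(\<lambda>n. norm (g n) * ?w n) \<longlonglongrightarrow> 0" by (rule bigo_tendsto_zero)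
    then have "(\<lambda>n. norm (g n * of_real (?w n))) \<longlonglongrightarrow> 0" by (simp add: norm_mult)
    then show ?thesis by (rule tendsto_norm_zero_cancel)
  qed
  have half: "1 / 2 ^ d \<le> (1 / 2 :: real)"
    using d by (cases d) (auto simp: field_simps)
  have tf: "(\<lambda>n. f n * of_real (?w n)) \<longlonglongrightarrow> 0"
    by (rule small[of _ "- 2"]) (use half \<open>(\<lambda>n. norm (f n)) \<in> _\<close> in auto)
  have tk: "(\<lambda>n. ?\<psi> (Suc (Suc k)) * ((- 1) ^ n * (?c (Suc (Suc k)) gchoose n)) * of_real (?w n)) \<longlonglongrightarrow> 0" for k
  proof -
    have "?c (Suc (Suc k)) = of_real (real (k + 2) / 2 ^ d)" by simp
    then have "(\<lambda>n. norm (?c (Suc (Suc k)) gchoose n)) \<in> O(\<lambda>n. real n powr (- 1 - real (k + 2) / 2 ^ d))"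
      by (intro gbinomial_bigo) (metis Re_complex_of_real, metis Im_complex_of_real)
    then have "(\<lambda>n. norm ((- 1) ^ n * (?c (Suc (Suc k)) gchoose n))) \<in> O(\<lambda>n. real n powr (- 1 - real (k + 2) / 2 ^ d))"
      by (simp add: norm_mult norm_power)
    then have "(\<lambda>n. (- 1) ^ n * (?c (Suc (Suc k)) gchoose n) * of_real (?w n)) \<longlonglongrightarrow> 0"
      by (rule small) (simp add: field_simps)
    then have "(\<lambda>n. ?\<psi> (Suc (Suc k)) * ((- 1) ^ n * (?c (Suc (Suc k)) gchoose n) * of_real (?w n))) \<longlonglongrightarrow> 0"
      by (rule tendsto_mult_right_zero)
    then show ?thesis by (simp only: mult.assoc)
  qed
  have t1: "(\<lambda>n. ?\<psi> 1 * ((- 1) ^ n * (?c 1 gchoose n)) * of_real (?w n)) \<longlonglongrightarrow> ?\<psi> 1 * inverse (Gamma (- ?c 1))"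
  proof -
    have "\<forall>\<^sub>F n in sequentially. (?c 1 gchoose n) / ((- 1) ^ n / exp ((?c 1 + 1) * of_real (ln (real n))))
        = (- 1) ^ n * (?c 1 gchoose n) * of_real (?w n)"
      using eventually_gt_at_top[of 0]
    proof eventually_elim
      case (elim n)
      have "of_real (?w n) = exp ((?c 1 + 1) * of_real (ln (real n)))"
        using elim by (simp add: powr_def exp_of_real[symmetric] add.commute)
      then show ?case by (simp add: divide_simps)
    qed
    from tendsto_cong[OF this] gbinomial_asymptotic[of "?c 1"]
    have "(\<lambda>n. (- 1) ^ n * (?c 1 gchoose n) * of_real (?w n)) \<longlonglongrightarrow> inverse (Gamma (- ?c 1))" by blast
    then have "(\<lambda>n. ?\<psi> 1 * ((- 1) ^ n * (?c 1 gchoose n) * of_real (?w n))) \<longlonglongrightarrow> ?\<psi> 1 * inverse (Gamma (- ?c 1))"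
      by (rule tendsto_mult_left)
    then show ?thesis by (simp only: mult.assoc)
  qed
  have t0: "(\<lambda>n. ?\<psi> 0 * ((- 1) ^ n * (?c 0 gchoose n)) * of_real (?w n)) \<longlonglongrightarrow> 0"
  proof (rule tendsto_eventually)
    show "\<forall>\<^sub>F n in sequentially. ?\<psi> 0 * ((- 1) ^ n * (?c 0 gchoose n)) * of_real (?w n) = 0"
      using eventually_gt_at_top[of 0] by eventually_elim (auto simp: gbinomial_0_left)
  qed
  have "(\<lambda>n. ?\<psi> 0 * ((- 1) ^ n * (?c 0 gchoose n)) * of_real (?w n) + (?\<psi> 1 * ((- 1) ^ n * (?c 1 gchoose n)) * of_real (?w n)
     + (\<Sum>k<K. ?\<psi> (Suc (Suc k)) * ((- 1) ^ n * (?c (Suc (Suc k)) gchoose n)) * of_real (?w n))) + f n * of_real (?w n))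
     \<longlonglongrightarrow> 0 + (?\<psi> 1 * inverse (Gamma (- ?c 1)) + (\<Sum>k<K. 0)) + 0"
    by (intro tendsto_add t0 t1 tendsto_sum tk tf)
  moreover have "fps_nth h n * of_real (?w n) = ?\<psi> 0 * ((- 1) ^ n * (?c 0 gchoose n)) * of_real (?w n) + (?\<psi> 1 * ((- 1) ^ n * (?c 1 gchoose n)) * of_real (?w n)
     + (\<Sum>k<K. ?\<psi> (Suc (Suc k)) * ((- 1) ^ n * (?c (Suc (Suc k)) gchoose n)) * of_real (?w n))) + f n * of_real (?w n)" for n
    unfolding f_def sum.lessThan_Suc_shift by (simp add: sum_distrib_right sum_distrib_left algebra_simps)
  ultimately have "(\<lambda>n. fps_nth h n * of_real (?w n)) \<longlonglongrightarrow> ?\<psi> 1 * inverse (Gamma (- ?c 1))" by simp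
  then have "(\<lambda>n. norm (fps_nth h n * of_real (?w n))) \<longlonglongrightarrow> norm (?\<psi> 1 * inverse (Gamma (- ?c 1)))"
    by (rule tendsto_norm)
  then show ?thesis by (simp add: norm_mult dquot_0)
qed

section \<open>Identification of the counting series with the analytic functions\<close>

lemma sfun_relations:
  shows "z * Ffun d z = 1 - sfun (Suc d) z ^ 2"
    and "Ffun (Suc d) z = (1 - sfun (Suc d) z) / (1 + sfun (Suc d) z)"
    and "1 + Ffun (Suc d) z = 2 / (1 + sfun (Suc d) z)"
proof -
  have "sfun (Suc d) z ^ 2 = 1 - z * Ffun d z" unfolding sfun_Suc by simp
  then show "z * Ffun d z = 1 - sfun (Suc d) z ^ 2" by simp
  show F: "Ffun (Suc d) z = (1 - sfun (Suc d) z) / (1 + sfun (Suc d) z)"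
    by (simp add: Ffun_def divide_inverse)
  show "1 + Ffun (Suc d) z = 2 / (1 + sfun (Suc d) z)"
    unfolding F using one_plus_sfun_nonzero[of "Suc d" z] by (simp add: field_simps)
qed

lemma Ffun_eq: "Ffun (Suc d) z = 1 / 4 * z * ((1 + Ffun (Suc d) z) * (1 + Ffun (Suc d) z) * Ffun d z)"
proof -
  let ?s = "sfun (Suc d) z"
  have "1 / 4 * z * ((1 + Ffun (Suc d) z) * (1 + Ffun (Suc d) z) * Ffun d z) =
      (z * Ffun d z) * (1 + Ffun (Suc d) z) ^ 2 / 4" by (simp add: power2_eq_square)
  also have "\<dots> = (1 - ?s ^ 2) * (2 / (1 + ?s)) ^ 2 / 4" unfolding sfun_relations(1,3) ..
  also have "\<dots> = (1 - ?s) / (1 + ?s)"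
    using one_plus_sfun_nonzero[of "Suc d" z] by (simp add: divide_simps) algebra
  finally show ?thesis using sfun_relations(2)[of d z] by (simp only:)
qed

lemma Ffun_0_eq: "Ffun 0 z = 1"
  by (simp add: Ffun_def)

text \<open>Subtracting the equations gives F - G = (F - G) X E for some series E, and 1 - X E is
  nonzero.\<close>

lemma fps_quadratic_unique:
  fixes F G H :: "'a::field fps"
  assumes F: "F = fps_const c * fps_X * ((1 + F) * (1 + F) * H)"
    and G: "G = fps_const c * fps_X * ((1 + G) * (1 + G) * H)"
  shows "F = G"
proof -
  have "F - G = fps_const c * fps_X * ((1 + F) * (1 + F) * H) - fps_const c * fps_X * ((1 + G) * (1 + G) * H)"
    using F G by metis
  also have "\<dots> = (F - G) * (fps_X * (fps_const c * (2 + F + G) * H))" by (simp add: algebra_simps)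
  finally have "(F - G) * (1 - fps_X * (fps_const c * (2 + F + G) * H)) = 0" by (simp add: algebra_simps)
  moreover have "fps_nth (1 - fps_X * (fps_const c * (2 + F + G) * H)) 0 = 1" by simp
  then have "1 - fps_X * (fps_const c * (2 + F + G) * H) \<noteq> 0" by (metis fps_zero_nth zero_neq_one)
  ultimately show ?thesis by simp
qed

lemma analytic_has_fps_expansion:
  assumes "f analytic_on cball 0 1 - {1}"
  shows "f has_fps_expansion fps_expansion f 0"
  by (intro analytic_at_imp_has_fps_expansion_0 analytic_on_subset[OF assms]) auto

text \<open>The Taylor series of \<open>Ffun (Suc d)\<close> solves the same formal fixed-point
  equation as the counting series. Comparing formally means that convergence of the counting series
  need not be known beforehand.\<close>

lemma Ffun_has_fps_expansion: "Ffun d has_fps_expansion Fgf d"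
proof (induction d)
  case 0
  have "Ffun 0 = (\<lambda>_. 1)" using Ffun_0_eq by blast
  then show ?case by (simp add: Fgf_0)
next
  case (Suc d)
  define A where "A = fps_expansion (Ffun (Suc d)) 0"
  have A: "Ffun (Suc d) has_fps_expansion A"
    unfolding A_def by (rule analytic_has_fps_expansion[OF Ffun_analytic])
  have "(\<lambda>z. 1 / 4 * z * ((1 + Ffun (Suc d) z) * (1 + Ffun (Suc d) z) * Ffun d z)) has_fps_expansion
      fps_const (1 / 4) * fps_X * ((1 + A) * (1 + A) * Fgf d)"
    by (intro fps_expansion_intros A Suc)
  then have "Ffun (Suc d) has_fps_expansion fps_const (1 / 4) * fps_X * ((1 + A) * (1 + A) * Fgf d)"
    by (simp only: Ffun_eq[of d, symmetric])
  then have "A = fps_const (1 / 4) * fps_X * ((1 + A) * (1 + A) * Fgf d)"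
    using A fps_expansion_unique_complex by blast
  then have "A = Fgf (Suc d)" using Fgf_Suc by (rule fps_quadratic_unique)
  then show ?case using A by simp
qed

text \<open>This solves the linear equation for \<open>Mgf (Suc d)\<close>. The coefficient to
  divide by, 1 - z (1 + F_(d+1)) F_d / 2, is s_(d+1) itself, as \<open>sfun_eq\<close> shows, which
  is the source of the pole at 1.\<close>

fun Mfun :: "nat \<Rightarrow> complex \<Rightarrow> complex" where
  "Mfun 0 z = 0"
| "Mfun (Suc d) z = ((if d = 0 then 0 else Ffun (Suc d) z) +
     1 / 4 * z * ((1 + Ffun (Suc d) z) * (1 + Ffun (Suc d) z) * Mfun d z)) * inverse (sfun (Suc d) z)"

lemma sfun_eq: "sfun (Suc d) z = 1 - 1 / 4 * z * (2 * (1 + Ffun (Suc d) z) * Ffun d z)"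
proof -
  let ?s = "sfun (Suc d) z"
  have "1 - 1 / 4 * z * (2 * (1 + Ffun (Suc d) z) * Ffun d z) = 1 - (z * Ffun d z) * (1 + Ffun (Suc d) z) / 2"
    by simp
  also have "\<dots> = 1 - (1 - ?s ^ 2) * (2 / (1 + ?s)) / 2" unfolding sfun_relations(1,3) ..
  also have "\<dots> = ?s"
    using one_plus_sfun_nonzero[of "Suc d" z] by (simp add: divide_simps) algebra
  finally show ?thesis by simp
qed

lemma Mfun_eq:
  assumes "sfun (Suc d) z \<noteq> 0"
  shows "Mfun (Suc d) z = (if d = 0 then 0 else Ffun (Suc d) z) +
    1 / 4 * z * (2 * (1 + Ffun (Suc d) z) * Ffun d z * Mfun (Suc d) z
       + (1 + Ffun (Suc d) z) * (1 + Ffun (Suc d) z) * Mfun d z)"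
proof -
  have "Mfun (Suc d) z * sfun (Suc d) z = (if d = 0 then 0 else Ffun (Suc d) z) +
     1 / 4 * z * ((1 + Ffun (Suc d) z) * (1 + Ffun (Suc d) z) * Mfun d z)"
    using assms by simp
  moreover have "m = a + 1 / 4 * z * (2 * f * g * m + b)"
    if "m * (1 - 1 / 4 * z * (2 * f * g)) = a + 1 / 4 * z * b" for m a b f g :: complex
    using that by (simp add: algebra_simps)
  ultimately show ?thesis using sfun_eq[of d z] by (simp only:)
qed

lemma sfun_nonzero: "norm z \<le> 1 \<Longrightarrow> z \<noteq> 1 \<Longrightarrow> sfun (Suc d) z \<noteq> 0"
  using Re_sfun_pos(1)[of z d] by auto

declare Mfun.simps(2) [simp del]

lemma Mfun_analytic: "Mfun d analytic_on cball 0 1 - {1}"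
proof (induction d)
  case 0
  have "Mfun 0 = (\<lambda>_. 0)" by auto
  then show ?case by simp
next
  case (Suc d)
  have "(\<lambda>z. if d = 0 then 0 else Ffun (Suc d) z) analytic_on cball 0 1 - {1}"
    using Ffun_analytic by (cases d) auto
  then show ?case unfolding Mfun.simps(2)
    using sfun_nonzero by (intro analytic_intros Suc Ffun_analytic sfun_analytic) auto
qed

lemma Mfun_has_fps_expansion: "Mfun d has_fps_expansion Mgf d"
proof (induction d)
  case 0
  have "Mfun 0 = (\<lambda>_. 0)" by auto
  then show ?case by (simp add: Mgf_0)
next
  case (Suc d)
  define A where "A = fps_expansion (Mfun (Suc d)) 0"
  have A: "Mfun (Suc d) has_fps_expansion A"
    unfolding A_def by (rule analytic_has_fps_expansion[OF Mfun_analytic])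
  let ?m = "\<lambda>z. (if d = 0 then 0 else Ffun (Suc d) z) +
    1 / 4 * z * (2 * (1 + Ffun (Suc d) z) * Ffun d z * Mfun (Suc d) z
       + (1 + Ffun (Suc d) z) * (1 + Ffun (Suc d) z) * Mfun d z)"
  let ?A = "(if d = 0 then 0 else Fgf (Suc d)) +
     fps_const (1 / 4) * fps_X * (2 * (1 + Fgf (Suc d)) * Fgf d * A
       + (1 + Fgf (Suc d)) * (1 + Fgf (Suc d)) * Mgf d)"
  have "(\<lambda>z. if d = 0 then 0 else Ffun (Suc d) z) has_fps_expansion (if d = 0 then 0 else Fgf (Suc d))"
    using Ffun_has_fps_expansion by (cases d) auto
  then have m: "?m has_fps_expansion ?A"
    by (intro fps_expansion_intros Ffun_has_fps_expansion A Suc)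
  have "\<forall>\<^sub>F z in nhds 0. z \<in> ball 0 1" by (intro eventually_nhds_in_open) auto
  then have "\<forall>\<^sub>F z in nhds 0. ?m z = Mfun (Suc d) z"
  proof eventually_elim
    case (elim z)
    then have "sfun (Suc d) z \<noteq> 0" by (intro sfun_nonzero) auto
    then show ?case by (rule Mfun_eq[symmetric])
  qed
  then have "Mfun (Suc d) has_fps_expansion ?A" by (rule has_fps_expansion_cong[THEN iffD1, OF _ refl m])
  then have eqA: "A = ?A" using A fps_expansion_unique_complex by blast
  have "A - Mgf (Suc d) = ?A - ((if d = 0 then 0 else Fgf (Suc d)) +
     fps_const (1 / 4) * fps_X * (2 * (1 + Fgf (Suc d)) * Fgf d * Mgf (Suc d)
       + (1 + Fgf (Suc d)) * (1 + Fgf (Suc d)) * Mgf d))"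
    using eqA Mgf_Suc[of d] by metis
  also have "\<dots> = (A - Mgf (Suc d)) * (fps_X * (fps_const (1 / 4) * (2 * (1 + Fgf (Suc d)) * Fgf d)))"
    by (simp add: algebra_simps)
  finally have "(A - Mgf (Suc d)) * (1 - fps_X * (fps_const (1 / 4) * (2 * (1 + Fgf (Suc d)) * Fgf d))) = 0"
    by (simp add: algebra_simps)
  moreover have "fps_nth (1 - fps_X * (fps_const (1 / 4) * (2 * (1 + Fgf (Suc d)) * Fgf d)) :: complex fps) 0 = 1" by simp
  then have "1 - fps_X * (fps_const (1 / 4) * (2 * (1 + Fgf (Suc d)) * Fgf d)) \<noteq> (0 :: complex fps)"
    by (metis fps_zero_nth zero_neq_one)
  ultimately have "A = Mgf (Suc d)" by simp
  then show ?case using A by simp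
qed

text \<open>Passing to the next dimension doubles the pole order, and dividing by s adds one. The
  recursion p to 2 p + 1, started at 0 since trees of dimension 1 have no branchings, gives 2^d -
  1.\<close>

lemma Mfun_expands: "\<exists>\<Phi>. expands (Suc d) (2 ^ d - 1) (Mfun (Suc d)) \<Phi>"
proof (induction d)
  case 0
  have "Mfun (Suc 0) = (\<lambda>_. 0)" by (auto simp: Mfun.simps(2))
  then show ?case using expands_const[of "Suc 0" 0] by auto
next
  case (Suc d)
  then obtain \<Phi>1 where M: "expands (Suc d) (2 ^ d - 1) (Mfun (Suc d)) \<Phi>1" by blast
  define q :: nat where "q = 2 * (2 ^ d - 1)"
  have q: "q + 1 = 2 ^ Suc d - 1" 
  proof -
    have "(1::nat) \<le> 2 ^ d" by simp
    then show ?thesis unfolding q_def power_Suc by linarith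
  qed
  obtain \<Phi>2 where M': "expands (Suc (Suc d)) q (Mfun (Suc d)) \<Phi>2"
    using expands_refine[OF M] unfolding q_def by blast
  let ?e = "Suc (Suc d)"
  let ?P = "\<lambda>z. 1 / 4 * z * ((1 + Ffun ?e z) * (1 + Ffun ?e z) * Mfun (Suc d) z)"
  obtain \<Phi> where F: "expands ?e 0 (Ffun ?e) \<Phi>" using Ffun_expansion by blast
  obtain \<Phi>3 where s: "expands ?e 1 (\<lambda>z. inverse (sfun ?e z)) \<Phi>3"
    using inverse_sfun_expansion by blast
  note one = expands_add[OF expands_const F, of 1]
  note prod = expands_mult[OF expands_mult[OF expands_const expands_ident] expands_mult[OF expands_mult[OF one one] M'],
      of "1 / 4"]
  obtain \<Phi>4 where "expands ?e q ?P \<Phi>4" using prod by auto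
  moreover obtain \<Phi>5 where "expands ?e q (Ffun ?e) \<Phi>5"
    using expands_weaken[OF F, of q] by auto
  ultimately obtain \<Phi>6 where "expands ?e q (\<lambda>z. Ffun ?e z + ?P z) \<Phi>6"
    using expands_add by blast
  from expands_mult[OF this s]
  have "\<exists>\<Phi>. expands ?e (2 ^ Suc d - 1) (\<lambda>z. (Ffun ?e z + ?P z) * inverse (sfun ?e z)) \<Phi>"
    unfolding q by blast
  moreover have "Mfun ?e = (\<lambda>z. (Ffun ?e z + ?P z) * inverse (sfun ?e z))" unfolding Mfun.simps(2) by simp
  ultimately show ?case by simp
qed

section \<open>Orders of the counting sequences\<close>

definition acoeff :: "nat \<Rightarrow> nat \<Rightarrow> real" where
  "acoeff d n = real (card {T \<in> etrees d. card T = n}) / 4 ^ n"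

lemma Fgf_nth: "fps_nth (Fgf d) n = of_real (acoeff d n)"
  by (simp add: Fgf_def gf_nth acoeff_def)

lemma acoeff_nonneg: "0 \<le> acoeff d n"
  by (simp add: acoeff_def)

definition weight :: "nat \<Rightarrow> nat \<Rightarrow> real" where
  "weight d n = real n powr (- (1 + 1 / 2 ^ d))"

theorem acoeff_asymptotics:
  assumes "0 < d"
  shows "\<exists>c>0. (\<lambda>n. acoeff d n / weight d n) \<longlonglongrightarrow> c"
proof -
  obtain e where d: "d = Suc e" using assms by (cases d) auto
  obtain \<Phi> b where \<Phi>: "expands d 0 (Ffun d) \<Phi>" "deriv \<Phi> 0 = of_real b" "b < 0"
    using Ffun_expansion unfolding d by blast
  let ?c = "norm (deriv \<Phi> 0 * inverse (Gamma (- (1 / 2 ^ d) :: complex)))"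
  have lim: "(\<lambda>n. norm (fps_nth (Fgf d :: complex fps) n) * real n powr (1 + 1 / 2 ^ d)) \<longlonglongrightarrow> ?c"
    by (rule expands_asymptotics[OF Ffun_analytic \<Phi>(1) Ffun_has_fps_expansion assms])
  have "norm (fps_nth (Fgf d :: complex fps) n) * real n powr (1 + 1 / 2 ^ d) = acoeff d n / weight d n" for n
  proof -
    have "norm (fps_nth (Fgf d :: complex fps) n) = acoeff d n"
      unfolding Fgf_nth norm_of_real by (simp add: acoeff_def)
    moreover have "weight d n = inverse (real n powr (1 + 1 / 2 ^ d))"
      unfolding weight_def by (rule powr_minus)
    ultimately show ?thesis by (simp add: divide_inverse)
  qed
  then have "(\<lambda>n. norm (fps_nth (Fgf d :: complex fps) n) * real n powr (1 + 1 / 2 ^ d)) = (\<lambda>n. acoeff d n / weight d n)"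
    by blast
  with lim have "(\<lambda>n. acoeff d n / weight d n) \<longlonglongrightarrow> ?c" by (simp only:)
  moreover have "0 < ?c"
  proof -
    \<comment> \<open>The argument lies strictly between -1 and 0, hence is no pole of Gamma. At a
      pole the default value 0 would make the limit vanish.\<close>
    have "- (1 / 2 ^ d :: complex) \<notin> \<int>\<^sub>\<le>\<^sub>0"
    proof
      assume "- (1 / 2 ^ d :: complex) \<in> \<int>\<^sub>\<le>\<^sub>0"
      then obtain n :: nat where "- (1 / 2 ^ d :: complex) = - of_nat n" by (auto elim!: nonpos_Ints_cases')
      then have "(1 / 2 ^ d :: real) = real n" by (metis Re_complex_of_real neg_equal_iff_equal of_real_1 of_real_divide of_real_numeral of_real_of_nat_eq of_real_power)
      moreover have "0 < (1 / 2 ^ d :: real)" "(1 / 2 ^ d :: real) < 1" using assms by (auto simp: divide_simps)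
      ultimately show False by simp
    qed
    then have "Gamma (- (1 / 2 ^ d) :: complex) \<noteq> 0" by (simp add: Gamma_eq_zero_iff)
    then show ?thesis using \<Phi> by simp
  qed
  ultimately show ?thesis by blast
qed

definition mcoeff :: "nat \<Rightarrow> nat \<Rightarrow> real" where
  "mcoeff d n = (\<Sum>T | T \<in> etrees d \<and> card T = n. branchings T) / 4 ^ n"

lemma Mgf_nth: "fps_nth (Mgf d) n = of_real (mcoeff d n)"
  by (simp add: Mgf_def gf_nth mcoeff_def)

text \<open>The coefficients are O(n^(-1/2 - 1/2^d)), while n times \<open>weight d n\<close> is
  n^(-1/2^d). The ratio is O(n^(-1/2)), so on average only a vanishing proportion of the vertices
  lies outside the last level.\<close>

theorem mcoeff_negligible:
  assumes "0 < d"
  shows "(\<lambda>n. mcoeff d n / (real n * weight d n)) \<longlonglongrightarrow> 0"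
proof -
  obtain e where d: "d = Suc e" using assms by (cases d) auto
  obtain \<Phi> where \<Phi>: "expands d (2 ^ e - 1) (Mfun d) \<Phi>" using Mfun_expands unfolding d by blast
  have "(\<lambda>n. norm (fps_nth (Mgf d :: complex fps) n)) \<in> O(\<lambda>n. real n powr (real (2 ^ e - 1) / 2 ^ d - 1))"
    by (rule expands_bound[OF Mfun_analytic \<Phi> Mfun_has_fps_expansion])
  moreover have "0 \<le> mcoeff d n" for n unfolding mcoeff_def branchings_def by (intro divide_nonneg_nonneg sum_nonneg) auto
  then have "norm (fps_nth (Mgf d :: complex fps) n) = mcoeff d n" for n by (simp add: Mgf_nth)
  moreover have "real (2 ^ e - 1) / 2 ^ d = 1 / 2 - 1 / 2 ^ d"
    by (simp add: d of_nat_diff field_simps)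
  ultimately have O: "mcoeff d \<in> O(\<lambda>n. real n powr (1 / 2 - 1 / 2 ^ d - 1))" by simp
  have "(\<lambda>n. mcoeff d n * real n powr (1 / 2 ^ d)) \<in>
      O(\<lambda>n. real n powr (1 / 2 - 1 / 2 ^ d - 1) * real n powr (1 / 2 ^ d))"
    using O by (intro landau_o.big.mult) auto
  moreover have "(\<lambda>n. real n powr (1 / 2 - 1 / 2 ^ d - 1) * real n powr (1 / 2 ^ d)) \<longlonglongrightarrow> 0"
  proof -
    have "(\<lambda>n. real n powr (- (1 / 2))) \<longlonglongrightarrow> 0"
      by (intro tendsto_neg_powr filterlim_real_sequentially) simp
    then show ?thesis by (simp add: powr_add[symmetric])
  qed
  ultimately have "(\<lambda>n. mcoeff d n * real n powr (1 / 2 ^ d)) \<longlonglongrightarrow> 0" by (rule bigo_tendsto_zero)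
  moreover have "\<forall>\<^sub>F n in sequentially. mcoeff d n * real n powr (1 / 2 ^ d) = mcoeff d n / (real n * weight d n)"
    using eventually_gt_at_top[of 0]
  proof eventually_elim
    case (elim n)
    have "real n * weight d n = real n powr (1 + - (1 + 1 / 2 ^ d))"
      unfolding weight_def by (rule powr_mult_base) simp
    then have "real n * weight d n = inverse (real n powr (1 / 2 ^ d))"
      by (simp add: powr_minus)
    then show ?case by (simp add: divide_inverse)
  qed
  ultimately show ?thesis by (rule Lim_transform_eventually)
qed


section \<open>Neighbourhoods of the root\<close>

lemma weight_pos: "0 < n \<Longrightarrow> 0 < weight d n"
  by (simp add: weight_def)

lemma weight_nonneg: "0 \<le> weight d n"
  by (simp add: weight_def)

lemma summable_weight: "summable (weight d)"
  unfolding weight_def by (subst summable_real_powr_iff) simp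

text \<open>The 4 bounds 2^(1 + 1/2^d), as the exponent is at most 2.\<close>

lemma weight_half:
  assumes "2 * k \<le> n" "0 < n"
  shows "weight d (n - k) \<le> 4 * weight d n"
proof -
  let ?a = "1 + 1 / 2 ^ d :: real"
  have "0 < ?a" by (rule add_pos_pos) simp_all
  moreover have "?a \<le> 1 + 1" by (rule add_left_mono) simp
  ultimately have a: "0 < ?a" "?a \<le> 2" by simp_all
  have "weight d (n - k) \<le> (real n / 2) powr (- ?a)"
    unfolding weight_def
  proof (rule powr_mono2')
    show "real n / 2 \<le> real (n - k)" using assms(1) by linarith
  qed (use assms(2) a in linarith)+
  also have "\<dots> = weight d n * 2 powr ?a"
    unfolding weight_def powr_divide powr_minus[of 2 ?a] by (rule divide_inverse[of _ "inverse _", unfolded inverse_inverse_eq])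
  also have "2 powr ?a \<le> 2 powr (2 :: real)" using a by (intro powr_mono) auto
  finally show ?thesis using weight_nonneg[of d n] by (simp add: mult_left_mono)
qed

lemma shift_ratio: "(\<lambda>n. real (n - k) / real n) \<longlonglongrightarrow> 1"
proof (rule Lim_transform_eventually)
  show "(\<lambda>n. 1 - real k / real n) \<longlonglongrightarrow> 1" by real_asymp
  show "\<forall>\<^sub>F n in sequentially. 1 - real k / real n = real (n - k) / real n"
    using eventually_gt_at_top[of k] by eventually_elim (auto simp: of_nat_diff field_simps)
qed

lemma weight_ratio: "(\<lambda>n. weight d (n - k) / weight d n) \<longlonglongrightarrow> 1"
proof -
  let ?a = "1 + 1 / 2 ^ d :: real"
  have "(\<lambda>n. (real (n - k) / real n) powr (- ?a)) \<longlonglongrightarrow> 1 powr (- ?a)"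
    by (intro tendsto_powr shift_ratio) auto
  moreover have "(real (n - k) / real n) powr (- ?a) = weight d (n - k) / weight d n" for n
    unfolding weight_def by (rule powr_divide)
  ultimately show ?thesis by simp
qed

text \<open>The limit may be 0. This admits constants, X and all series of lower dimension, so that
  everything produced by the root decomposition stays in the class.\<close>

definition tame :: "nat \<Rightarrow> real fps \<Rightarrow> bool" where
  "tame d F \<longleftrightarrow> convergent (\<lambda>n. fps_nth F n / weight d n)"

lemma tame_bounded:
  assumes "tame d F"
  obtains C where "0 \<le> C" "\<And>n. 0 < n \<Longrightarrow> \<bar>fps_nth F n\<bar> \<le> C * weight d n"
proof -
  have "Bseq (\<lambda>n. fps_nth F n / weight d n)"
    using assms unfolding tame_def by (rule convergent_imp_Bseq)
  then obtain C where C: "0 < C" "\<And>n. norm (fps_nth F n / weight d n) \<le> C" by (auto elim: BseqE)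
  have "\<bar>fps_nth F n\<bar> \<le> C * weight d n" if "0 < n" for n
    using C(2)[of n] weight_pos[OF that, of d] by (simp add: abs_divide divide_simps)
  then show ?thesis using that[of C] C(1) by simp
qed

lemma tame_summable:
  assumes "tame d F"
  shows "summable (\<lambda>n. \<bar>fps_nth F n\<bar>)"
proof -
  obtain C where C: "\<And>n. 0 < n \<Longrightarrow> \<bar>fps_nth F n\<bar> \<le> C * weight d n"
    using assms by (rule tame_bounded) blast
  show ?thesis
  proof (rule summable_comparison_test_ev)
    show "\<forall>\<^sub>F n in sequentially. norm \<bar>fps_nth F n\<bar> \<le> C * weight d n"
      using eventually_gt_at_top[of 0] by eventually_elim (simp add: C)
  qed (intro summable_mult summable_weight)
qed

text \<open>In a convolution only the terms in which one index is bounded contribute in the limit, which is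
  Tannery's theorem for each half of the sum.\<close>

lemma tame_half_convolution:
  assumes u: "summable (\<lambda>n. \<bar>u n\<bar>)" and v: "tame d G"
  shows "convergent (\<lambda>n. (\<Sum>k | k \<le> n \<and> 2 * k \<le> n - j. u k * fps_nth G (n - k)) / weight d n)"
proof -
  obtain V where V: "(\<lambda>n. fps_nth G n / weight d n) \<longlonglongrightarrow> V" using v by (auto simp: tame_def convergent_def)
  obtain C where C: "0 \<le> C" "\<And>n. 0 < n \<Longrightarrow> \<bar>fps_nth G n\<bar> \<le> C * weight d n"
    by (rule tame_bounded[OF v]) (rule that)
  define a where "a k n = (if 2 * k \<le> n - j then u k * fps_nth G (n - k) / weight d n else 0)" for k n
  have lim: "(\<lambda>n. a k n) \<longlonglongrightarrow> u k * (V * 1)" for k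
  proof -
    have "(\<lambda>n. fps_nth G (n - k) / weight d (n - k)) \<longlonglongrightarrow> V"
      using V by (rule filterlim_compose[OF _ filterlim_minus_const_nat_at_top])
    then have "(\<lambda>n. u k * (fps_nth G (n - k) / weight d (n - k) * (weight d (n - k) / weight d n))) \<longlonglongrightarrow> u k * (V * 1)"
      by (intro tendsto_mult tendsto_const weight_ratio)
    moreover have "\<forall>\<^sub>F n in sequentially.
        u k * (fps_nth G (n - k) / weight d (n - k) * (weight d (n - k) / weight d n)) = a k n"
      using eventually_gt_at_top[of "2 * k + j"]
    proof eventually_elim
      case (elim n)
      then have "0 < weight d (n - k)" by (intro weight_pos) auto
      then show ?case using elim by (simp add: a_def)
    qed
    ultimately show ?thesis by (rule Lim_transform_eventually)
  qed
  \<comment> \<open>The restriction 2 k \<le> n keeps n - k comparable to n. This gives a dominating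
    sequence independent of n, as Tannery's theorem demands.\<close>
  have bound: "norm (a k n) \<le> \<bar>u k\<bar> * (4 * C)" if "0 < n" for k n
  proof (cases "2 * k \<le> n - j")
    case True
    then have "\<bar>fps_nth G (n - k)\<bar> \<le> C * weight d (n - k)" using that by (intro C(2)) auto
    also have "\<dots> \<le> C * (4 * weight d n)"
      using True that C(1) by (intro mult_left_mono weight_half) auto
    finally have "\<bar>fps_nth G (n - k)\<bar> / weight d n \<le> 4 * C"
      using weight_pos[OF that, of d] by (simp add: divide_simps mult_ac)
    then have "\<bar>u k\<bar> * (\<bar>fps_nth G (n - k)\<bar> / weight d n) \<le> \<bar>u k\<bar> * (4 * C)"
      by (rule mult_left_mono) simp
    then show ?thesis using True weight_nonneg[of d n] by (simp add: a_def abs_mult)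
  qed (use C(1) in \<open>simp add: a_def\<close>)
  have "(\<lambda>n. \<Sum>k. a k n) \<longlonglongrightarrow> (\<Sum>k. u k * (V * 1))"
  proof (rule tannerys_theorem[THEN conjunct2, THEN conjunct2])
    show "\<forall>\<^sub>F (k, n) in sequentially \<times>\<^sub>F sequentially. norm (a k n) \<le> \<bar>u k\<bar> * (4 * C)"
      unfolding eventually_prod_filter
      by (intro exI[of _ "\<lambda>_. True"] exI[of _ "\<lambda>n. 0 < n"]) (use bound eventually_gt_at_top in auto)
    show "summable (\<lambda>k. \<bar>u k\<bar> * (4 * C))" using u by (rule summable_mult2)
  qed (use lim in auto)
  moreover have "(\<Sum>k. a k n) = (\<Sum>k | k \<le> n \<and> 2 * k \<le> n - j. u k * fps_nth G (n - k)) / weight d n" for n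
  proof -
    have "(\<Sum>k. a k n) = (\<Sum>k | k \<le> n \<and> 2 * k \<le> n - j. a k n)"
      by (rule suminf_finite) (auto simp: a_def)
    then show ?thesis by (simp add: a_def sum_divide_distrib)
  qed
  ultimately show ?thesis by (auto simp: convergent_def)
qed

lemma tame_mult:
  assumes F: "tame d F" and G: "tame d G"
  shows "tame d (F * G)"
proof -
  \<comment> \<open>The two values of \<open>j\<close> split the convolution at its middle: the
    first half keeps the term with 2 k = n, the second, read backwards, omits it.\<close>
  have "fps_nth (F * G) n = (\<Sum>k | k \<le> n \<and> 2 * k \<le> n - 0. fps_nth F k * fps_nth G (n - k)) +
      (\<Sum>k | k \<le> n \<and> 2 * k \<le> n - 1. fps_nth G k * fps_nth F (n - k))" if "0 < n" for n
  proof -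
    let ?A = "{k. k \<le> n \<and> 2 * k \<le> n - 0}" and ?B = "{k. k \<le> n \<and> n < 2 * k}"
    have "fps_nth (F * G) n = (\<Sum>k\<in>?A \<union> ?B. fps_nth F k * fps_nth G (n - k))"
      unfolding fps_mult_nth by (rule sum.cong) auto
    also have "\<dots> = (\<Sum>k\<in>?A. fps_nth F k * fps_nth G (n - k)) + (\<Sum>k\<in>?B. fps_nth F k * fps_nth G (n - k))"
      by (rule sum.union_disjoint) auto
    also have "(\<Sum>k\<in>?B. fps_nth F k * fps_nth G (n - k)) =
        (\<Sum>k | k \<le> n \<and> 2 * k \<le> n - 1. fps_nth G k * fps_nth F (n - k))"
      by (rule sum.reindex_bij_witness[of _ "\<lambda>k. n - k" "\<lambda>k. n - k"]) (use that in auto)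
    finally show ?thesis .
  qed
  then have ev: "\<forall>\<^sub>F n in sequentially.
      (\<Sum>k | k \<le> n \<and> 2 * k \<le> n - 0. fps_nth F k * fps_nth G (n - k)) / weight d n +
      (\<Sum>k | k \<le> n \<and> 2 * k \<le> n - 1. fps_nth G k * fps_nth F (n - k)) / weight d n =
      fps_nth (F * G) n / weight d n"
    by (intro eventually_mono[OF eventually_gt_at_top[of 0]]) (simp add: add_divide_distrib)
  have "convergent (\<lambda>n. (\<Sum>k | k \<le> n \<and> 2 * k \<le> n - 0. fps_nth F k * fps_nth G (n - k)) / weight d n +
      (\<Sum>k | k \<le> n \<and> 2 * k \<le> n - 1. fps_nth G k * fps_nth F (n - k)) / weight d n)"
    by (intro convergent_add tame_half_convolution[OF tame_summable[OF F] G]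
        tame_half_convolution[OF tame_summable[OF G] F])
  then show ?thesis unfolding tame_def by (subst convergent_cong[OF ev, symmetric])
qed

lemma tame_const: "tame d (fps_const c)"
  unfolding tame_def
  by (rule convergentI[of _ 0], rule tendsto_eventually,
      rule eventually_mono[OF eventually_gt_at_top[of 0]]) simp

lemma tame_X: "tame d fps_X"
  unfolding tame_def
  by (rule convergentI[of _ 0], rule tendsto_eventually,
      rule eventually_mono[OF eventually_gt_at_top[of 1]]) simp

lemma tame_add: "tame d F \<Longrightarrow> tame d G \<Longrightarrow> tame d (F + G)"
  unfolding tame_def by (simp add: add_divide_distrib convergent_add)

text \<open>\<open>weight d\<close> is of smaller order than \<open>weight (Suc d)\<close>, so the
  limit in the higher dimension is 0.\<close>

lemma tame_Suc:
  assumes "tame d F"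
  shows "tame (Suc d) F"
proof -
  obtain L where L: "(\<lambda>n. fps_nth F n / weight d n) \<longlonglongrightarrow> L"
    using assms by (auto simp: tame_def convergent_def)
  have "(\<lambda>n. real n powr (1 / 2 ^ Suc d - 1 / 2 ^ d)) \<longlonglongrightarrow> 0"
    by (intro tendsto_neg_powr filterlim_real_sequentially) (simp add: field_simps)
  then have "(\<lambda>n. fps_nth F n / weight d n * real n powr (1 / 2 ^ Suc d - 1 / 2 ^ d)) \<longlonglongrightarrow> L * 0"
    by (intro tendsto_mult L)
  moreover have "fps_nth F n / weight d n * real n powr (1 / 2 ^ Suc d - 1 / 2 ^ d) =
      fps_nth F n / weight (Suc d) n" for n
  proof -
    have "1 / 2 ^ Suc d - 1 / 2 ^ d = - (1 + 1 / 2 ^ d) - - (1 + 1 / 2 ^ Suc d :: real)" by simp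
    then have "real n powr (1 / 2 ^ Suc d - 1 / 2 ^ d) = weight d n / weight (Suc d) n"
      unfolding weight_def by (metis powr_diff)
    then show ?thesis by (cases "n = 0") (auto simp: weight_def)
  qed
  ultimately have "(\<lambda>n. fps_nth F n / weight (Suc d) n) \<longlonglongrightarrow> L * 0" by (simp only:)
  then show ?thesis unfolding tame_def by (rule convergentI)
qed

lemma tame_Fgf: "tame (Suc d) (Fgf (Suc d))"
  using acoeff_asymptotics[of "Suc d"] by (auto simp: tame_def Fgf_nth intro: convergentI)

section \<open>Counting trees with a prescribed truncation\<close>

definition trunc :: "nat \<Rightarrow> rtree \<Rightarrow> rtree" where
  "trunc r T = {v \<in> T. length v \<le> r}"

lemma trunc_node: "trunc (Suc r) (node L R N) = node (trunc r L) (trunc r R) (trunc r N)"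
proof (intro set_eqI)
  fix v show "v \<in> trunc (Suc r) (node L R N) \<longleftrightarrow> v \<in> node (trunc r L) (trunc r R) (trunc r N)"
  proof (cases v)
    case (Cons e w)
    then show ?thesis by (cases e) (auto simp: trunc_def)
  qed (auto simp: trunc_def)
qed

text \<open>A prescribed truncation splits at the root into three truncations of radius one less.
  Two concern the same dimension or an absent child, the third the dimension below, which
  \<open>tame_Suc\<close> lifts. Hence the induction is on \<open>r\<close> with \<open>d\<close>
  arbitrary.\<close>

lemma tame_trunc: "tame (Suc d) (tgf (etrees (Suc d)) (\<lambda>T. of_bool (trunc r T = H)))"
proof (induction r arbitrary: d H)
  case 0
  have "trunc 0 T = {[]}" if "T \<in> etrees (Suc d)" for T
    using that by (auto simp: trunc_def etrees_def)
  then have "tgf (etrees (Suc d)) (\<lambda>T. of_bool (trunc 0 T = H)) =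
      (tgf (etrees (Suc d)) (\<lambda>T. of_bool ({[]} = H)) :: real fps)"
    by (intro gf_cong) simp
  also have "\<dots> = (if {[]} = H then Fgf (Suc d) else 0)" by (simp add: Fgf_def gf_zero)
  finally show ?case using tame_Fgf tame_const[of "Suc d" 0] by simp
next
  case (Suc r)
  show ?case
  proof (cases "[] \<in> H")
    case False
    have "tgf (etrees (Suc d)) (\<lambda>T. of_bool (trunc (Suc r) T = H)) =
      (tgf (etrees (Suc d)) (\<lambda>T. 0) :: real fps)"
      using False by (intro gf_cong) (auto simp: trunc_def etrees_def)
    then show ?thesis using tame_const[of "Suc d" 0] by (simp add: gf_zero)
  next
    case True
    let ?H = "\<lambda>e. subtree H [e]" and ?\<phi> = "\<lambda>H T. of_bool (trunc r T = H)"
    have eq: "tgf (etrees (Suc d)) (\<lambda>T. of_bool (trunc (Suc r) T = H)) =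
      fps_const (1 / 4) * fps_X * (tgf (otrees (Suc d)) (?\<phi> (?H LeftE)) *
        tgf (otrees (Suc d)) (?\<phi> (?H RightE)) * tgf (etrees d) (?\<phi> (?H NextE)))"
    proof (rule tgf_node)
      fix L R N
      have "trunc (Suc r) (node L R N) = H \<longleftrightarrow>
          node (trunc r L) (trunc r R) (trunc r N) = node (?H LeftE) (?H RightE) (?H NextE)"
        by (simp add: trunc_node node_subtrees True)
      then show "of_bool (trunc (Suc r) (node L R N) = H) =
          (?\<phi> (?H LeftE) L * ?\<phi> (?H RightE) R * ?\<phi> (?H NextE) N :: real)"
        by (simp add: node_inject)
    qed
    have O: "tame (Suc d) (tgf (otrees (Suc d)) (?\<phi> H'))" for H'
      unfolding tgf_otrees by (intro tame_add tame_const Suc)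
    have N: "tame (Suc d) (tgf (etrees d) (?\<phi> H'))" for H'
    proof (cases d)
      case 0
      then show ?thesis by (simp add: tgf_etrees_0 tame_const)
    next
      case (Suc e)
      then show ?thesis using Suc.IH[of e] tame_Suc by blast
    qed
    show ?thesis unfolding eq by (intro tame_mult tame_const tame_X O N)
  qed
qed

abbreviation level_set :: "nat \<Rightarrow> nat \<Rightarrow> rtree set" where
  "level_set d n \<equiv> {T \<in> etrees d. card T = n}"

lemma card_dtrees_acoeff: "real (card {T \<in> etrees d. card T = n}) = 4 ^ n * acoeff d n"
  by (simp add: acoeff_def)

lemma eventually_acoeff_pos:
  assumes "0 < d"
  shows "\<forall>\<^sub>F n in sequentially. 0 < acoeff d n"
proof -
  obtain c where c: "0 < c" "(\<lambda>n. acoeff d n / weight d n) \<longlonglongrightarrow> c"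
    using acoeff_asymptotics[OF assms] by blast
  have "\<forall>\<^sub>F n in sequentially. 0 < acoeff d n / weight d n" using c by (intro order_tendstoD)
  then show ?thesis
  proof eventually_elim
    case (elim n)
    then have "acoeff d n \<noteq> 0" by auto
    then show ?case using acoeff_nonneg[of d n] by simp
  qed
qed

lemma measure_random_dtree:
  assumes "1 \<le> d" "0 < acoeff d n"
  shows "measure_pmf.prob (random_dtree d n) A = real (card (level_set d n \<inter> A)) / (4 ^ n * acoeff d n)"
proof -
  have "card (level_set d n) \<noteq> 0" using assms(2) unfolding acoeff_def zero_less_divide_iff by auto
  then have ne: "level_set d n \<noteq> {}" "finite (level_set d n)" by (auto simp: card_eq_0_iff)
  then show ?thesis
    unfolding random_dtree_def dtrees_eq[OF assms(1)] by (simp add: measure_pmf_of_set card_dtrees_acoeff)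
qed

theorem prob_trunc_convergent:
  assumes "1 \<le> d"
  shows "convergent (\<lambda>n. measure_pmf.prob (random_dtree d n) {T. trunc r T = H})"
proof -
  obtain e where d: "d = Suc e" using assms by (cases d) auto
  have pos: "\<forall>\<^sub>F n in sequentially. 0 < acoeff d n" using assms by (intro eventually_acoeff_pos) simp
  let ?C = "tgf (etrees d) (\<lambda>T. of_bool (trunc r T = H)) :: real fps"
  obtain c where c: "0 < c" "(\<lambda>n. acoeff d n / weight d n) \<longlonglongrightarrow> c"
    using acoeff_asymptotics[of d] assms by auto
  obtain L where L: "(\<lambda>n. fps_nth ?C n / weight d n) \<longlonglongrightarrow> L"
    using tame_trunc[of e r H] unfolding d tame_def convergent_def by blast
  have "(\<lambda>n. (fps_nth ?C n / weight d n) / (acoeff d n / weight d n)) \<longlonglongrightarrow> L / c"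
    using c by (intro tendsto_divide L) auto
  moreover have "\<forall>\<^sub>F n in sequentially. (fps_nth ?C n / weight d n) / (acoeff d n / weight d n) =
      measure_pmf.prob (random_dtree d n) {T. trunc r T = H}"
    using pos eventually_gt_at_top[of 0]
  proof eventually_elim
    case (elim n)
    have "fps_nth ?C n = real (card (level_set d n \<inter> {T. trunc r T = H})) / 4 ^ n"
      by (simp add: gf_nth of_bool_def sum.If_cases finite_etrees_card Int_def)
    then show ?case unfolding measure_random_dtree[OF assms elim(1)]
      using weight_pos[OF elim(2), of d] by simp
  qed
  ultimately have "(\<lambda>n. measure_pmf.prob (random_dtree d n) {T. trunc r T = H}) \<longlonglongrightarrow> L / c"
    by (rule Lim_transform_eventually)
  then show ?thesis by (rule convergentI)
qed


section \<open>Measures on the space of marked trees\<close>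

instance step :: finite
proof
  have "UNIV = range Up \<union> range Down" by (auto intro: step.exhaust)
  moreover have "finite (range Up \<union> range Down)" by simp
  ultimately show "finite (UNIV :: step set)" by metis
qed

lemma finite_truncate: "finite (range (truncate r))"
proof (rule finite_subset)
  show "range (truncate r) \<subseteq> Pow {s. length s \<le> r}" by (auto simp: truncate_def)
qed (simp add: finite_length_le)

lemma truncate_truncate: "q \<le> r \<Longrightarrow> {s \<in> truncate r t. length s \<le> q} = truncate q t"
  by (auto simp: truncate_def)

lemma truncate_mono: "truncate r t = truncate r t' \<Longrightarrow> q \<le> r \<Longrightarrow> truncate q t = truncate q t'"
  by (metis truncate_truncate)

lemma address_set_addresses: "address_set (addresses t)"
  using addresses[of t] by simp

text \<open>Each instance of a condition in \<open>address_set\<close> involves only addresses of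
  bounded length, and so can be checked inside one truncation.\<close>

lemma address_set_of_truncates:
  assumes "\<And>r. \<exists>t. {s \<in> S. length s \<le> r} = truncate r t"
  shows "address_set S"
proof -
  obtain t where t: "\<And>r. {s \<in> S. length s \<le> r} = truncate r (t r)" using assms by metis
  have S: "s \<in> S \<longleftrightarrow> s \<in> addresses (t r)" if "length s \<le> r" for s r
    using t[of r] that by (auto simp: truncate_def)
  have A: "[] \<in> addresses (t r)" "prefix_closed (addresses (t r))"
    "\<And>s. s \<in> addresses (t r) \<Longrightarrow> \<exists>a b. s = map Up a @ map Down b \<and> (a = [] \<or> b = [] \<or> last a \<noteq> hd b)"
    "\<And>a e e'. map Up a @ [Up e] \<in> addresses (t r) \<and> map Up a @ [Up e'] \<in> addresses (t r) \<Longrightarrow> e = e'" for r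
    using address_set_addresses[of "t r"] unfolding address_set_def by auto
  show ?thesis
    unfolding address_set_def
  proof (intro conjI ballI allI impI)
    show "[] \<in> S" using S[of "[]" 0] A(1) by simp
    show "prefix_closed S"
      unfolding prefix_closed_def
    proof (intro allI impI)
      fix s x assume "s @ [x] \<in> S"
      then show "s \<in> S" using S[of "s @ [x]" "Suc (length s)"] S[of s "Suc (length s)"] A(2)
        by (auto simp: prefix_closed_def)
    qed
    show "\<exists>a b. s = map Up a @ map Down b \<and> (a = [] \<or> b = [] \<or> last a \<noteq> hd b)" if "s \<in> S" for s
      using S[of s "length s"] A(3)[of s "length s"] that by simp
    show "e = e'" if "map Up a @ [Up e] \<in> S \<and> map Up a @ [Up e'] \<in> S" for a e e'
      using S[of "map Up a @ [Up e]" "Suc (length a)"] S[of "map Up a @ [Up e']" "Suc (length a)"]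
        A(4)[of a e "Suc (length a)" e'] that by simp
  qed
qed

text \<open>Compactness of the space of marked trees. A truncation takes finitely many values, so
  values occurring infinitely often can be chosen consistently for growing radii, and they glue to a
  marked tree.\<close>

lemma marked_tree_koenig:
  fixes t :: "nat \<Rightarrow> marked_tree"
  shows "\<exists>l. \<forall>r. infinite {n. truncate r (t n) = truncate r l}"
proof -
  have "\<exists>f. \<forall>r. infinite {n. truncate r (t n) = truncate r (t (f r))} \<and>
      truncate r (t (f (Suc r))) = truncate r (t (f r))"
  proof (rule dependent_nat_choice)
    have "\<exists>x\<in>range (\<lambda>n. truncate 0 (t n)). infinite {n \<in> UNIV. truncate 0 (t n) = x}"
      by (rule pigeonhole_infinite_rel) (auto intro: finite_subset[OF _ finite_truncate[of 0]])
    then show "\<exists>m. infinite {n. truncate 0 (t n) = truncate 0 (t m)}" by auto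
  next
    fix m r assume inf: "infinite {n. truncate r (t n) = truncate r (t m)}"
    let ?A = "{n. truncate r (t n) = truncate r (t m)}"
    have "\<exists>x\<in>range (\<lambda>n. truncate (Suc r) (t n)). infinite {n \<in> ?A. truncate (Suc r) (t n) = x}"
      using inf by (intro pigeonhole_infinite_rel) (auto intro: finite_subset[OF _ finite_truncate[of "Suc r"]])
    then obtain m' where m': "infinite {n \<in> ?A. truncate (Suc r) (t n) = truncate (Suc r) (t m')}" by auto
    from infinite_imp_nonempty[OF m'] obtain n where "n \<in> ?A" "truncate (Suc r) (t n) = truncate (Suc r) (t m')"
      by blast
    then have "truncate r (t m') = truncate r (t m)"
      using truncate_mono[of "Suc r" "t n" "t m'" r] by simp
    moreover have "infinite {n. truncate (Suc r) (t n) = truncate (Suc r) (t m')}"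
      using m' by (rule contrapos_nn) (auto elim: rev_finite_subset)
    ultimately show "\<exists>m'. infinite {n. truncate (Suc r) (t n) = truncate (Suc r) (t m')} \<and>
      truncate r (t m') = truncate r (t m)" by blast
  qed
  then obtain f where f: "\<And>r. infinite {n. truncate r (t n) = truncate r (t (f r))}"
    "\<And>r. truncate r (t (f (Suc r))) = truncate r (t (f r))" by blast
  have mono: "truncate q (t (f (q + k))) = truncate q (t (f q))" for q k
  proof (induction k)
    case (Suc k)
    have "truncate q (t (f (Suc (q + k)))) = truncate q (t (f (q + k)))"
      using f(2)[of "q + k"] by (rule truncate_mono) simp
    then show ?case using Suc by simp
  qed simp
  define S where "S = (\<Union>r. truncate r (t (f r)))"
  have S: "{s \<in> S. length s \<le> r} = truncate r (t (f r))" for r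
  proof (intro equalityI subsetI)
    fix s assume "s \<in> {s \<in> S. length s \<le> r}"
    then obtain q where q: "s \<in> truncate q (t (f q))" "length s \<le> r" by (auto simp: S_def)
    show "s \<in> truncate r (t (f r))"
    proof (cases "q \<le> r")
      case True
      then show ?thesis using q mono[of q "r - q"] by (auto simp: truncate_def)
    next
      case False
      then show ?thesis using q mono[of r "q - r"] by (auto simp: truncate_def)
    qed
  qed (auto simp: S_def truncate_def)
  then have "address_set S" by (intro address_set_of_truncates) blast
  then have "addresses (Abs_marked_tree S) = S" by (simp add: Abs_marked_tree_inverse)
  then have "truncate r (Abs_marked_tree S) = truncate r (t (f r))" for r
    using S[of r] by (simp add: truncate_def[of r "Abs_marked_tree S"])
  then show ?thesis using f(1) by (intro exI[of _ "Abs_marked_tree S"]) simp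
qed

section \<open>Cylinder sets and limits of their masses\<close>

definition cyl :: "nat \<Rightarrow> step list set \<Rightarrow> marked_tree set" where
  "cyl r h = {t. truncate r t = h}"

definition cylinders :: "marked_tree set set" where
  "cylinders = {{t. truncate r t \<in> H} | r H. True}"

lemma cylinder_raise:
  assumes "q \<le> r"
  shows "{t. truncate q t \<in> H} = {t. truncate r t \<in> {h. {s \<in> h. length s \<le> q} \<in> H}}"
  using truncate_truncate[OF assms] by simp

lemma cylindersI: "{t. truncate r t \<in> H} \<in> cylinders"
  by (auto simp: cylinders_def)

lemma cylindersE:
  assumes "A \<in> cylinders"
  obtains r H where "A = {t. truncate r t \<in> H}"
  using assms unfolding cylinders_def by blast

lemma cylinders_common_radius:
  assumes "A \<in> cylinders" "B \<in> cylinders"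
  obtains r H K where "A = {t. truncate r t \<in> H}" "B = {t. truncate r t \<in> K}"
proof -
  obtain q H q' K where *: "A = {t. truncate q t \<in> H}" "B = {t. truncate q' t \<in> K}"
    using assms unfolding cylinders_def by blast
  then show ?thesis
    using that[of "max q q'" "{h. {s \<in> h. length s \<le> q} \<in> H}" "{h. {s \<in> h. length s \<le> q'} \<in> K}"]
      cylinder_raise[of q "max q q'" H] cylinder_raise[of q' "max q q'" K] by simp
qed

lemma algebra_cylinders: "algebra UNIV cylinders"
  unfolding algebra_iff_Un
proof (intro conjI ballI)
  show "cylinders \<subseteq> Pow UNIV" by simp
  show "{} \<in> cylinders" using cylindersI[of 0 "{}"] by simp
  show "UNIV - A \<in> cylinders" if "A \<in> cylinders" for A
  proof -
    from that obtain r H where "A = {t. truncate r t \<in> H}" by (rule cylindersE)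
    then have "UNIV - A = {t. truncate r t \<in> - H}" by auto
    then show ?thesis using cylindersI by metis
  qed
  show "A \<union> B \<in> cylinders" if "A \<in> cylinders" "B \<in> cylinders" for A B
  proof -
    from that obtain r H K where "A = {t. truncate r t \<in> H}" "B = {t. truncate r t \<in> K}"
      by (rule cylinders_common_radius)
    then have "A \<union> B = {t. truncate r t \<in> H \<union> K}" by auto
    then show ?thesis using cylindersI by metis
  qed
qed

lemma open_cylinder: "open {t. truncate r t \<in> H}"
  unfolding open_marked_tree_def by (auto intro!: exI[of _ r])

text \<open>An open set is the countable union, over the radii, of the largest cylinder of that
  radius contained in it.\<close>

lemma sets_borel_cylinders: "sets (borel :: marked_tree measure) = sigma_sets UNIV cylinders"
  unfolding sets_borel
proof (rule sigma_sets_eqI)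
  fix U :: "marked_tree set" assume "U \<in> {S. open S}"
  then have U: "\<And>t. t \<in> U \<Longrightarrow> \<exists>r. \<forall>t'. truncate r t' = truncate r t \<longrightarrow> t' \<in> U"
    by (simp add: open_marked_tree_def)
  define H where "H r = {h. \<forall>t'. truncate r t' = h \<longrightarrow> t' \<in> U}" for r
  have "U = (\<Union>r. {t. truncate r t \<in> H r})"
  proof (intro equalityI subsetI)
    fix t assume "t \<in> U"
    then show "t \<in> (\<Union>r. {t. truncate r t \<in> H r})" using U[of t] by (auto simp: H_def)
  qed (auto simp: H_def)
  moreover have "(\<Union>r. {t. truncate r t \<in> H r}) \<in> sigma_sets UNIV cylinders"
    by (intro sigma_sets.Union sigma_sets.Basic cylindersI)
  ultimately show "U \<in> sigma_sets UNIV cylinders" by simp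
next
  fix A assume "A \<in> cylinders"
  then show "A \<in> sigma_sets UNIV {S. open S}"
    using open_cylinder by (intro sigma_sets.Basic) (auto simp: cylinders_def)
qed

lemma cylinder_decomp: "{t. truncate r t \<in> H} = (\<Union>h\<in>H \<inter> range (truncate r). cyl r h)"
  by (auto simp: cyl_def)

lemma cyl_borel: "{t. truncate r t \<in> H} \<in> sets borel" "cyl r h \<in> sets borel"
  using open_cylinder[of r H] open_cylinder[of r "{h}"] by (auto simp: cyl_def)

lemma measure_cylinder:
  assumes "M \<in> borel_probs"
  shows "measure M {t. truncate r t \<in> H} = (\<Sum>h\<in>H \<inter> range (truncate r). measure M (cyl r h))"
proof -
  interpret prob_space M using assms by (simp add: borel_probs_def)
  have sM: "sets M = sets borel" using assms by (simp add: borel_probs_def)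
  show ?thesis unfolding cylinder_decomp
  proof (rule finite_measure_finite_Union)
    show "finite (H \<inter> range (truncate r))" by (intro finite_Int disjI2 finite_truncate)
    show "cyl r ` (H \<inter> range (truncate r)) \<subseteq> sets M" using sM cyl_borel(2) by blast
    show "disjoint_family_on (cyl r) (H \<inter> range (truncate r))" by (auto simp: disjoint_family_on_def cyl_def)
  qed
qed

text \<open>Pointwise limits of probabilities are finitely additive on the algebra of cylinders. By
  compactness, continuity at the empty set is automatic, so Caratheodory's theorem applies without a
  tightness estimate.\<close>

theorem cylinder_limit_measure:
  fixes M :: "nat \<Rightarrow> marked_tree measure"
  assumes M: "\<And>n. M n \<in> borel_probs"
    and conv: "\<And>r h. convergent (\<lambda>n. measure (M n) (cyl r h))"
  shows "\<exists>N\<in>borel_probs. \<forall>r h. (\<lambda>n. measure (M n) (cyl r h)) \<longlonglongrightarrow> measure N (cyl r h)"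
proof -
  interpret algebra UNIV cylinders by (rule algebra_cylinders)
  define m where "m A = lim (\<lambda>n. measure (M n) A)" for A
  have setsM: "sets (M n) = sets borel" and prob: "prob_space (M n)" for n
    using M by (auto simp: borel_probs_def)
  have m: "(\<lambda>n. measure (M n) A) \<longlonglongrightarrow> m A" if "A \<in> cylinders" for A
  proof -
    from that obtain r H where A: "A = {t. truncate r t \<in> H}" by (rule cylindersE)
    have "convergent (\<lambda>n. measure (M n) A)"
      unfolding A measure_cylinder[OF M] by (intro convergent_sum conv)
    then show ?thesis unfolding m_def by (simp add: convergent_LIMSEQ_iff)
  qed
  have cyl_sets: "A \<in> sets (M n)" if "A \<in> cylinders" for A n
    using that sets_borel_cylinders setsM by auto
  have m0: "0 \<le> m A" if "A \<in> cylinders" for A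
    using m[OF that] by (rule LIMSEQ_le_const) auto
  have add: "m (A \<union> B) = m A + m B" if "A \<in> cylinders" "B \<in> cylinders" "A \<inter> B = {}" for A B
  proof (rule LIMSEQ_unique)
    show "(\<lambda>n. measure (M n) (A \<union> B)) \<longlonglongrightarrow> m (A \<union> B)" using that by (intro m Un)
    have "measure (M n) (A \<union> B) = measure (M n) A + measure (M n) B" for n
    proof -
      interpret prob_space "M n" by (rule prob)
      show ?thesis using that by (intro finite_measure_Union cyl_sets)
    qed
    then show "(\<lambda>n. measure (M n) (A \<union> B)) \<longlonglongrightarrow> m A + m B"
      using m that by (simp add: tendsto_add)
  qed
  have mUNIV: "m UNIV = 1"
  proof (rule LIMSEQ_unique)
    show "(\<lambda>n. measure (M n) UNIV) \<longlonglongrightarrow> m UNIV" using top by (intro m)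
    have "measure (M n) UNIV = 1" for n
      using prob_space.prob_space[OF prob[of n]] sets_eq_imp_space_eq[OF setsM[of n]] by simp
    then show "(\<lambda>n. measure (M n) UNIV) \<longlonglongrightarrow> 1" by simp
  qed
  have mempty: "m {} = 0" using add[of "{}" "{}"] empty_sets by simp
  have "\<exists>\<mu>. (\<forall>A\<in>cylinders. \<mu> A = ennreal (m A)) \<and> measure_space UNIV (sigma_sets UNIV cylinders) \<mu>"
  proof (rule caratheodory_empty_continuous)
    show "positive cylinders (\<lambda>A. ennreal (m A))" by (simp add: positive_def mempty)
    show "additive cylinders (\<lambda>A. ennreal (m A))" by (auto simp: additive_def add m0)
    show "ennreal (m A) \<noteq> \<infinity>" for A by simp
    fix A :: "nat \<Rightarrow> marked_tree set"
    assume A: "range A \<subseteq> cylinders" "decseq A" "(\<Inter>i. A i) = {}"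
    \<comment> \<open>Points chosen in the sets \<open>A i\<close> accumulate at some
      \<open>l\<close>. Each \<open>A i\<close> is decided by a bounded radius and contains all
      later points, hence contains \<open>l\<close>.\<close>
    have "\<exists>i. A i = {}"
    proof (rule ccontr)
      assume "\<nexists>i. A i = {}"
      then have "\<forall>i. \<exists>t. t \<in> A i" by blast
      then obtain t where t: "\<And>i. t i \<in> A i" by metis
      obtain l where l: "\<And>r. infinite {n. truncate r (t n) = truncate r l}"
        using marked_tree_koenig by blast
      have "l \<in> A i" for i
      proof -
        obtain r H where rH: "A i = {t. truncate r t \<in> H}"
          using A(1) cylindersE[of "A i"] by blast
        obtain n where "i \<le> n" "truncate r (t n) = truncate r l"
          using l[of r] unfolding infinite_nat_iff_unbounded_le by blast
        moreover have "t n \<in> A i" using t[of n] decseqD[OF A(2) \<open>i \<le> n\<close>] by blast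
        ultimately show ?thesis using rH by auto
      qed
      then show False using A(3) by blast
    qed
    then obtain i where "A i = {}" by blast
    then have "A n = {}" if "i \<le> n" for n using decseqD[OF A(2) that] by blast
    then have "\<forall>\<^sub>F n in sequentially. ennreal (m (A n)) = 0"
      by (intro eventually_mono[OF eventually_ge_at_top[of i]]) (simp add: mempty)
    then show "(\<lambda>i. ennreal (m (A i))) \<longlonglongrightarrow> 0" by (rule tendsto_eventually)
  qed
  then obtain \<mu> where \<mu>: "\<And>A. A \<in> cylinders \<Longrightarrow> \<mu> A = ennreal (m A)"
    "measure_space UNIV (sigma_sets UNIV cylinders) \<mu>" by blast
  define N where "N = measure_of UNIV (sigma_sets UNIV cylinders) \<mu>"
  have setsN: "sets N = sigma_sets UNIV cylinders" and spaceN: "space N = UNIV"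
    by (auto simp: N_def sigma_sets_sigma_sets_eq)
  have N: "emeasure N A = \<mu> A" if "A \<in> sigma_sets UNIV cylinders" for A
    unfolding N_def using \<mu>(2) that by (intro emeasure_measure_of_sigma) (auto simp: measure_space_def)
  have Nm: "measure N A = m A" if "A \<in> cylinders" for A
    using that N[of A] \<mu>(1) m0 by (simp add: measure_def sigma_sets.Basic)
  have "emeasure N (space N) = 1"
    using N[of UNIV] \<mu>(1)[of UNIV] top mUNIV by (simp add: spaceN sigma_sets.Basic)
  then have "N \<in> borel_probs"
    unfolding borel_probs_def using setsN sets_borel_cylinders by (auto intro: prob_spaceI)
  moreover have "(\<lambda>n. measure (M n) (cyl r h)) \<longlonglongrightarrow> measure N (cyl r h)" for r h
  proof -
    have "cyl r h \<in> cylinders" using cylindersI[of r "{h}"] by (simp add: cyl_def)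
    then show ?thesis using m Nm by simp
  qed
  ultimately show ?thesis by blast
qed

section \<open>Weak convergence expressed by cylinder masses\<close>

lemma uniformly_continuous_on_cylinders:
  fixes f :: "marked_tree \<Rightarrow> real"
  assumes "continuous_on UNIV f" "0 < e"
  shows "\<exists>r. \<forall>t t'. truncate r t = truncate r t' \<longrightarrow> \<bar>f t - f t'\<bar> < e"
proof (rule ccontr)
  assume "\<not> ?thesis"
  then obtain t t' where t: "\<And>r. truncate r (t r) = truncate r (t' r)" "\<And>r. e \<le> \<bar>f (t r) - f (t' r)\<bar>"
    by (metis not_less)
  \<comment> \<open>At an accumulation point of the first members of the bad pairs, the second
    members accumulate as well, since both agree to growing radius. Continuity there contradicts the
    gap \<open>e\<close>.\<close>
  obtain l where l: "\<And>r. infinite {n. truncate r (t n) = truncate r l}"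
    using marked_tree_koenig by blast
  have "open (f -` ball (f l) (e / 2))"
    using assms by (intro open_vimage) auto
  moreover have "l \<in> f -` ball (f l) (e / 2)" using assms by simp
  ultimately obtain r where r: "\<And>t. truncate r t = truncate r l \<Longrightarrow> t \<in> f -` ball (f l) (e / 2)"
    unfolding open_marked_tree_def by blast
  obtain n where n: "r \<le> n" "truncate r (t n) = truncate r l"
    using l[of r] unfolding infinite_nat_iff_unbounded_le by blast
  then have "truncate r (t' n) = truncate r l" using truncate_mono[OF t(1)[of n] n(1)] by simp
  then have "\<bar>f l - f (t n)\<bar> < e / 2" "\<bar>f l - f (t' n)\<bar> < e / 2"
    using r[of "t n"] r[of "t' n"] n(2) by (auto simp: dist_real_def)
  then show False using t(2)[of n] by linarith
qed

lemma bounded_continuous_integrable: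
  fixes f :: "marked_tree \<Rightarrow> real"
  assumes "continuous_on UNIV f" "bounded (range f)" "M \<in> borel_probs"
  shows "integrable M f"
proof -
  interpret prob_space M using assms by (simp add: borel_probs_def)
  obtain B where "\<And>x. norm (f x) \<le> B" using assms(2) by (auto simp: bounded_iff)
  moreover have "f \<in> borel_measurable M"
    using assms borel_measurable_continuous_onI[of f] measurable_cong_sets[of M borel] by (auto simp: borel_probs_def)
  ultimately show ?thesis by (intro integrable_const_bound[of _ B]) auto
qed

lemma integral_close_on_cylinders:
  fixes f :: "marked_tree \<Rightarrow> real"
  assumes f: "continuous_on UNIV f" "bounded (range f)" and M: "M \<in> borel_probs"
    and osc: "\<And>t t'. truncate r t = truncate r t' \<Longrightarrow> \<bar>f t - f t'\<bar> < e"
    and t: "\<And>h. h \<in> range (truncate r) \<Longrightarrow> truncate r (t h) = h"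
  shows "\<bar>(\<integral>x. f x \<partial>M) - (\<Sum>h\<in>range (truncate r). f (t h) * measure M (cyl r h))\<bar> \<le> e"
proof -
  interpret prob_space M using M by (simp add: borel_probs_def)
  have sM: "sets M = sets borel" and spM: "space M = UNIV"
    using M sets_eq_imp_space_eq[of M borel] by (auto simp: borel_probs_def)
  define g where "g x = (\<Sum>h\<in>range (truncate r). f (t h) * indicator (cyl r h) x)" for x
  have g: "g x = f (t (truncate r x))" for x
  proof -
    have "g x = (\<Sum>h\<in>range (truncate r). if h = truncate r x then f (t h) else 0)"
      unfolding g_def by (rule sum.cong) (auto simp: cyl_def indicator_def)
    then show ?thesis by (simp add: finite_truncate)
  qed
  have intf: "integrable M f" by (rule bounded_continuous_integrable[OF f M])
  have ii: "integrable M (\<lambda>x. f (t h) * indicator (cyl r h) x)" for h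
    using cyl_borel(2)[of r h] sM by (intro integrable_mult_right) (simp add: emeasure_eq_measure)
  have intg: "integrable M g" unfolding g_def by (intro Bochner_Integration.integrable_sum ii)
  have "(\<integral>x. g x \<partial>M) = (\<Sum>h\<in>range (truncate r). f (t h) * measure M (cyl r h))"
    unfolding g_def using ii cyl_borel(2) sM by (simp add: Bochner_Integration.integral_sum spM)
  moreover have "\<bar>(\<integral>x. f x \<partial>M) - (\<integral>x. g x \<partial>M)\<bar> \<le> e"
  proof -
    have "\<bar>f x - g x\<bar> \<le> e" for x
      using osc[of x "t (truncate r x)"] t[of "truncate r x"] by (simp add: g)
    then have "\<bar>\<integral>x. f x - g x \<partial>M\<bar> \<le> (\<integral>x. e \<partial>M)"
      by (intro order_trans[OF integral_abs_bound] integral_mono) (use intf intg in auto)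
    then show ?thesis using intf intg by (simp add: Bochner_Integration.integral_diff prob_space)
  qed
  ultimately show ?thesis by simp
qed

lemma weak_basic_nhd:
  fixes f :: "marked_tree \<Rightarrow> real"
  assumes f: "continuous_on UNIV f" "bounded (range f)" and M: "M \<in> borel_probs" and e: "0 < e"
  shows "\<exists>r. \<exists>\<delta>>0. \<forall>N\<in>borel_probs. (\<forall>h\<in>range (truncate r).
     \<bar>measure N (cyl r h) - measure M (cyl r h)\<bar> < \<delta>) \<longrightarrow> \<bar>(\<integral>x. f x \<partial>N) - (\<integral>x. f x \<partial>M)\<bar> < e"
proof -
  \<comment> \<open>Three errors of e / 4 are allowed: replacing \<open>f\<close> by a function of
    the truncation under each of the two measures, and changing the cylinder masses.\<close>
  obtain r where r: "\<And>t t'. truncate r t = truncate r t' \<Longrightarrow> \<bar>f t - f t'\<bar> < e / 4"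
    using uniformly_continuous_on_cylinders[OF f(1), of "e / 4"] e by auto
  define t where "t h = (SOME t. truncate r t = h)" for h
  have t: "truncate r (t h) = h" if "h \<in> range (truncate r)" for h
    using that someI_ex[of "\<lambda>t. truncate r t = h"] by (auto simp: t_def)
  define C where "C = (\<Sum>h\<in>range (truncate r). \<bar>f (t h)\<bar>)"
  have C: "0 \<le> C" by (simp add: C_def sum_nonneg)
  \<comment> \<open>The increment of \<open>C\<close> keeps the quotient meaningful when
    \<open>f\<close> vanishes at all representatives.\<close>
  define \<delta> where "\<delta> = e / (4 * (C + 1))"
  have \<delta>: "0 < \<delta>" using e C by (simp add: \<delta>_def)
  have "\<bar>(\<integral>x. f x \<partial>N) - (\<integral>x. f x \<partial>M)\<bar> < e" if N: "N \<in> borel_probs"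
    and d: "\<And>h. h \<in> range (truncate r) \<Longrightarrow> \<bar>measure N (cyl r h) - measure M (cyl r h)\<bar> < \<delta>" for N
  proof -
    let ?S = "\<lambda>N. \<Sum>h\<in>range (truncate r). f (t h) * measure N (cyl r h)"
    have "?S N - ?S M = (\<Sum>h\<in>range (truncate r). f (t h) * (measure N (cyl r h) - measure M (cyl r h)))"
      by (simp add: sum_subtractf right_diff_distrib)
    also have "\<bar>\<dots>\<bar> \<le> (\<Sum>h\<in>range (truncate r). \<bar>f (t h) * (measure N (cyl r h) - measure M (cyl r h))\<bar>)"
      by (rule sum_abs)
    also have "\<dots> \<le> (\<Sum>h\<in>range (truncate r). \<bar>f (t h)\<bar> * \<delta>)"
      unfolding abs_mult by (rule sum_mono, rule mult_left_mono, rule less_imp_le, rule d) auto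
    also have "\<dots> = C * \<delta>" by (simp add: C_def sum_distrib_right)
    also have "\<dots> \<le> e / 4" using C e by (simp add: \<delta>_def field_simps)
    finally have "\<bar>?S N - ?S M\<bar> \<le> e / 4" .
    then show ?thesis
      using integral_close_on_cylinders[OF f N r t] integral_close_on_cylinders[OF f M r t] e by linarith
  qed
  then show ?thesis using \<delta> by blast
qed

text \<open>Quantifying over all radii up to \<open>R\<close> makes the condition monotone in
  \<open>R\<close>, so a finite intersection of neighbourhoods is handled by a maximum of radii and
  a minimum of tolerances.\<close>

definition near :: "marked_tree measure \<Rightarrow> nat \<Rightarrow> real \<Rightarrow> marked_tree measure \<Rightarrow> bool" where
  "near M R \<delta> N \<longleftrightarrow> (\<forall>r\<le>R. \<forall>h\<in>range (truncate r). \<bar>measure N (cyl r h) - measure M (cyl r h)\<bar> < \<delta>)"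

lemma near_mono: "near M R \<delta> N \<Longrightarrow> R' \<le> R \<Longrightarrow> \<delta> \<le> \<delta>' \<Longrightarrow> near M R' \<delta>' N"
  unfolding near_def by (meson le_trans less_le_trans)

theorem weak_topology_nhd:
  fixes M :: "marked_tree measure"
  assumes "openin weak_topology U" "M \<in> U" "M \<in> borel_probs"
  shows "\<exists>R. \<exists>\<delta>>0. \<forall>N\<in>borel_probs. near M R \<delta> N \<longrightarrow> N \<in> U"
proof -
  have "generate_topology_on {{M \<in> borel_probs. (\<integral>x. f x \<partial>M) \<in> U} | (f :: marked_tree \<Rightarrow> real) U.
        continuous_on UNIV f \<and> bounded (range f) \<and> open U} U"
    using assms(1) unfolding weak_topology_def openin_topology_generated_by_iff .
  then show ?thesis using assms(2)
  proof (induction rule: generate_topology_on.induct)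
    case Empty
    then show ?case by simp
  next
    case (Int A B)
    obtain R \<delta> where 1: "0 < \<delta>" "\<And>N. N \<in> borel_probs \<Longrightarrow> near M R \<delta> N \<Longrightarrow> N \<in> A"
      using Int.IH(1) Int.prems by blast
    obtain R' \<delta>' where 2: "0 < \<delta>'" "\<And>N. N \<in> borel_probs \<Longrightarrow> near M R' \<delta>' N \<Longrightarrow> N \<in> B"
      using Int.IH(2) Int.prems by blast
    have "N \<in> A \<inter> B" if "N \<in> borel_probs" "near M (max R R') (min \<delta> \<delta>') N" for N
      using 1(2)[OF that(1)] 2(2)[OF that(1)] near_mono[OF that(2)] by simp
    moreover have "0 < min \<delta> \<delta>'" using 1(1) 2(1) by simp
    ultimately show ?case by blast
  next
    case (UN K)
    then obtain S where "S \<in> K" "M \<in> S" by blast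
    then show ?case using UN.IH[of S] by blast
  next
    case (Basis S)
    then obtain f :: "marked_tree \<Rightarrow> real" and V where S: "S = {M \<in> borel_probs. (\<integral>x. f x \<partial>M) \<in> V}"
      and f: "continuous_on UNIV f" "bounded (range f)" "open V" by blast
    have "(\<integral>x. f x \<partial>M) \<in> V" using Basis.prems S by simp
    then obtain e where e: "0 < e" "\<And>y. \<bar>y - (\<integral>x. f x \<partial>M)\<bar> < e \<Longrightarrow> y \<in> V"
      using f(3) unfolding open_dist dist_real_def by blast
    obtain r \<delta> where "0 < \<delta>" and r: "\<And>N. N \<in> borel_probs \<Longrightarrow> (\<forall>h\<in>range (truncate r).
        \<bar>measure N (cyl r h) - measure M (cyl r h)\<bar> < \<delta>) \<Longrightarrow> \<bar>(\<integral>x. f x \<partial>N) - (\<integral>x. f x \<partial>M)\<bar> < e"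
      using weak_basic_nhd[OF f(1,2) assms(3) e(1)] by blast
    have "N \<in> S" if "N \<in> borel_probs" "near M r \<delta> N" for N
      using r[OF that(1)] that e(2) S by (simp add: near_def)
    then show ?case using \<open>0 < \<delta>\<close> by blast
  qed
qed

lemma topspace_weak_topology: "topspace (weak_topology :: 'a::topological_space measure topology) = borel_probs"
proof -
  have "borel_probs \<in> {{M \<in> borel_probs. (\<integral>x. f x \<partial>M) \<in> U} | (f :: 'a \<Rightarrow> real) U.
        continuous_on UNIV f \<and> bounded (range f) \<and> open U}"
    by (rule CollectI, rule exI[of _ "\<lambda>_. 0"], rule exI[of _ UNIV]) auto
  then show ?thesis unfolding weak_topology_def topology_generated_by_topspace by blast
qed

theorem limitin_weak_topology_cyl:
  assumes M: "M \<in> borel_probs" and N: "\<And>n. N n \<in> borel_probs"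
    and lim: "\<And>r h. (\<lambda>n. measure (N n) (cyl r h)) \<longlonglongrightarrow> measure M (cyl r h)"
  shows "limitin weak_topology N M sequentially"
  unfolding limitin_def topspace_weak_topology
proof (intro conjI allI impI M)
  fix U assume U: "openin weak_topology U \<and> M \<in> U"
  then obtain R \<delta> where R: "0 < \<delta>" "\<And>N. N \<in> borel_probs \<Longrightarrow> near M R \<delta> N \<Longrightarrow> N \<in> U"
    using weak_topology_nhd[of U M] M by blast
  have "\<forall>\<^sub>F n in sequentially. \<bar>measure (N n) (cyl r h) - measure M (cyl r h)\<bar> < \<delta>" for r h
    using tendstoD[OF lim R(1)] by (simp add: dist_real_def)
  then have "\<forall>\<^sub>F n in sequentially. \<forall>r\<in>{..R}. \<forall>h\<in>range (truncate r).
      \<bar>measure (N n) (cyl r h) - measure M (cyl r h)\<bar> < \<delta>"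
    by (intro eventually_ball_finite ballI finite_truncate finite_atMost)
  then show "\<forall>\<^sub>F n in sequentially. N n \<in> U"
    by eventually_elim (use R(2) N in \<open>auto simp: near_def\<close>)
qed

lemma prob_eventually_all:
  fixes P :: "nat \<Rightarrow> 'a pmf"
  assumes "finite I" "\<And>i. i \<in> I \<Longrightarrow> (\<lambda>n. measure_pmf.prob (P n) {x. Q i n x}) \<longlonglongrightarrow> 1"
  shows "(\<lambda>n. measure_pmf.prob (P n) {x. \<forall>i\<in>I. Q i n x}) \<longlonglongrightarrow> 1"
proof (rule tendsto_sandwich)
  have "(\<lambda>n. 1 - (\<Sum>i\<in>I. 1 - measure_pmf.prob (P n) {x. Q i n x})) \<longlonglongrightarrow> 1 - (\<Sum>i\<in>I. 1 - 1)"
    by (intro tendsto_diff tendsto_sum tendsto_const assms(2))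
  then show "(\<lambda>n. 1 - (\<Sum>i\<in>I. 1 - measure_pmf.prob (P n) {x. Q i n x})) \<longlonglongrightarrow> 1" by simp
  have "1 - (\<Sum>i\<in>I. 1 - measure_pmf.prob (P n) {x. Q i n x}) \<le> measure_pmf.prob (P n) {x. \<forall>i\<in>I. Q i n x}" for n
  proof -
    have "1 - measure_pmf.prob (P n) {x. \<forall>i\<in>I. Q i n x} = measure_pmf.prob (P n) (UNIV - {x. \<forall>i\<in>I. Q i n x})"
      by (subst measure_pmf.finite_measure_Diff) auto
    also have "UNIV - {x. \<forall>i\<in>I. Q i n x} = (\<Union>i\<in>I. UNIV - {x. Q i n x})" by auto
    also have "measure_pmf.prob (P n) \<dots> \<le> (\<Sum>i\<in>I. measure_pmf.prob (P n) (UNIV - {x. Q i n x}))"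
      by (intro measure_pmf.finite_measure_subadditive_finite assms(1)) auto
    also have "\<dots> = (\<Sum>i\<in>I. 1 - measure_pmf.prob (P n) {x. Q i n x})"
      by (intro sum.cong refl, subst measure_pmf.finite_measure_Diff) auto
    finally show ?thesis by linarith
  qed
  then show "\<forall>\<^sub>F n in sequentially. 1 - (\<Sum>i\<in>I. 1 - measure_pmf.prob (P n) {x. Q i n x}) \<le>
      measure_pmf.prob (P n) {x. \<forall>i\<in>I. Q i n x}" by simp
qed auto

theorem converges_in_prob_cyl:
  fixes P :: "nat \<Rightarrow> 'a pmf"
  assumes M: "M \<in> borel_probs" and Y: "\<And>n x. Y n x \<in> borel_probs"
    and lim: "\<And>r h e. 0 < e \<Longrightarrow>
      (\<lambda>n. measure_pmf.prob (P n) {x. \<bar>measure (Y n x) (cyl r h) - measure M (cyl r h)\<bar> < e}) \<longlonglongrightarrow> 1"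
  shows "converges_in_prob weak_topology P Y M"
  unfolding converges_in_prob_def topspace_weak_topology
proof (intro conjI allI impI M)
  fix U assume U: "openin weak_topology U \<and> M \<in> U"
  then obtain R \<delta> where R: "0 < \<delta>" "\<And>N. N \<in> borel_probs \<Longrightarrow> near M R \<delta> N \<Longrightarrow> N \<in> U"
    using weak_topology_nhd[of U M] M by blast
  let ?Q = "\<lambda>n x. \<forall>r\<in>{..R}. \<forall>h\<in>range (truncate r). \<bar>measure (Y n x) (cyl r h) - measure M (cyl r h)\<bar> < \<delta>"
  have "(\<lambda>n. measure_pmf.prob (P n) {x. ?Q n x}) \<longlonglongrightarrow> 1"
    by (intro prob_eventually_all finite_truncate finite_atMost lim R(1))
  then show "(\<lambda>n. measure_pmf.prob (P n) {x. Y n x \<in> U}) \<longlonglongrightarrow> 1"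
  proof (rule tendsto_sandwich[rotated 2])
    have "{x. ?Q n x} \<subseteq> {x. Y n x \<in> U}" for n using R(2) Y by (auto simp: near_def)
    then show "\<forall>\<^sub>F n in sequentially. measure_pmf.prob (P n) {x. ?Q n x} \<le> measure_pmf.prob (P n) {x. Y n x \<in> U}"
      by (intro always_eventually allI measure_pmf.finite_measure_mono) auto
  qed auto
qed


section \<open>Occurrences of fringe subtrees\<close>

text \<open>Only left and right edges may lead to an occurrence: those children are optional, so
  cutting one off leaves a tree of the class, whereas a \<open>NextE\<close> child is
  obligatory.\<close>

definition occ :: "rtree \<Rightarrow> rtree \<Rightarrow> vertex set" where
  "occ S T = {p \<in> T. p \<noteq> [] \<and> last p \<noteq> NextE \<and> subtree T p = S}"

text \<open>The free left and right positions on the last level. These are the places where a binary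
  tree can be grafted without creating an obligation to attach further trees.\<close>

definition slots :: "nat \<Rightarrow> rtree \<Rightarrow> vertex set" where
  "slots d T = {p. p \<notin> T \<and> p \<noteq> [] \<and> last p \<noteq> NextE \<and> butlast p \<in> T \<and> Suc (level p) = d}"

definition graft :: "rtree \<Rightarrow> vertex \<Rightarrow> rtree \<Rightarrow> rtree" where
  "graft T p S = T \<union> (@) p ` S"

definition prune :: "rtree \<Rightarrow> vertex \<Rightarrow> rtree" where
  "prune T p = T - range ((@) p)"

lemma level_snoc: "e \<noteq> NextE \<Longrightarrow> level (v @ [e]) = level v"
  by (cases e) auto

lemma level_butlast: "p \<noteq> [] \<Longrightarrow> last p \<noteq> NextE \<Longrightarrow> level (butlast p) = level p"
  by (metis append_butlast_last_id level_snoc)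

lemma etreesD:
  assumes "T \<in> etrees d"
  shows "finite T" "prefix_closed T" "v \<in> T \<Longrightarrow> level v < d"
    "v \<in> T \<Longrightarrow> v @ [NextE] \<in> T \<longleftrightarrow> Suc (level v) < d" "[] \<in> T \<longleftrightarrow> 0 < d"
  using assms by (auto simp: etrees_def)

lemma below_slot: "prefix_closed T \<Longrightarrow> p \<notin> T \<Longrightarrow> p @ w \<notin> T"
  using prefix_closedD by blast

lemma graft_slot:
  assumes T: "T \<in> etrees d" and S: "S \<in> etrees 1" and p: "p \<in> slots d T"
  shows "graft T p S \<in> etrees d" "card (graft T p S) = card T + card S"
    "p \<in> occ S (graft T p S)" "prune (graft T p S) p = T"
proof -
  note t = etreesD[OF T] and s = etreesD[OF S]
  have p': "p \<notin> T" "p \<noteq> []" "last p \<noteq> NextE" "butlast p \<in> T" "Suc (level p) = d"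
    using p by (auto simp: slots_def)
  have nb: "p @ w \<notin> T" for w using below_slot[OF t(2) p'(1)] .
  have mem: "p @ w \<in> graft T p S \<longleftrightarrow> w \<in> S" for w using nb by (auto simp: graft_def)
  have "prefix_closed (graft T p S)"
    unfolding prefix_closed_def
  proof (intro allI impI)
    fix v x assume "v @ [x] \<in> graft T p S"
    then consider "v @ [x] \<in> T" | w where "w \<in> S" "v @ [x] = p @ w" by (auto simp: graft_def)
    then show "v \<in> graft T p S"
    proof cases
      case 1
      then show ?thesis using t(2) by (auto simp: prefix_closed_def graft_def)
    next
      case 2
      show ?thesis
      proof (cases w rule: rev_cases)
        case Nil
        then have "v = butlast p" using 2 by (metis append.right_neutral butlast_snoc)
        then show ?thesis using p'(4) by (simp add: graft_def)
      next
        case (snoc w' y)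
        then have "w' \<in> S" using 2(1) s(2) by (auto simp: prefix_closed_def)
        then show ?thesis using 2(2) snoc by (simp add: graft_def)
      qed
    qed
  qed
  moreover have "level v < d \<and> (v @ [NextE] \<in> graft T p S \<longleftrightarrow> Suc (level v) < d)"
    if "v \<in> graft T p S" for v
  proof (cases "v \<in> T")
    case True
    have "v @ [NextE] \<notin> (@) p ` S" 
    proof
      assume "v @ [NextE] \<in> (@) p ` S"
      then obtain w where w: "w \<in> S" "v @ [NextE] = p @ w" by blast
      show False
      proof (cases w rule: rev_cases)
        case Nil
        then show False using w(2) p'(3) by (metis append.right_neutral last_snoc)
      next
        case (snoc w' y)
        then show False using w(2) nb[of w'] True by simp
      qed
    qed
    then show ?thesis using t(3,4)[OF True] by (auto simp: graft_def)
  next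
    case False
    with that obtain w where w: "w \<in> S" "v = p @ w" by (auto simp: graft_def)
    then have "level w = 0" "w @ [NextE] \<notin> S" using s(3,4)[of w] by auto
    then show ?thesis using w p'(5) mem[of "w @ [NextE]"] by auto
  qed
  moreover have "[] \<in> graft T p S \<longleftrightarrow> 0 < d" using t(5) p'(2) by (auto simp: graft_def)
  moreover have fin: "finite (graft T p S)" using t(1) s(1) by (simp add: graft_def)
  ultimately show "graft T p S \<in> etrees d" unfolding etrees_def by blast
  have "T \<inter> (@) p ` S = {}" using nb by auto
  then have "card (graft T p S) = card T + card ((@) p ` S)"
    unfolding graft_def using t(1) s(1) by (intro card_Un_disjoint) auto
  then show "card (graft T p S) = card T + card S" by (simp add: card_image inj_on_def)
  have "[] \<in> S" using s(5) by simp
  then show "p \<in> occ S (graft T p S)" using p' mem by (auto simp: occ_def subtree_def graft_def)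
  show "prune (graft T p S) p = T" using nb by (auto simp: prune_def graft_def)
qed

lemma prune_occ:
  assumes T: "T \<in> etrees d" and S: "S \<in> etrees 1" and p: "p \<in> occ S T"
  shows "prune T p \<in> etrees d" "card T = card (prune T p) + card S"
    "p \<in> slots d (prune T p)" "graft (prune T p) p S = T"
proof -
  note t = etreesD[OF T] and s = etreesD[OF S]
  have p': "p \<in> T" "p \<noteq> []" "last p \<noteq> NextE" and sub: "subtree T p = S"
    using p by (auto simp: occ_def)
  have mem: "p @ w \<in> T \<longleftrightarrow> w \<in> S" for w using sub by (auto simp: subtree_def)
  \<comment> \<open>A copy of a binary tree has no \<open>NextE\<close> child at its root, which is
    possible only on the last level.\<close>
  have d: "Suc (level p) = d"
  proof -
    have "[] @ [NextE] \<in> S \<longleftrightarrow> Suc (level []) < 1" using s(4)[of "[]"] s(5) by simp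
    then have "p @ [NextE] \<notin> T" using mem[of "[NextE]"] by simp
    then show ?thesis using t(3,4)[OF p'(1)] by auto
  qed
  have next_in: "v @ [NextE] \<in> prune T p" if "v \<in> prune T p" "v @ [NextE] \<in> T" for v
  proof -
    have "v @ [NextE] \<noteq> p @ w" for w
      using that(1) p'(3) by (cases w rule: rev_cases) (auto simp: prune_def)
    then show ?thesis using that by (auto simp: prune_def)
  qed
  have "prefix_closed (prune T p)"
    unfolding prefix_closed_def
  proof (intro allI impI)
    fix v x assume vx: "v @ [x] \<in> prune T p"
    have "v \<in> T" using vx t(2) by (auto simp: prefix_closed_def prune_def)
    moreover have "v \<noteq> p @ w" for w using vx by (auto simp: prune_def)
    ultimately show "v \<in> prune T p" by (auto simp: prune_def)
  qed
  moreover have "level v < d \<and> (v @ [NextE] \<in> prune T p \<longleftrightarrow> Suc (level v) < d)" if "v \<in> prune T p" for v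
    using t(3,4)[of v] that next_in[OF that] by (auto simp: prune_def)
  moreover have "[] \<in> prune T p \<longleftrightarrow> 0 < d" using t(5) p'(2) by (auto simp: prune_def)
  moreover have "finite (prune T p)" using t(1) by (simp add: prune_def)
  ultimately show "prune T p \<in> etrees d" unfolding etrees_def by blast
  show gr: "graft (prune T p) p S = T" using mem by (auto simp: graft_def prune_def)
  have "T = prune T p \<union> (@) p ` S" using gr by (simp add: graft_def)
  moreover have "prune T p \<inter> (@) p ` S = {}" by (auto simp: prune_def)
  moreover have "finite (prune T p)" "finite ((@) p ` S)" using t(1) s(1) by (auto simp: prune_def)
  ultimately have "card T = card (prune T p) + card ((@) p ` S)" using card_Un_disjoint by metis
  then show "card T = card (prune T p) + card S" by (simp add: card_image inj_on_def)
  have "butlast p \<in> T"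
    using p'(1,2) t(2) unfolding prefix_closed_def by (metis append_butlast_last_id)
  moreover have "butlast p \<noteq> p @ w" for w
    using p'(2) by (metis append_self_conv butlast_append append_butlast_last_id length_append_singleton
        length_append not_add_less1 lessI)
  ultimately show "p \<in> slots d (prune T p)" using p' d by (auto simp: slots_def prune_def)
qed

lemma finite_occ: "finite T \<Longrightarrow> finite (occ S T)"
  by (simp add: occ_def)

lemma finite_slots: "finite T \<Longrightarrow> finite (slots d T)"
proof -
  assume "finite T"
  then have "finite ((\<lambda>(v, e). v @ [e]) ` (T \<times> UNIV))" by simp
  moreover have "slots d T \<subseteq> (\<lambda>(v, e). v @ [e]) ` (T \<times> UNIV)"
  proof
    fix p assume "p \<in> slots d T"
    then have "p = butlast p @ [last p]" "butlast p \<in> T" by (auto simp: slots_def)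
    then show "p \<in> (\<lambda>(v, e). v @ [e]) ` (T \<times> UNIV)" by (intro image_eqI[of _ _ "(butlast p, last p)"]) auto
  qed
  ultimately show ?thesis by (rule rev_finite_subset)
qed

text \<open>Remembering \<open>p\<close> makes cutting and grafting inverse to each other. The first
  moment of the number of occurrences is thereby an exact count of slots in smaller trees.\<close>

lemma bij_prune:
  assumes S: "S \<in> etrees 1"
  shows "bij_betw (\<lambda>(T, p). (prune T p, p)) (SIGMA T:level_set d (n + card S). occ S T) (SIGMA T:level_set d n. slots d T)"
proof (rule bij_betw_byWitness[where f' = "\<lambda>(T, p). (graft T p S, p)"])
qed (use prune_occ[OF _ S] graft_slot[OF _ S] in auto)

lemma sum_occ_eq:
  assumes S: "S \<in> etrees 1"
  shows "(\<Sum>T\<in>level_set d (n + card S). card (occ S T)) = (\<Sum>T\<in>level_set d n. card (slots d T))"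
proof -
  have "card (SIGMA T:level_set d (n + card S). occ S T) = card (SIGMA T:level_set d n. slots d T)"
    using bij_prune[OF S] by (rule bij_betw_same_card)
  moreover have "card (SIGMA T:level_set d (n + card S). occ S T) = (\<Sum>T\<in>level_set d (n + card S). card (occ S T))"
    using finite_etrees_card finite_occ finite_etrees by (intro card_SigmaI) auto
  moreover have "card (SIGMA T:level_set d n. slots d T) = (\<Sum>T\<in>level_set d n. card (slots d T))"
    using finite_etrees_card finite_slots finite_etrees by (intro card_SigmaI) auto
  ultimately show ?thesis by simp
qed

text \<open>If \<open>S\<close> reappeared as its own subtree at a nonempty word w, all powers of w
  would be vertices of \<open>S\<close>, contradicting finiteness.\<close>

lemma occ_incomparable:
  assumes T: "T \<in> etrees d" and p: "p \<in> occ S T" "q \<in> occ S T" "q = p @ w"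
  shows "w = []"
proof (rule ccontr)
  assume w: "w \<noteq> []"
  have fin: "finite S" using p(1) etreesD(1)[OF T] by (auto simp: occ_def finite_subtree)
  have "subtree S w = S" using p by (auto simp: occ_def subtree_def)
  then have "w @ u \<in> S \<longleftrightarrow> u \<in> S" for u by (auto simp: subtree_def)
  moreover have "[] \<in> S" using p(1) by (auto simp: occ_def subtree_def)
  ultimately have "((@) w ^^ n) [] \<in> S" for n by (induction n) auto
  moreover have "length (((@) w ^^ n) []) = n * length w" for n by (induction n) auto
  then have "inj (\<lambda>n. ((@) w ^^ n) [])" using w by (intro injI) (metis length_0_conv mult_cancel2)
  ultimately have "infinite S" by (meson finite_subset image_subsetI infinite_iff_countable_subset rev_finite_subset)
  then show False using fin by simp
qed

lemma occ_prune:
  assumes T: "T \<in> etrees d" and p: "p \<in> occ S T" and q: "q \<in> occ S T" and ne: "p \<noteq> q"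
  shows "q \<in> occ S (prune T p)"
proof -
  have 1: "q \<noteq> p @ w" for w using occ_incomparable[OF T p q] ne by auto
  have 2: "q @ w \<noteq> p @ w'" for w w'
  proof
    assume "q @ w = p @ w'"
    then obtain u where "q = p @ u \<or> p = q @ u" by (metis append_eq_append_conv2)
    then show False using 1 occ_incomparable[OF T q p] ne by auto
  qed
  have "subtree (prune T p) q = subtree T q" using 2 by (auto simp: subtree_def prune_def)
  then show ?thesis using q 1 by (auto simp: occ_def prune_def)
qed

text \<open>Two occurrences of \<open>S\<close> are incomparable, so one of them survives the removal of the other.\<close>

lemma sum_occ_pairs:
  assumes S: "S \<in> etrees 1"
  shows "(\<Sum>T\<in>level_set d (n + card S). card (occ S T) * (card (occ S T) - 1)) \<le>
    (\<Sum>T\<in>level_set d n. card (slots d T) * card (occ S T))"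
proof -
  let ?P = "SIGMA T:level_set d (n + card S). (SIGMA p:occ S T. occ S T - {p})"
  let ?Q = "SIGMA T:level_set d n. slots d T \<times> occ S T"
  let ?f = "\<lambda>(T, p, q). (prune T p, p, q)"
  have fin: "finite T" if "T \<in> level_set d n" for T n using that finite_etrees by auto
  \<comment> \<open>Only an injection is to be expected: grafting at a slot inside the copy of
    \<open>S\<close> at q would destroy that copy. An upper bound is all the variance needs.\<close>
  have im: "?f ` ?P \<subseteq> ?Q"
  proof
    fix y assume "y \<in> ?f ` ?P"
    then obtain T p q where y: "y = (prune T p, p, q)" and T: "T \<in> etrees d" "card T = n + card S"
      and pq: "p \<in> occ S T" "q \<in> occ S T" "p \<noteq> q" by auto
    show "y \<in> ?Q"
      unfolding y using prune_occ[OF T(1) S pq(1)] occ_prune[OF T(1) pq] T(2) by auto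
  qed
  have inj: "inj_on ?f ?P"
  proof (rule inj_onI)
    fix x y assume xy: "x \<in> ?P" "y \<in> ?P" and eq: "?f x = ?f y"
    from xy(1) obtain T p q where x: "x = (T, p, q)" "T \<in> etrees d" "p \<in> occ S T" by auto
    from xy(2) obtain T' p' q' where y: "y = (T', p', q')" "T' \<in> etrees d" "p' \<in> occ S T'" by auto
    have "prune T p = prune T' p'" "p = p'" "q = q'" using eq x(1) y(1) by auto
    moreover have "T = graft (prune T p) p S" "T' = graft (prune T' p') p' S"
      using prune_occ(4)[OF x(2) S x(3)] prune_occ(4)[OF y(2) S y(3)] by auto
    ultimately show "x = y" using x(1) y(1) by metis
  qed
  have finO: "finite (occ S T)" if "T \<in> level_set d n" for T n
    using fin[OF that] by (rule finite_occ)
  have finS: "finite (slots d T)" if "T \<in> level_set d n" for T n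
    using fin[OF that] by (rule finite_slots)
  have finQ: "finite (slots d T \<times> occ S T)" if "T \<in> level_set d n" for T n
    by (rule finite_cartesian_product[OF finS[OF that] finO[OF that]])
  have "finite ?Q" by (rule finite_SigmaI[OF finite_etrees_card finQ])
  with inj im have "card ?P \<le> card ?Q" by (rule card_inj_on_le)
  moreover have "card ?P = (\<Sum>T\<in>level_set d (n + card S). card (occ S T) * (card (occ S T) - 1))"
  proof -
    have "card (SIGMA p:occ S T. occ S T - {p}) = card (occ S T) * (card (occ S T) - 1)"
      if "T \<in> level_set d (n + card S)" for T
    proof -
      have f: "finite (occ S T)" using that by (rule finO)
      have "card (SIGMA p:occ S T. occ S T - {p}) = (\<Sum>p\<in>occ S T. card (occ S T - {p}))"
        using f by (intro card_SigmaI) auto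
      also have "\<dots> = (\<Sum>p\<in>occ S T. card (occ S T) - 1)"
        using f by (intro sum.cong) (auto simp: card_Diff_singleton)
      finally show ?thesis by simp
    qed
    moreover have "card ?P = (\<Sum>T\<in>level_set d (n + card S). card (SIGMA p:occ S T. occ S T - {p}))"
    proof (rule card_SigmaI[OF finite_etrees_card], rule ballI)
      fix T assume "T \<in> level_set d (n + card S)"
      then have "finite (occ S T)" by (rule finO)
      then show "finite (SIGMA p:occ S T. occ S T - {p})" by simp
    qed
    ultimately show ?thesis by simp
  qed
  moreover have "card ?Q = (\<Sum>T\<in>level_set d n. card (slots d T) * card (occ S T))"
    unfolding card_cartesian_product[symmetric]
    by (rule card_SigmaI[OF finite_etrees_card]) (use finQ in blast)
  ultimately show ?thesis by simp
qed

text \<open>Let V be the vertices on the last level, K the others, and X the members of V reached by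
  a left or right edge. The positions below V number 2 |V|, and X is exactly the occupied part, so
  there are 2 |V| - |X| slots. Now |X| \<le> |V| gives the lower bound. The members of V outside X
  are the root or \<open>NextE\<close> children of K, so |V| \<le> |X| + 1 + |K|, which gives the
  upper bound.\<close>

lemma slots_bounds:
  assumes T: "T \<in> etrees d" and d: "0 < d"
  shows "real (card T) - branchings T \<le> real (card (slots d T))" "card (slots d T) \<le> card T + 1"
proof -
  note t = etreesD[OF T]
  define K where "K = {v. v @ [NextE] \<in> T}"
  define V where "V = {v \<in> T. Suc (level v) = d}"
  define X where "X = {p \<in> V. p \<noteq> [] \<and> last p \<noteq> NextE}"
  let ?snoc = "\<lambda>(v, e). v @ [e] :: vertex"
  have KT: "K \<subseteq> T" using t(2) by (auto simp: K_def prefix_closed_def)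
  have finK: "finite K" "finite V" "finite X" using KT t(1) by (auto simp: V_def X_def elim: finite_subset)
  have V: "V = T - K" using t(3,4) by (fastforce simp: V_def K_def)
  have cV: "card V + card K = card T"
    unfolding V using KT t(1) card_mono[of T K] finite_subset[OF KT] by (simp add: card_Diff_subset)
  have un: "?snoc ` (V \<times> {LeftE, RightE}) = slots d T \<union> X"
  proof (intro equalityI subsetI)
    fix p assume "p \<in> ?snoc ` (V \<times> {LeftE, RightE})"
    then obtain v e where "p = v @ [e]" "v \<in> V" "e \<noteq> NextE" by auto
    then show "p \<in> slots d T \<union> X" by (cases e) (auto simp: slots_def X_def V_def)
  next
    fix p assume p: "p \<in> slots d T \<union> X"
    then have ne: "p \<noteq> []" "last p \<noteq> NextE" and l: "Suc (level p) = d"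
      by (auto simp: slots_def X_def V_def)
    have "p \<in> T \<Longrightarrow> butlast p \<in> T" using t(2) ne(1) unfolding prefix_closed_def by (metis append_butlast_last_id)
    then have "butlast p \<in> V" using p l level_butlast[OF ne] by (auto simp: slots_def X_def V_def)
    moreover have "last p \<in> {LeftE, RightE}" using ne(2) by (cases "last p") auto
    ultimately show "p \<in> ?snoc ` (V \<times> {LeftE, RightE})"
      using ne(1) by (intro image_eqI[of _ _ "(butlast p, last p)"]) auto
  qed
  have "card (slots d T \<union> X) = 2 * card V"
    unfolding un[symmetric] by (subst card_image) (auto simp: inj_on_def card_cartesian_product)
  moreover have "card (slots d T \<union> X) = card (slots d T) + card X"
    using finite_slots[OF t(1)] finK by (intro card_Un_disjoint) (auto simp: slots_def X_def V_def)
  ultimately have eq: "card (slots d T) + card X = 2 * card V" by simp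
  have "card X \<le> card V" using finK by (intro card_mono) (auto simp: X_def)
  then have "card V \<le> card (slots d T)" using eq by linarith
  then show "real (card T) - branchings T \<le> real (card (slots d T))"
    using cV unfolding branchings_def K_def[symmetric] by linarith
  have "V \<subseteq> X \<union> ({[]} \<union> (\<lambda>v. v @ [NextE]) ` K)"
  proof
    fix v assume v: "v \<in> V"
    then show "v \<in> X \<union> ({[]} \<union> (\<lambda>v. v @ [NextE]) ` K)"
      by (cases v rule: rev_cases) (auto simp: X_def V_def K_def)
  qed
  then have "card V \<le> card (X \<union> ({[]} \<union> (\<lambda>v. v @ [NextE]) ` K))"
    using finK by (intro card_mono) auto
  also have "\<dots> \<le> card X + (card {[] :: vertex} + card ((\<lambda>v. v @ [NextE]) ` K))"
    by (meson add_left_mono card_Un_le order_trans)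
  also have "\<dots> \<le> card X + (1 + card K)" using finK by (simp add: card_image_le)
  finally show "card (slots d T) \<le> card T + 1" using eq cV by linarith
qed

section \<open>First and second moments of the number of occurrences\<close>

lemma acoeff_ratio:
  assumes "0 < d"
  shows "(\<lambda>n. acoeff d (n - k) / acoeff d n) \<longlonglongrightarrow> 1"
proof -
  obtain c where c: "0 < c" "(\<lambda>n. acoeff d n / weight d n) \<longlonglongrightarrow> c"
    using acoeff_asymptotics[OF assms] by blast
  have "(\<lambda>n. acoeff d (n - k) / weight d (n - k)) \<longlonglongrightarrow> c"
    using c(2) by (rule filterlim_compose[OF _ filterlim_minus_const_nat_at_top])
  then have "(\<lambda>n. acoeff d (n - k) / weight d (n - k) / (acoeff d n / weight d n) * (weight d (n - k) / weight d n)) \<longlonglongrightarrow> c / c * 1"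
    using c by (intro tendsto_intros weight_ratio) auto
  moreover have "\<forall>\<^sub>F n in sequentially. acoeff d (n - k) / weight d (n - k) / (acoeff d n / weight d n) *
      (weight d (n - k) / weight d n) = acoeff d (n - k) / acoeff d n"
    using eventually_gt_at_top[of k]
  proof eventually_elim
    case (elim n)
    then show ?case using weight_pos[of n d] weight_pos[of "n - k" d] by simp
  qed
  ultimately have "(\<lambda>n. acoeff d (n - k) / acoeff d n) \<longlonglongrightarrow> c / c * 1" by (rule Lim_transform_eventually)
  then show ?thesis using c(1) by simp
qed

lemma mcoeff_ratio:
  assumes "0 < d"
  shows "(\<lambda>n. mcoeff d (n - k) / (real n * acoeff d n)) \<longlonglongrightarrow> 0"
proof -
  obtain c where c: "0 < c" "(\<lambda>n. acoeff d n / weight d n) \<longlonglongrightarrow> c"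
    using acoeff_asymptotics[OF assms] by blast
  have "(\<lambda>n. mcoeff d (n - k) / (real (n - k) * weight d (n - k))) \<longlonglongrightarrow> 0"
    using mcoeff_negligible[OF assms] by (rule filterlim_compose[OF _ filterlim_minus_const_nat_at_top])
  then have "(\<lambda>n. mcoeff d (n - k) / (real (n - k) * weight d (n - k)) * (real (n - k) / real n) *
      (weight d (n - k) / weight d n) / (acoeff d n / weight d n)) \<longlonglongrightarrow> 0 * 1 * 1 / c"
    using c by (intro tendsto_intros weight_ratio shift_ratio) auto
  moreover have "\<forall>\<^sub>F n in sequentially. mcoeff d (n - k) / (real (n - k) * weight d (n - k)) * (real (n - k) / real n) *
      (weight d (n - k) / weight d n) / (acoeff d n / weight d n) = mcoeff d (n - k) / (real n * acoeff d n)"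
    using eventually_gt_at_top[of k]
  proof eventually_elim
    case (elim n)
    then show ?case using weight_pos[of n d] weight_pos[of "n - k" d] by simp
  qed
  ultimately have "(\<lambda>n. mcoeff d (n - k) / (real n * acoeff d n)) \<longlonglongrightarrow> 0 * 1 * 1 / c"
    by (rule Lim_transform_eventually)
  then show ?thesis by simp
qed

abbreviation nocc :: "rtree \<Rightarrow> rtree \<Rightarrow> real" where
  "nocc S T \<equiv> real (card (occ S T))"

lemma sum_branchings: "(\<Sum>T\<in>level_set d n. branchings T) = 4 ^ n * mcoeff d n"
  by (simp add: mcoeff_def)

lemma sum_nocc_lower:
  assumes "S \<in> etrees 1" "0 < d"
  shows "real n * (4 ^ n * acoeff d n) - 4 ^ n * mcoeff d n \<le> (\<Sum>T\<in>level_set d (n + card S). nocc S T)"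
proof -
  have "real n * (4 ^ n * acoeff d n) - 4 ^ n * mcoeff d n = (\<Sum>T\<in>level_set d n. real n - branchings T)"
    by (simp add: sum_subtractf sum_branchings card_dtrees_acoeff)
  also have "\<dots> \<le> (\<Sum>T\<in>level_set d n. real (card (slots d T)))"
    using slots_bounds(1)[OF _ assms(2)] by (intro sum_mono) auto
  also have "\<dots> = (\<Sum>T\<in>level_set d (n + card S). nocc S T)"
    using sum_occ_eq[OF assms(1), of d n] by (simp flip: of_nat_sum)
  finally show ?thesis .
qed

lemma sum_nocc_upper:
  assumes "S \<in> etrees 1" "0 < d"
  shows "(\<Sum>T\<in>level_set d (n + card S). nocc S T) \<le> (real n + 1) * (4 ^ n * acoeff d n)"
proof -
  have "(\<Sum>T\<in>level_set d (n + card S). nocc S T) = (\<Sum>T\<in>level_set d n. real (card (slots d T)))"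
    using sum_occ_eq[OF assms(1), of d n] by (simp flip: of_nat_sum)
  also have "\<dots> \<le> (\<Sum>T\<in>level_set d n. real n + 1)"
    using slots_bounds(2)[OF _ assms(2)] by (intro sum_mono) force
  also have "\<dots> = (real n + 1) * (4 ^ n * acoeff d n)" by (simp add: card_dtrees_acoeff)
  finally show ?thesis .
qed

text \<open>A square splits into ordered pairs of distinct occurrences and single occurrences.
  Cutting one member of a pair leaves a slot, with at most \<open>n + card S + 1\<close> choices,
  together with an occurrence, to which the first-moment bound applies.\<close>

lemma sum_nocc_square_upper:
  assumes "S \<in> etrees 1" "0 < d"
  shows "(\<Sum>T\<in>level_set d (n + card S + card S). (nocc S T)\<^sup>2) \<le>
    (real (n + card S) + 1) * ((real n + 1) * (4 ^ n * acoeff d n)) +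
    (real (n + card S) + 1) * (4 ^ (n + card S) * acoeff d (n + card S))"
proof -
  let ?L = "level_set d (n + card S + card S)"
  have "(nocc S T)\<^sup>2 = real (card (occ S T) * (card (occ S T) - 1)) + nocc S T" for T
    by (cases "card (occ S T)") (auto simp: power2_eq_square algebra_simps)
  then have "(\<Sum>T\<in>?L. (nocc S T)\<^sup>2) =
      real (\<Sum>T\<in>?L. card (occ S T) * (card (occ S T) - 1)) + (\<Sum>T\<in>?L. nocc S T)"
    by (simp add: sum.distrib)
  moreover have "real (\<Sum>T\<in>?L. card (occ S T) * (card (occ S T) - 1)) \<le>
      real (\<Sum>T\<in>level_set d (n + card S). card (slots d T) * card (occ S T))"
    using sum_occ_pairs[OF assms(1), of d "n + card S"] by linarith
  moreover have "real (\<Sum>T\<in>level_set d (n + card S). card (slots d T) * card (occ S T)) \<le>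
      (\<Sum>T\<in>level_set d (n + card S). (real (n + card S) + 1) * nocc S T)"
    unfolding of_nat_sum of_nat_mult
    using slots_bounds(2)[OF _ assms(2)] by (intro sum_mono mult_right_mono) force+
  moreover have "(\<Sum>T\<in>level_set d (n + card S). (real (n + card S) + 1) * nocc S T) \<le>
      (real (n + card S) + 1) * ((real n + 1) * (4 ^ n * acoeff d n))"
    unfolding sum_distrib_left[symmetric] by (intro mult_left_mono sum_nocc_upper assms) auto
  moreover have "(\<Sum>T\<in>?L. nocc S T) \<le> (real (n + card S) + 1) * (4 ^ (n + card S) * acoeff d (n + card S))"
    by (rule sum_nocc_upper[OF assms])
  ultimately show ?thesis by linarith
qed

text \<open>In the expanded square the second moment has a positive and the first moment a negative
  coefficient, so the upper bound for the one and the lower bound for the other are what is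
  required. In \<open>U\<close> the three contributions tend to \<theta>^2, -2 \<theta>^2 and
  \<theta>^2.\<close>

lemma second_moment_tendsto:
  assumes S: "S \<in> etrees 1" and d: "0 < d"
  defines "\<theta> \<equiv> 1 / 4 ^ card S"
  shows "(\<lambda>n. (\<Sum>T\<in>level_set d n. (nocc S T / real n - \<theta>)\<^sup>2) / (4 ^ n * acoeff d n)) \<longlonglongrightarrow> 0"
proof -
  define k where "k = card S"
  define r1 where "r1 n = acoeff d (n - k) / acoeff d n" for n
  define r2 where "r2 n = acoeff d (n - 2 * k) / acoeff d n" for n
  define \<mu> where "\<mu> n = mcoeff d (n - k) / (real n * acoeff d n)" for n
  define U where "U n = ((real n + 1) / real n) ^ 2 * \<theta>\<^sup>2 * r2 n + (real n + 1) / (real n)\<^sup>2 * \<theta> * r1 n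
      - 2 * \<theta> * (real (n - k) / real n * \<theta> * r1 n - \<theta> * \<mu> n) + \<theta>\<^sup>2" for n
  have lims: "r1 \<longlonglongrightarrow> 1" "r2 \<longlonglongrightarrow> 1" "\<mu> \<longlonglongrightarrow> 0"
    unfolding r1_def r2_def \<mu>_def by (intro acoeff_ratio mcoeff_ratio d)+
  have "(\<lambda>n. (real n + 1) / real n) \<longlonglongrightarrow> 1" "(\<lambda>n. (real n + 1) / (real n)\<^sup>2) \<longlonglongrightarrow> 0" by real_asymp+
  then have "U \<longlonglongrightarrow> 1 ^ 2 * \<theta>\<^sup>2 * 1 + 0 * \<theta> * 1 - 2 * \<theta> * (1 * \<theta> * 1 - \<theta> * 0) + \<theta>\<^sup>2"
    unfolding U_def by (intro tendsto_intros lims shift_ratio)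
  then have U0: "U \<longlonglongrightarrow> 0" by (simp add: power2_eq_square)
  have pos: "\<forall>\<^sub>F n in sequentially. 0 \<le> (\<Sum>T\<in>level_set d n. (nocc S T / real n - \<theta>)\<^sup>2) / (4 ^ n * acoeff d n)"
    by (intro always_eventually allI divide_nonneg_nonneg sum_nonneg) (auto simp: acoeff_nonneg)
  have "\<forall>\<^sub>F n in sequentially. (\<Sum>T\<in>level_set d n. (nocc S T / real n - \<theta>)\<^sup>2) / (4 ^ n * acoeff d n) \<le> U n"
    using eventually_acoeff_pos[OF d] eventually_gt_at_top[of "2 * k"]
  proof eventually_elim
    case (elim n)
    define m where "m = n - 2 * k"
    have n: "n = m + k + k" "n - k = m + k" "n - 2 * k = m" and n0: "0 < real n" using elim by (auto simp: m_def)
    define f where "f = 4 ^ n * acoeff d n"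
    have f0: "0 < f" using elim by (simp add: f_def)
    define s1 where "s1 = (\<Sum>T\<in>level_set d n. nocc S T)"
    define s2 where "s2 = (\<Sum>T\<in>level_set d n. (nocc S T)\<^sup>2)"
    have th: "4 ^ n * \<theta> = 4 ^ (n - k)" "4 ^ n * \<theta>\<^sup>2 = 4 ^ (n - 2 * k)"
      using elim by (simp_all add: \<theta>_def k_def[symmetric] power_diff power_mult power2_eq_square
          power_divide mult_2 power_add)
    have e1: "4 ^ (n - k) * acoeff d (n - k) = f * \<theta> * r1 n"
      using elim(1) by (simp add: f_def r1_def th(1)[symmetric])
    have e2: "4 ^ (n - 2 * k) * acoeff d (n - 2 * k) = f * \<theta>\<^sup>2 * r2 n"
      using elim(1) by (simp add: f_def r2_def th(2)[symmetric])
    have e3: "4 ^ (n - k) * mcoeff d (n - k) = f * \<theta> * (real n * \<mu> n)"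
      using elim(1) n0 by (simp add: f_def \<mu>_def th(1)[symmetric])
    have low: "real (n - k) * (f * \<theta> * r1 n) - f * \<theta> * (real n * \<mu> n) \<le> s1"
      using sum_nocc_lower[OF S d, of "n - k"] elim(2) unfolding e1 e3 s1_def by (simp add: k_def)
    have up: "s2 \<le> (real n + 1) * ((real n + 1) * (f * \<theta>\<^sup>2 * r2 n)) + (real n + 1) * (f * \<theta> * r1 n)"
    proof -
      have "s2 \<le> (real (m + k) + 1) * ((real m + 1) * (4 ^ m * acoeff d m)) +
        (real (m + k) + 1) * (4 ^ (m + k) * acoeff d (m + k))"
        using sum_nocc_square_upper[OF S d, of m] unfolding s2_def n(1) k_def .
      also have "\<dots> \<le> (real n + 1) * ((real n + 1) * (4 ^ m * acoeff d m)) +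
        (real n + 1) * (4 ^ (m + k) * acoeff d (m + k))"
        unfolding n(1) by (intro add_mono mult_mono mult_right_mono) (auto simp: acoeff_nonneg)
      finally show ?thesis using e1 e2 unfolding n(2,3) by simp
    qed
    have "(\<Sum>T\<in>level_set d n. (nocc S T / real n - \<theta>)\<^sup>2) =
        (\<Sum>T\<in>level_set d n. (nocc S T)\<^sup>2 / (real n)\<^sup>2 - 2 * \<theta> / real n * nocc S T + \<theta>\<^sup>2)"
      using n0 by (intro sum.cong) (auto simp: power2_eq_square field_simps)
    also have "\<dots> = s2 / (real n)\<^sup>2 - 2 * \<theta> / real n * s1 + f * \<theta>\<^sup>2"
      by (simp add: sum.distrib sum_subtractf s1_def s2_def sum_divide_distrib sum_distrib_left
          card_dtrees_acoeff f_def)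
    also have "\<dots> \<le> ((real n + 1) * ((real n + 1) * (f * \<theta>\<^sup>2 * r2 n)) + (real n + 1) * (f * \<theta> * r1 n)) / (real n)\<^sup>2
        - 2 * \<theta> / real n * (real (n - k) * (f * \<theta> * r1 n) - f * \<theta> * (real n * \<mu> n)) + f * \<theta>\<^sup>2"
      by (intro add_mono diff_mono divide_right_mono mult_left_mono up low) (use f0 in \<open>auto simp: \<theta>_def\<close>)
    also have "\<dots> = f * U n"
      using n0 by (simp add: U_def power2_eq_square field_simps)
    finally show ?case using f0 unfolding f_def[symmetric] by (simp add: divide_le_eq mult.commute)
  qed
  then show ?thesis by (rule tendsto_sandwich[OF pos _ tendsto_const U0])
qed

text \<open>Chebyshev's inequality for the uniform law on \<open>level_set d n\<close>.\<close>

theorem fringe_concentration: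
  assumes S: "S \<in> etrees 1" and d: "1 \<le> d" and e: "0 < e"
  shows "(\<lambda>n. measure_pmf.prob (random_dtree d n) {T. \<bar>nocc S T / real n - 1 / 4 ^ card S\<bar> < e}) \<longlonglongrightarrow> 1"
proof -
  let ?B = "\<lambda>n. {T. e \<le> \<bar>nocc S T / real n - 1 / 4 ^ card S\<bar>}"
  let ?V = "\<lambda>n. (\<Sum>T\<in>level_set d n. (nocc S T / real n - 1 / 4 ^ card S)\<^sup>2) / (4 ^ n * acoeff d n)"
  have d0: "0 < d" using d by simp
  have "(\<lambda>n. measure_pmf.prob (random_dtree d n) (?B n)) \<longlonglongrightarrow> 0"
  proof (rule tendsto_sandwich[where f = "\<lambda>_. 0"])
    have "(\<lambda>n. ?V n / e\<^sup>2) \<longlonglongrightarrow> 0 / e\<^sup>2" using e by (intro tendsto_divide second_moment_tendsto S d0) auto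
    then show "(\<lambda>n. ?V n / e\<^sup>2) \<longlonglongrightarrow> 0" by simp
    show "\<forall>\<^sub>F n in sequentially. measure_pmf.prob (random_dtree d n) (?B n) \<le> ?V n / e\<^sup>2"
      using eventually_acoeff_pos[OF d0]
    proof eventually_elim
      case (elim n)
      have "real (card (level_set d n \<inter> ?B n)) * e\<^sup>2 = (\<Sum>T\<in>level_set d n \<inter> ?B n. e\<^sup>2)" by simp
      also have "\<dots> \<le> (\<Sum>T\<in>level_set d n \<inter> ?B n. (nocc S T / real n - 1 / 4 ^ card S)\<^sup>2)"
      proof (rule sum_mono)
        fix T assume "T \<in> level_set d n \<inter> ?B n"
        then have "e \<le> \<bar>nocc S T / real n - 1 / 4 ^ card S\<bar>" by blast
        then have "e\<^sup>2 \<le> \<bar>nocc S T / real n - 1 / 4 ^ card S\<bar>\<^sup>2" using e by (intro power_mono) auto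
        then show "e\<^sup>2 \<le> (nocc S T / real n - 1 / 4 ^ card S)\<^sup>2" by simp
      qed
      also have "\<dots> \<le> (\<Sum>T\<in>level_set d n. (nocc S T / real n - 1 / 4 ^ card S)\<^sup>2)"
        by (intro sum_mono2 finite_etrees_card) auto
      finally have "real (card (level_set d n \<inter> ?B n)) \<le> (\<Sum>T\<in>level_set d n. (nocc S T / real n - 1 / 4 ^ card S)\<^sup>2) / e\<^sup>2"
        using e by (simp add: le_divide_eq)
      then have "real (card (level_set d n \<inter> ?B n)) / (4 ^ n * acoeff d n) \<le>
          (\<Sum>T\<in>level_set d n. (nocc S T / real n - 1 / 4 ^ card S)\<^sup>2) / e\<^sup>2 / (4 ^ n * acoeff d n)"
        using elim by (intro divide_right_mono) auto
      then show ?case unfolding measure_random_dtree[OF d elim] by (simp add: mult.commute)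
    qed
  qed auto
  then have "(\<lambda>n. 1 - measure_pmf.prob (random_dtree d n) (?B n)) \<longlonglongrightarrow> 1 - 0" by (intro tendsto_intros)
  moreover have "1 - measure_pmf.prob (random_dtree d n) (?B n) =
      measure_pmf.prob (random_dtree d n) {T. \<bar>nocc S T / real n - 1 / 4 ^ card S\<bar> < e}" for n
  proof -
    have "{T. \<bar>nocc S T / real n - 1 / 4 ^ card S\<bar> < e} = UNIV - ?B n" by auto
    then show ?thesis using measure_pmf.finite_measure_Diff[of UNIV "random_dtree d n" "?B n"] by simp
  qed
  ultimately show ?thesis by simp
qed

text \<open>The series is summable by its asymptotics, so its sum s satisfies s = (1 + s)^2 / 4,
  which has the double root 1. Consequently the limiting proportions 4^-|S| form a probability
  distribution on binary trees and no mass escapes. The sequence \<open>b\<close> belongs to 1 +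
  F_1.\<close>

lemma Fgf_1_sums: "(\<lambda>n. acoeff 1 n) sums 1"
proof -
  define b where "b n = acoeff 1 n + (if n = 0 then 1 else 0)" for n
  have "tame (Suc 0) (Fgf (Suc 0))" by (rule tame_Fgf)
  then have "summable (\<lambda>n. \<bar>acoeff 1 n\<bar>)" using tame_summable by (fastforce simp: Fgf_nth)
  then have sa: "summable (acoeff 1)" by (rule summable_rabs_cancel)
  define s where "s = suminf (acoeff 1)"
  have a: "acoeff 1 sums s" using sa by (simp add: s_def summable_sums)
  have "(\<lambda>n. if n = 0 then 1 else 0 :: real) sums 1" using sums_single[of 0 "\<lambda>_. 1 :: real"] by simp
  then have b: "b sums (s + 1)" unfolding b_def by (intro sums_add a)
  have nb: "norm (b n) = b n" for n by (simp add: b_def acoeff_nonneg)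
  have sb: "summable (\<lambda>n. norm (b n))" unfolding nb using b by (rule sums_summable)
  have "(\<lambda>n. \<Sum>i\<le>n. b i * b (n - i)) sums (suminf b * suminf b)"
    by (rule Cauchy_product_sums[OF sb sb])
  then have "(\<lambda>n. 1 / 4 * (\<Sum>i\<le>n. b i * b (n - i))) sums (1 / 4 * ((s + 1) * (s + 1)))"
    using b by (intro sums_mult) (simp add: sums_iff)
  moreover have "1 / 4 * (\<Sum>i\<le>n. b i * b (n - i)) = acoeff 1 (Suc n)" for n
  proof -
    have bn: "fps_nth (1 + Fgf (Suc 0) :: real fps) n = b n" for n by (simp add: b_def Fgf_nth)
    have "acoeff 1 (Suc n) = fps_nth (Fgf (Suc 0) :: real fps) (Suc n)" by (simp add: Fgf_nth)
    also have "\<dots> = 1 / 4 * fps_nth ((1 + Fgf (Suc 0)) * (1 + Fgf (Suc 0)) :: real fps) n"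
      by (subst Fgf_Suc) (simp add: Fgf_0 mult.assoc)
    also have "\<dots> = 1 / 4 * (\<Sum>i\<le>n. b i * b (n - i))"
      unfolding fps_mult_nth bn by (simp add: atLeast0AtMost)
    finally show ?thesis by simp
  qed
  ultimately have "(\<lambda>n. acoeff 1 (Suc n)) sums (1 / 4 * ((s + 1) * (s + 1)))" by simp
  moreover have "acoeff 1 0 = 0"
  proof -
    have "level_set 1 0 = {}" using finite_etrees[of _ 1] etreesD(5)[of _ 1] by (auto simp: card_eq_0_iff)
    then show ?thesis by (simp only: acoeff_def) simp
  qed
  ultimately have "acoeff 1 sums (1 / 4 * ((s + 1) * (s + 1)))" using sums_Suc_iff[of "acoeff 1"] by simp
  then have "s = 1 / 4 * ((s + 1) * (s + 1))" using a sums_unique2 by blast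
  then have "(s - 1)\<^sup>2 = 0" by (simp add: power2_eq_square field_simps)
  then have "s = 1" by simp
  then show ?thesis using a by simp
qed


section \<open>Neighbourhoods of a uniform vertex\<close>

lemma address_append: "address (u @ a) (u @ b) = address a b"
  by (induction u) auto

text \<open>A shortest path of length at most r from \<open>u @ a\<close> ascends at most
  \<open>length a\<close> steps, hence never leaves the subtree at \<open>u\<close>.\<close>

lemma truncate_view_subtree:
  assumes T: "prefix_closed T" and ua: "u @ a \<in> T" "length a = r"
  shows "truncate r (view T (u @ a)) = truncate r (view (subtree T u) a)"
proof -
  have "address (u @ a) w \<in> address a ` subtree T u"
    if w: "w \<in> T" "length (address (u @ a) w) \<le> r" for w
  proof -
    obtain p x y where f: "u @ a = p @ x" "w = p @ y" "address (u @ a) w = map Up (rev x) @ map Down y"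
      using address_form by blast
    have "length x \<le> length a" using f(3) w(2) ua(2) by simp
    obtain c where c: "u = p @ c \<and> c @ a = x \<or> u @ c = p \<and> a = c @ x"
      using f(1) by (auto simp: append_eq_append_conv2)
    have "\<exists>p'. p = u @ p'"
    proof (cases "u = p @ c \<and> c @ a = x")
      case True
      then have "c = []" using \<open>length x \<le> length a\<close> by auto
      then show ?thesis using True by auto
    qed (use c in auto)
    then obtain p' where "p = u @ p'" by blast
    then have "w = u @ (p' @ y)" using f(2) by simp
    then show ?thesis using w(1) by (auto simp: address_append subtree_def)
  qed
  moreover have "address a b \<in> address (u @ a) ` T" if "b \<in> subtree T u" for b
    using that by (intro image_eqI[of _ _ "u @ b"]) (auto simp: address_append subtree_def)
  moreover have "a \<in> subtree T u" using ua(1) by (simp add: subtree_def)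
  ultimately show ?thesis
    unfolding truncate_def addresses_view[OF T ua(1)]
      addresses_view[OF prefix_closed_subtree[OF T] \<open>a \<in> subtree T u\<close>] by auto
qed

lemma ancestor_line_unique:
  assumes "address_set X" "map Up a \<in> X" "map Up b \<in> X" "length a = length b"
  shows "a = b"
  using assms(2-)
proof (induction a arbitrary: b rule: rev_induct)
  case (snoc e a)
  then obtain b' e' where b: "b = b' @ [e']" by (cases b rule: rev_cases) auto
  have pc: "prefix_closed X" using assms(1) by (simp add: address_set_def)
  have "map Up a @ [Up e] \<in> X" "map Up b' @ [Up e'] \<in> X" using snoc.prems b by auto
  then have "map Up a \<in> X" "map Up b' \<in> X" using prefix_closedD[OF pc] by blast+
  moreover have "length a = length b'" using snoc.prems(3) b by simp
  ultimately have "a = b'" by (rule snoc.IH)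
  then have "e = e'"
    using assms(1) \<open>map Up a @ [Up e] \<in> X\<close> \<open>map Up b' @ [Up e'] \<in> X\<close> unfolding address_set_def by blast
  then show ?case using b \<open>a = b'\<close> by simp
qed simp

definition views :: "nat \<Rightarrow> step list set \<Rightarrow> rtree \<Rightarrow> vertex set" where
  "views r h T = {v \<in> T. truncate r (view T v) = h}"

text \<open>For given \<open>S\<close> the vertex \<open>a\<close> is unique: it has depth
  \<open>r\<close>, so \<open>h\<close> contains its whole path up to the root of \<open>S\<close>.
  Occurrences of members of this family therefore correspond to single vertices with neighbourhood
  \<open>h\<close>.\<close>

definition fringes :: "nat \<Rightarrow> step list set \<Rightarrow> rtree set" where
  "fringes r h = {S \<in> etrees 1. \<exists>a\<in>S. length a = r \<and> truncate r (view S a) = h}"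

text \<open>An occurrence of \<open>S\<close> at \<open>u\<close> contributes the vertex
  \<open>u @ a S\<close>. As every \<open>a S\<close> has length \<open>r\<close>, the word
  determines \<open>u\<close>, and then \<open>S\<close> as the subtree at \<open>u\<close>.\<close>

lemma views_lower:
  assumes T: "T \<in> etrees d" and B: "finite B" "B \<subseteq> fringes r h"
  shows "(\<Sum>S\<in>B. card (occ S T)) \<le> card (views r h T)"
proof -
  note t = etreesD[OF T]
  obtain a where a: "\<And>S. S \<in> B \<Longrightarrow> a S \<in> S \<and> length (a S) = r \<and> truncate r (view S (a S)) = h"
  proof -
    have "\<forall>S\<in>B. \<exists>a. a \<in> S \<and> length a = r \<and> truncate r (view S a) = h"
      using B(2) unfolding fringes_def by blast
    from bchoice[OF this] show ?thesis using that by blast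
  qed
  let ?f = "\<lambda>(S, u). u @ a S"
  have "(\<Sum>S\<in>B. card (occ S T)) = card (SIGMA S:B. occ S T)"
    using B(1) finite_occ[OF t(1)] by (intro card_SigmaI[symmetric]) auto
  also have "\<dots> \<le> card (views r h T)"
  proof (rule card_inj_on_le)
    show "inj_on ?f (SIGMA S:B. occ S T)"
    proof (rule inj_onI)
      fix x y assume xy: "x \<in> (SIGMA S:B. occ S T)" "y \<in> (SIGMA S:B. occ S T)" "?f x = ?f y"
      obtain S u where x: "x = (S, u)" "S \<in> B" "u \<in> occ S T" using xy(1) by auto
      obtain S' u' where y: "y = (S', u')" "S' \<in> B" "u' \<in> occ S' T" using xy(2) by auto
      have "u @ a S = u' @ a S'" using xy(3) x(1) y(1) by simp
      then have "u = u'" using a[OF x(2)] a[OF y(2)] by simp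
      moreover have "S = subtree T u" "S' = subtree T u'" using x(3) y(3) by (auto simp: occ_def)
      ultimately show "x = y" using x(1) y(1) by simp
    qed
    show "?f ` (SIGMA S:B. occ S T) \<subseteq> views r h T"
    proof
      fix z assume "z \<in> ?f ` (SIGMA S:B. occ S T)"
      then obtain S u where z: "z = u @ a S" "S \<in> B" "u \<in> occ S T" by auto
      have S: "subtree T u = S" using z(3) by (auto simp: occ_def)
      then have "u @ a S \<in> T" using a[OF z(2)] by (auto simp: subtree_def)
      then show "z \<in> views r h T"
        using truncate_view_subtree[OF t(2) \<open>u @ a S \<in> T\<close>] a[OF z(2)] S z(1) by (simp add: views_def)
    qed
    show "finite (views r h T)" using t(1) by (simp add: views_def)
  qed
  finally show ?thesis .
qed

text \<open>
  A vertex is determined by its ancestor at distance \<open>r\<close> and its neighbourhood. The summand on the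
  right accounts for the vertices with fewer than \<open>r\<close> ancestors.
\<close>

lemma views_upper:
  assumes T: "T \<in> etrees d" and B: "finite B" "B \<subseteq> etrees 1 - fringes r h"
  shows "card (views r h T) + (\<Sum>S\<in>B. card (occ S T)) \<le> card T + card {v :: vertex. length v \<le> r}"
proof -
  note t = etreesD[OF T]
  let ?W = "{v \<in> views r h T. r \<le> length v}"
  let ?anc = "\<lambda>v :: vertex. take (length v - r) v"
  have split: "?anc v @ drop (length v - r) v = v" for v by simp
  have lst: "length (drop (length v - r) v) = r" if "v \<in> ?W" for v using that by auto
  have up: "map Up (rev (drop (length v - r) v)) \<in> h \<and> ?anc v \<in> T" if v: "v \<in> ?W" for v
  proof -
    let ?u = "?anc v" and ?a = "drop (length v - r) v"
    have vT: "v \<in> T" using v by (auto simp: views_def)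
    then have uT: "?u \<in> T" using prefix_closedD[OF t(2), of ?u ?a] by simp
    have "address (?u @ ?a) (?u @ []) = address ?a []" by (rule address_append)
    moreover have "address ?a [] = map Up (rev ?a)" by (cases ?a) auto
    ultimately have "address v ?u = map Up (rev ?a)" by simp
    then have "map Up (rev ?a) \<in> truncate r (view T v)"
      using uT lst[OF v] unfolding truncate_def addresses_view[OF t(2) vT] by force
    then show ?thesis using v uT by (auto simp: views_def)
  qed
  have inj: "inj_on ?anc ?W"
  proof (rule inj_onI)
    fix v w assume v: "v \<in> ?W" and w: "w \<in> ?W" and eq: "?anc v = ?anc w"
    have sub: "h \<subseteq> addresses (view T v)" using v by (auto simp: views_def truncate_def)
    have "rev (drop (length v - r) v) = rev (drop (length w - r) w)"
      by (rule ancestor_line_unique[OF address_set_addresses[of "view T v"]])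
        (use up[OF v] up[OF w] sub lst[OF v] lst[OF w] in auto)
    then show "v = w" using eq split[of v] split[of w] by (metis rev_rev_ident)
  qed
  have disj: "?anc ` ?W \<inter> (\<Union>S\<in>B. occ S T) = {}"
  proof (rule ccontr)
    assume "?anc ` ?W \<inter> (\<Union>S\<in>B. occ S T) \<noteq> {}"
    then obtain v S where v: "v \<in> ?W" and S: "S \<in> B" "?anc v \<in> occ S T" by blast
    let ?a = "drop (length v - r) v"
    have sub: "subtree T (?anc v) = S" using S(2) by (simp add: occ_def)
    have vT: "?anc v @ ?a \<in> T" using v by (auto simp: views_def)
    then have "?a \<in> S" using sub unfolding subtree_def by blast
    moreover have "truncate r (view S ?a) = h"
      using truncate_view_subtree[OF t(2) vT lst[OF v]] v sub by (simp add: views_def)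
    moreover have "S \<in> etrees 1" using B(2) S(1) by blast
    ultimately have "S \<in> fringes r h" using lst[OF v] unfolding fringes_def by blast
    then show False using B(2) S(1) by blast
  qed
  have "card (views r h T) \<le> card (?W \<union> {v. length v \<le> r})"
    using t(1) finite_length_le[of r] by (intro card_mono) (auto simp: views_def)
  also have "\<dots> \<le> card ?W + card {v :: vertex. length v \<le> r}" by (rule card_Un_le)
  also have "card ?W = card (?anc ` ?W)" using inj by (simp add: card_image)
  finally have 1: "card (views r h T) \<le> card (?anc ` ?W) + card {v :: vertex. length v \<le> r}" .
  have finW: "finite (?anc ` ?W)" using t(1) by (auto simp: views_def)
  have occT: "(\<Union>S\<in>B. occ S T) \<subseteq> T" by (auto simp: occ_def)
  have "(\<Sum>S\<in>B. card (occ S T)) = card (\<Union>S\<in>B. occ S T)"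
    using B(1) finite_occ[OF t(1)] by (intro card_UN_disjoint[symmetric]) (auto simp: occ_def)
  then have "card (?anc ` ?W) + (\<Sum>S\<in>B. card (occ S T)) = card (?anc ` ?W \<union> (\<Union>S\<in>B. occ S T))"
    using finW finite_subset[OF occT t(1)] disj by (simp add: card_Un_disjoint)
  also have "\<dots> \<le> card T" using up occT t(1) by (intro card_mono) auto
  finally show ?thesis using 1 by linarith
qed

section \<open>Concentration of the neighbourhood statistics\<close>

definition fringe_coeff :: "rtree set \<Rightarrow> nat \<Rightarrow> real" where
  "fringe_coeff A n = real (card {S \<in> A. card S = n}) / 4 ^ n"

definition fringe_mass :: "rtree set \<Rightarrow> real" where
  "fringe_mass A = (\<Sum>n. fringe_coeff A n)"

lemma fringe_coeff_sums:
  assumes "A \<subseteq> etrees 1"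
  shows "fringe_coeff A sums fringe_mass A" "fringe_coeff (etrees 1 - A) sums (1 - fringe_mass A)"
proof -
  have fin: "finite {S \<in> A. card S = n}" for n
    by (rule finite_subset[OF _ finite_etrees_card[of 1 n]]) (use assms in auto)
  have add: "fringe_coeff A n + fringe_coeff (etrees 1 - A) n = acoeff 1 n" for n
  proof -
    have "card (level_set 1 n) = card ({S \<in> A. card S = n} \<union> {S \<in> etrees 1 - A. card S = n})"
      using assms by (intro arg_cong[where f = card]) auto
    also have "\<dots> = card {S \<in> A. card S = n} + card {S \<in> etrees 1 - A. card S = n}"
      using fin by (intro card_Un_disjoint) (auto intro: finite_subset[OF _ finite_etrees_card[of 1 n]])
    finally show ?thesis by (simp add: fringe_coeff_def acoeff_def add_divide_distrib)
  qed
  have nn: "0 \<le> fringe_coeff A n" for A n by (simp add: fringe_coeff_def)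
  have "norm (fringe_coeff A n) \<le> acoeff 1 n" for n
    using add[of n] nn[of A n] nn[of "etrees 1 - A" n] by simp
  then have "summable (fringe_coeff A)"
    by (rule summable_comparison_test'[OF sums_summable[OF Fgf_1_sums]])
  then show s: "fringe_coeff A sums fringe_mass A" unfolding fringe_mass_def by (rule summable_sums)
  have "(\<lambda>n. acoeff 1 n - fringe_coeff A n) = fringe_coeff (etrees 1 - A)"
  proof
    show "acoeff 1 n - fringe_coeff A n = fringe_coeff (etrees 1 - A) n" for n using add[of n] by linarith
  qed
  then show "fringe_coeff (etrees 1 - A) sums (1 - fringe_mass A)"
    using sums_diff[OF Fgf_1_sums s] by simp
qed

lemma finite_fringe_approximation:
  assumes "A \<subseteq> etrees 1" "fringe_coeff A sums q" "0 < e"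
  shows "\<exists>B. finite B \<and> B \<subseteq> A \<and> q - e < (\<Sum>S\<in>B. 1 / 4 ^ card S)"
proof -
  have "(\<lambda>m. \<Sum>n<m. fringe_coeff A n) \<longlonglongrightarrow> q" using assms(2) by (simp add: sums_def)
  then have "\<forall>\<^sub>F m in sequentially. q - e < (\<Sum>n<m. fringe_coeff A n)"
    using assms(3) by (intro order_tendstoD) auto
  then obtain m where m: "q - e < (\<Sum>n<m. fringe_coeff A n)" by (auto simp: eventually_sequentially)
  let ?B = "\<Union>n\<in>{..<m}. {S \<in> A. card S = n}"
  have fin: "finite {S \<in> A. card S = n}" for n
    by (rule finite_subset[OF _ finite_etrees_card[of 1 n]]) (use assms in auto)
  have "(\<Sum>S\<in>?B. 1 / 4 ^ card S :: real) = (\<Sum>n<m. \<Sum>S\<in>{S \<in> A. card S = n}. 1 / 4 ^ card S)"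
    using fin by (intro sum.UNION_disjoint) auto
  also have "\<dots> = (\<Sum>n<m. fringe_coeff A n)" by (intro sum.cong refl) (simp add: fringe_coeff_def)
  finally show ?thesis using m fin by (intro exI[of _ ?B]) auto
qed

definition view_prob :: "nat \<Rightarrow> step list set \<Rightarrow> rtree \<Rightarrow> real" where
  "view_prob r h T = measure (quenched_law T) (cyl r h)"

lemma view_prob_eq:
  assumes "finite T" "T \<noteq> {}"
  shows "view_prob r h T = real (card (views r h T)) / real (card T)"
proof -
  have "view_prob r h T = measure_pmf.prob (pmf_of_set T) (view T -` cyl r h)"
    unfolding view_prob_def quenched_law_def by (subst measure_distr) (auto simp: cyl_borel)
  also have "\<dots> = real (card (T \<inter> view T -` cyl r h)) / real (card T)"
    using assms by (intro measure_pmf_of_set)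
  also have "T \<inter> view T -` cyl r h = views r h T" by (auto simp: views_def cyl_def)
  finally show ?thesis .
qed

theorem view_prob_concentration:
  assumes d: "1 \<le> d" and e: "0 < e"
  shows "(\<lambda>n. measure_pmf.prob (random_dtree d n) {T. \<bar>view_prob r h T - fringe_mass (fringes r h)\<bar> < e}) \<longlonglongrightarrow> 1"
proof -
  let ?A = "fringes r h"
  define q where "q = fringe_mass ?A"
  have A: "?A \<subseteq> etrees 1" by (auto simp: fringes_def)
  obtain B where B: "finite B" "B \<subseteq> ?A" "q - e / 4 < (\<Sum>S\<in>B. 1 / 4 ^ card S)"
    using finite_fringe_approximation[OF A, of q "e / 4"] fringe_coeff_sums(1)[OF A] e q_def by auto
  obtain B' where B': "finite B'" "B' \<subseteq> etrees 1 - ?A" "1 - q - e / 4 < (\<Sum>S\<in>B'. 1 / 4 ^ card S)"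
    using finite_fringe_approximation[OF Diff_subset fringe_coeff_sums(2)[OF A], of "e / 4"] e q_def by auto
  \<comment> \<open>The errors of all members of \<open>B\<close>, and likewise of
    \<open>B'\<close>, must add up to at most e / 4. The final 1 covers the case where both are
    empty.\<close>
  define \<delta> where "\<delta> = e / (4 * (real (card B) + real (card B') + 1))"
  have \<delta>: "0 < \<delta>" using e by (simp add: \<delta>_def add_nonneg_pos)
  have small: "real (card B) * \<delta> \<le> e / 4" "real (card B') * \<delta> \<le> e / 4"
    using e by (auto simp: \<delta>_def field_simps)
  define L where "L = real (card {v :: vertex. length v \<le> r})"
  let ?Q = "\<lambda>n T. \<forall>S\<in>B \<union> B'. \<bar>nocc S T / real n - 1 / 4 ^ card S\<bar> < \<delta>"
  have "(\<lambda>n. measure_pmf.prob (random_dtree d n) {T. ?Q n T}) \<longlonglongrightarrow> 1"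
    using B(1,2) B'(1,2) A by (intro prob_eventually_all fringe_concentration d \<delta>) auto
  then show ?thesis
  proof (rule tendsto_sandwich[rotated 2])
    have "(\<lambda>n. L / real n) \<longlonglongrightarrow> 0" by real_asymp
    then have Ln: "\<forall>\<^sub>F n in sequentially. L / real n < e / 4" using e by (intro order_tendstoD) auto
    have "\<forall>\<^sub>F n in sequentially. 0 < acoeff d n" using d by (intro eventually_acoeff_pos) simp
    then show "\<forall>\<^sub>F n in sequentially. measure_pmf.prob (random_dtree d n) {T. ?Q n T} \<le>
        measure_pmf.prob (random_dtree d n) {T. \<bar>view_prob r h T - fringe_mass ?A\<bar> < e}"
      using Ln eventually_gt_at_top[of 0]
    proof eventually_elim
      case (elim n)
      have "\<bar>view_prob r h T - q\<bar> < e" if T: "T \<in> etrees d" "card T = n" and Q: "?Q n T" for T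
      proof -
        have ne: "finite T" "T \<noteq> {}" using T elim(3) by (auto dest: finite_etrees)
        have v: "view_prob r h T = real (card (views r h T)) / real n"
          using view_prob_eq[OF ne] T(2) by simp
        have sum_low: "(\<Sum>S\<in>C. 1 / 4 ^ card S) - real (card C) * \<delta> \<le> (\<Sum>S\<in>C. nocc S T / real n)"
          if "C \<subseteq> B \<union> B'" for C
        proof -
          have "(\<Sum>S\<in>C. 1 / 4 ^ card S - \<delta>) \<le> (\<Sum>S\<in>C. nocc S T / real n)"
          proof (rule sum_mono)
            fix S assume "S \<in> C"
            then have "\<bar>nocc S T / real n - 1 / 4 ^ card S\<bar> < \<delta>" using Q that by blast
            then show "1 / 4 ^ card S - \<delta> \<le> nocc S T / real n" by linarith
          qed
          then show ?thesis by (simp add: sum_subtractf)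
        qed
        have "real (\<Sum>S\<in>B. card (occ S T)) \<le> real (card (views r h T))"
          using views_lower[OF T(1) B(1,2)] by linarith
        then have "(\<Sum>S\<in>B. nocc S T / real n) \<le> view_prob r h T"
          unfolding v by (simp add: divide_right_mono flip: sum_divide_distrib)
        then have low: "q - e < view_prob r h T" using sum_low[OF Un_upper1] B(3) small(1) e by linarith
        have "real (card (views r h T)) + real (\<Sum>S\<in>B'. card (occ S T)) \<le> real n + L"
          using views_upper[OF T(1) B'(1,2)] T(2) unfolding L_def by linarith
        then have "(real (card (views r h T)) + real (\<Sum>S\<in>B'. card (occ S T))) / real n \<le> (real n + L) / real n"
          by (rule divide_right_mono) simp
        then have "view_prob r h T + (\<Sum>S\<in>B'. nocc S T / real n) \<le> 1 + L / real n"
          unfolding v using elim(3) by (simp add: add_divide_distrib sum_divide_distrib)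
        then have "view_prob r h T < q + e" using sum_low[OF Un_upper2] B'(3) small(2) e elim(2) by linarith
        then show ?thesis using low by linarith
      qed
      then have "level_set d n \<inter> {T. ?Q n T} \<subseteq> {T. \<bar>view_prob r h T - fringe_mass ?A\<bar> < e}"
        by (auto simp: q_def)
      then show ?case
        unfolding measure_random_dtree[OF d elim(1)] using finite_etrees_card[of d n] elim(1)
        by (intro divide_right_mono of_nat_mono card_mono) auto
    qed
  qed auto
qed

section \<open>Annealed convergence and the common limit law\<close>

lemma view_prob_range: "0 \<le> view_prob r h T" "view_prob r h T \<le> 1"
proof -
  interpret prob_space "quenched_law T"
    unfolding quenched_law_def by (intro measure_pmf.prob_space_distr) simp
  show "0 \<le> view_prob r h T" "view_prob r h T \<le> 1" by (simp_all add: view_prob_def)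
qed

text \<open>Bounded convergence. It derives the annealed statement from the quenched one, since the
  annealed cylinder mass is the expectation of the quenched mass.\<close>

lemma expectation_tendsto_of_prob:
  fixes X :: "'a \<Rightarrow> real" and P :: "nat \<Rightarrow> 'a pmf"
  assumes X: "\<And>x. 0 \<le> X x" "\<And>x. X x \<le> 1"
    and lim: "\<And>e. 0 < e \<Longrightarrow> (\<lambda>n. measure_pmf.prob (P n) {x. \<bar>X x - q\<bar> < e}) \<longlonglongrightarrow> 1"
  shows "(\<lambda>n. measure_pmf.expectation (P n) X) \<longlonglongrightarrow> q"
proof (rule LIMSEQ_I)
  fix e :: real assume e: "0 < e"
  \<comment> \<open>A bound for the deviation on the exceptional event, because \<open>X\<close>
    takes values in the unit interval.\<close>
  define C where "C = 1 + \<bar>q\<bar>"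
  have C: "0 < C" by (simp add: C_def add_pos_nonneg)
  have "(\<lambda>n. e / 2 + C * (1 - measure_pmf.prob (P n) {x. \<bar>X x - q\<bar> < e / 2})) \<longlonglongrightarrow> e / 2 + C * (1 - 1)"
    using e by (intro tendsto_intros lim) auto
  then have "\<forall>\<^sub>F n in sequentially. e / 2 + C * (1 - measure_pmf.prob (P n) {x. \<bar>X x - q\<bar> < e / 2}) < e"
    by (rule order_tendstoD(2)) (use e in simp)
  then have "\<forall>\<^sub>F n in sequentially. norm (measure_pmf.expectation (P n) X - q) < e"
  proof eventually_elim
    case (elim n)
    let ?G = "{x. \<bar>X x - q\<bar> < e / 2}"
    have int: "integrable (measure_pmf (P n)) f" if "\<And>x. \<bar>f x\<bar> \<le> B" for f :: "'a \<Rightarrow> real" and B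
      using that by (intro measure_pmf.integrable_const_bound[of _ B]) auto
    have intX: "integrable (measure_pmf (P n)) X" 
    proof (rule int)
      show "\<bar>X x\<bar> \<le> 1" for x using X[of x] by linarith
    qed
    have "measure_pmf.expectation (P n) X - q = measure_pmf.expectation (P n) (\<lambda>x. X x - q)"
      using intX by simp
    also have "\<bar>\<dots>\<bar> \<le> measure_pmf.expectation (P n) (\<lambda>x. \<bar>X x - q\<bar>)" by (rule integral_abs_bound)
    also have "\<dots> \<le> measure_pmf.expectation (P n) (\<lambda>x. e / 2 + C * indicator (UNIV - ?G) x)"
    proof (rule integral_mono)
      show "integrable (measure_pmf (P n)) (\<lambda>x. \<bar>X x - q\<bar>)" using intX by simp
      show "integrable (measure_pmf (P n)) (\<lambda>x. e / 2 + C * indicator (UNIV - ?G) x)"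
        using e C by (intro int[of _ "e / 2 + C"]) (auto simp: indicator_def)
      show "\<bar>X x - q\<bar> \<le> e / 2 + C * indicator (UNIV - ?G) x" for x
      proof (cases "x \<in> ?G")
        case False
        have "\<bar>X x - q\<bar> \<le> C" using X[of x] unfolding C_def by linarith
        then show ?thesis using False e by (simp add: indicator_def)
      qed (simp add: indicator_def)
    qed
    also have "\<dots> = e / 2 + C * measure_pmf.prob (P n) (UNIV - ?G)"
    proof -
      have "measure_pmf.expectation (P n) (\<lambda>x. e / 2 + C * indicator A x) = e / 2 + C * measure_pmf.prob (P n) A" for A
      proof -
        have "integrable (measure_pmf (P n)) (\<lambda>x. C * indicator A x)"
          by (intro integrable_mult_right measure_pmf.integrable_const_bound[of _ 1]) (auto simp: indicator_def)
        then show ?thesis by simp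
      qed
      then show ?thesis .
    qed
    also have "measure_pmf.prob (P n) (UNIV - ?G) = 1 - measure_pmf.prob (P n) ?G"
      using measure_pmf.finite_measure_Diff[of UNIV "P n" ?G] by simp
    finally show ?case using elim by simp
  qed
  then show "\<exists>N. \<forall>n\<ge>N. norm (measure_pmf.expectation (P n) X - q) < e" by (simp add: eventually_sequentially)
qed

lemma measure_bind_pmf:
  "measure_pmf.prob (bind_pmf M N) A = measure_pmf.expectation M (\<lambda>x. measure_pmf.prob (N x) A)"
proof -
  have "ennreal (measure_pmf.prob (bind_pmf M N) A) = (\<integral>\<^sup>+x. ennreal (measure_pmf.prob (N x) A) \<partial>measure_pmf M)"
    using emeasure_bind_pmf[of M N A] unfolding measure_pmf.emeasure_eq_measure .
  also have "\<dots> = ennreal (measure_pmf.expectation M (\<lambda>x. measure_pmf.prob (N x) A))"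
    by (intro nn_integral_eq_integral measure_pmf.integrable_const_bound[of _ 1]) auto
  finally show ?thesis by (simp add: integral_nonneg_AE)
qed

lemma measure_law_at_uniform_vertex:
  "measure (law_at_uniform_vertex d n) (cyl r h) = measure_pmf.expectation (random_dtree d n) (view_prob r h)"
proof -
  let ?V = "(\<lambda>(T, v). view T v) -` cyl r h"
  have "measure (law_at_uniform_vertex d n) (cyl r h) =
      measure_pmf.prob (bind_pmf (random_dtree d n) (\<lambda>T. bind_pmf (pmf_of_set T) (\<lambda>v. return_pmf (T, v)))) ?V"
    unfolding law_at_uniform_vertex_def by (subst measure_distr) (auto simp: cyl_borel)
  also have "\<dots> = measure_pmf.expectation (random_dtree d n)
      (\<lambda>T. measure_pmf.prob (bind_pmf (pmf_of_set T) (\<lambda>v. return_pmf (T, v))) ?V)"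
    by (rule measure_bind_pmf)
  also have "(\<lambda>T. measure_pmf.prob (bind_pmf (pmf_of_set T) (\<lambda>v. return_pmf (T, v))) ?V) = view_prob r h"
  proof
    fix T
    have "measure_pmf.prob (bind_pmf (pmf_of_set T) (\<lambda>v. return_pmf (T, v))) ?V =
        measure_pmf.prob (map_pmf (Pair T) (pmf_of_set T)) ?V"
      by (simp add: map_pmf_def)
    also have "\<dots> = measure_pmf.prob (pmf_of_set T) (view T -` cyl r h)"
      by (simp add: vimage_def)
    also have "\<dots> = view_prob r h T"
      unfolding view_prob_def quenched_law_def by (subst measure_distr) (auto simp: cyl_borel)
    finally show "measure_pmf.prob (bind_pmf (pmf_of_set T) (\<lambda>v. return_pmf (T, v))) ?V = view_prob r h T" .
  qed
  finally show ?thesis .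
qed

text \<open>Stated for arbitrary \<open>p\<close>, so that it also covers sizes for which no tree
  exists and \<open>random_dtree\<close> is some unspecified law.\<close>

lemma distr_pmf_borel_probs: "distr (measure_pmf p) borel f \<in> borel_probs"
  unfolding borel_probs_def by (auto intro: measure_pmf.prob_space_distr)

lemma law_at_uniform_vertex_tendsto:
  assumes "1 \<le> d"
  shows "(\<lambda>n. measure (law_at_uniform_vertex d n) (cyl r h)) \<longlonglongrightarrow> fringe_mass (fringes r h)"
  unfolding measure_law_at_uniform_vertex
  by (intro expectation_tendsto_of_prob view_prob_range view_prob_concentration assms)

theorem local_limit_at_uniform_vertex:
  "\<exists>Fbar :: marked_tree measure. Fbar \<in> borel_probs \<and>
     (\<forall>d\<ge>1. limitin weak_topology (\<lambda>n. law_at_uniform_vertex d n) Fbar sequentially) \<and>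
     (\<forall>d\<ge>1. converges_in_prob weak_topology (random_dtree d) (\<lambda>n. quenched_law) Fbar)"
proof -
  have bp: "law_at_uniform_vertex d n \<in> borel_probs" for d n
    unfolding law_at_uniform_vertex_def by (rule distr_pmf_borel_probs)
  \<comment> \<open>The limit law is built from dimension 1 alone. Its cylinder masses are
    \<open>fringe_mass (fringes r h)\<close>, in which the dimension does not occur, so it serves
    every \<open>d\<close>.\<close>
  have conv: "convergent (\<lambda>n. measure (law_at_uniform_vertex 1 n) (cyl r h))" for r h
    by (rule convergentI[OF law_at_uniform_vertex_tendsto]) simp
  obtain F where F: "F \<in> borel_probs"
    "\<And>r h. (\<lambda>n. measure (law_at_uniform_vertex 1 n) (cyl r h)) \<longlonglongrightarrow> measure F (cyl r h)"
    using cylinder_limit_measure[OF bp conv] by blast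
  have Fm: "measure F (cyl r h) = fringe_mass (fringes r h)" for r h
    by (rule LIMSEQ_unique[OF F(2) law_at_uniform_vertex_tendsto]) simp
  show ?thesis
  proof (intro exI[of _ F] conjI allI impI F(1))
    fix d :: nat assume d: "1 \<le> d"
    show "limitin weak_topology (\<lambda>n. law_at_uniform_vertex d n) F sequentially"
      by (rule limitin_weak_topology_cyl[OF F(1) bp], unfold Fm, rule law_at_uniform_vertex_tendsto[OF d])
    show "converges_in_prob weak_topology (random_dtree d) (\<lambda>n. quenched_law) F"
    proof (rule converges_in_prob_cyl[OF F(1)])
      show "quenched_law T \<in> borel_probs" for T
        unfolding quenched_law_def by (rule distr_pmf_borel_probs)
      show "(\<lambda>n. measure_pmf.prob (random_dtree d n) {T. \<bar>measure (quenched_law T) (cyl r h) - measure F (cyl r h)\<bar> < e}) \<longlonglongrightarrow> 1"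
        if "0 < e" for r h e
        using view_prob_concentration[OF d that, of r h] by (simp add: Fm view_prob_def)
    qed
  qed
qed

section \<open>The limit around the root\<close>

lemma address_Nil: "address [] w = map Down w"
  by (cases w) auto

lemma truncate_view_root:
  assumes "T \<in> etrees d" "0 < d"
  shows "truncate r (view T []) = map Down ` trunc r T"
proof -
  have "prefix_closed T" "[] \<in> T" using assms by (auto simp: etrees_def)
  then show ?thesis by (auto simp: truncate_def addresses_view address_Nil trunc_def)
qed

lemma measure_law_at_root:
  assumes "1 \<le> d" "0 < acoeff d n"
  shows "measure (law_at_root d n) (cyl r h) = measure_pmf.prob (random_dtree d n) {T. map Down ` trunc r T = h}"
proof -
  have "measure (law_at_root d n) (cyl r h) = measure_pmf.prob (random_dtree d n) ((\<lambda>T. view T []) -` cyl r h)"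
    unfolding law_at_root_def by (subst measure_distr) (auto simp: cyl_borel)
  also have "\<dots> = measure_pmf.prob (random_dtree d n) {T. map Down ` trunc r T = h}"
    unfolding measure_random_dtree[OF assms]
    using assms(1) by (intro arg_cong[where f = "\<lambda>x. real (card x) / _"]) (auto simp: cyl_def truncate_view_root)
  finally show ?thesis .
qed

lemma law_at_root_convergent:
  assumes "1 \<le> d"
  shows "convergent (\<lambda>n. measure (law_at_root d n) (cyl r h))"
proof -
  have inj: "inj (\<lambda>H. map Down ` H)"
  proof (rule injI)
    fix H H' :: rtree assume "map Down ` H = map Down ` H'"
    moreover have "inj (map Down)" by (simp add: inj_mapI inj_def)
    ultimately show "H = H'" by (simp add: inj_image_eq_iff)
  qed
  have "convergent (\<lambda>n. measure_pmf.prob (random_dtree d n) {T. map Down ` trunc r T = h})"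
  proof (cases "h \<in> range (\<lambda>H. map Down ` H)")
    case True
    then obtain H where "h = map Down ` H" by blast
    then have "{T. map Down ` trunc r T = h} = {T. trunc r T = H}" using inj by (auto dest: injD)
    then show ?thesis using prob_trunc_convergent[OF assms] by simp
  next
    case False
    then have "{T. map Down ` trunc r T = h} = {}" by blast
    then show ?thesis by (simp add: convergent_const)
  qed
  moreover have "\<forall>\<^sub>F n in sequentially. measure (law_at_root d n) (cyl r h) =
      measure_pmf.prob (random_dtree d n) {T. map Down ` trunc r T = h}"
    using eventually_acoeff_pos[of d] assms measure_law_at_root by (auto elim: eventually_mono)
  ultimately show ?thesis by (subst convergent_cong)
qed

theorem local_limit_at_root:
  assumes d: "1 \<le> d"
  shows "\<exists>Fhat :: marked_tree measure. Fhat \<in> borel_probs \<and>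
     (AE t in Fhat. infinite (addresses t) \<and> marked_at_root t) \<and>
     limitin weak_topology (\<lambda>n. law_at_root d n) Fhat sequentially"
proof -
  have bp: "law_at_root d n \<in> borel_probs" for n
    unfolding law_at_root_def by (rule distr_pmf_borel_probs)
  obtain F where F: "F \<in> borel_probs"
    and lim: "\<And>r h. (\<lambda>n. measure (law_at_root d n) (cyl r h)) \<longlonglongrightarrow> measure F (cyl r h)"
    using cylinder_limit_measure[OF bp law_at_root_convergent[OF d]] by blast
  interpret prob_space F using F by (simp add: borel_probs_def)
  have sF: "sets F = sets borel" and spF: "space F = UNIV"
    using F sets_eq_imp_space_eq[of F borel] by (auto simp: borel_probs_def)
  \<comment> \<open>Patterns that a large tree marked at its root cannot show: no vertex at distance
    r, or a parent of the marked vertex. A parent is visible only from radius 1 on, which is why the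
    radii \<open>Suc r\<close> are used below.\<close>
  define bad where "bad r = {h. (\<forall>s\<in>h. length s < r) \<or> (\<exists>e. [Up e] \<in> h)}" for r
  have null: "measure F (cyl r h) = 0" if h: "h \<in> bad r" "1 \<le> r" for r h
  proof (rule LIMSEQ_unique[OF lim])
    have "\<forall>\<^sub>F n in sequentially. 0 < acoeff d n" using d by (intro eventually_acoeff_pos) simp
    then have "\<forall>\<^sub>F n in sequentially. measure (law_at_root d n) (cyl r h) = 0"
      using eventually_gt_at_top[of "card {v :: vertex. length v \<le> r}"]
    proof eventually_elim
      case (elim n)
      have "map Down ` trunc r T \<noteq> h" if T: "T \<in> level_set d n" for T
      proof
        assume eq: "map Down ` trunc r T = h"
        then have "[Up e] \<notin> h" for e by auto
        then have short: "length s < r" if "s \<in> h" for s using h that by (auto simp: bad_def)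
        \<comment> \<open>The size of \<open>T\<close> exceeds the number of words of length at most
          \<open>r\<close>, so a deeper vertex exists. Its prefix of length \<open>r\<close> then
          contradicts \<open>short\<close>.\<close>
        have "\<not> T \<subseteq> {v. length v \<le> r}"
          using card_mono[OF finite_length_le, of T r] elim(2) T by auto
        then obtain v where v: "v \<in> T" "r < length v" by (auto simp: subset_iff not_le)
        then have "take r v \<in> T"
          using prefix_closedD[OF etreesD(2), of T d "take r v" "drop r v"] T by auto
        then have "map Down (take r v) \<in> h" using eq by (auto simp: trunc_def)
        then show False using short[of "map Down (take r v)"] v(2) by simp
      qed
      then have "level_set d n \<inter> {T. map Down ` trunc r T = h} = {}" by blast
      then show ?case
        unfolding measure_law_at_root[OF d elim(1)] measure_random_dtree[OF d elim(1)] by simp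
    qed
    then show "(\<lambda>n. measure (law_at_root d n) (cyl r h)) \<longlonglongrightarrow> 0" by (rule tendsto_eventually)
  qed
  have "AE t in F. truncate (Suc r) t \<notin> bad (Suc r)" for r
  proof -
    have "measure F {t. truncate (Suc r) t \<in> bad (Suc r)} = 0"
      unfolding measure_cylinder[OF F] using null by (intro sum.neutral) auto
    then have "{t. truncate (Suc r) t \<in> bad (Suc r)} \<in> null_sets F"
      using cyl_borel(1) sF by (auto simp: null_sets_def emeasure_eq_measure)
    then show ?thesis by (rule AE_I') (simp add: spF)
  qed
  then have "AE t in F. \<forall>r. truncate (Suc r) t \<notin> bad (Suc r)" by (simp add: AE_all_countable)
  then have "AE t in F. infinite (addresses t) \<and> marked_at_root t"
  proof (rule AE_mp, intro AE_I2 impI conjI)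
    fix t assume t: "\<forall>r. truncate (Suc r) t \<notin> bad (Suc r)"
    show "infinite (addresses t)"
    proof
      assume fin: "finite (addresses t)"
      define m where "m = Max (length ` addresses t)"
      obtain s where "s \<in> truncate (Suc m) t" "Suc m \<le> length s"
        using t[rule_format, of m] by (auto simp: bad_def not_less)
      then have "s \<in> addresses t" "Suc m \<le> length s" by (auto simp: truncate_def)
      moreover have "length s \<le> m" unfolding m_def using fin \<open>s \<in> addresses t\<close> by (intro Max_ge) auto
      ultimately show False by linarith
    qed
    show "marked_at_root t"
      using t[rule_format, of 0] by (auto simp: marked_at_root_def bad_def truncate_def)
  qed
  moreover have "limitin weak_topology (\<lambda>n. law_at_root d n) F sequentially"
    by (rule limitin_weak_topology_cyl[OF F bp lim])
  ultimately show ?thesis using F by blast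
qed

theorem theorem1p3:
  shows "(\<forall>d\<ge>1. \<exists>Fhat :: marked_tree measure.
            Fhat \<in> borel_probs \<and>
            (AE t in Fhat. infinite (addresses t) \<and> marked_at_root t) \<and>
            limitin weak_topology (\<lambda>n. law_at_root d n) Fhat sequentially)
       \<and> (\<exists>Fbar :: marked_tree measure.
            Fbar \<in> borel_probs \<and>
            (\<forall>d\<ge>1. limitin weak_topology (\<lambda>n. law_at_uniform_vertex d n) Fbar sequentially) \<and>
            (\<forall>d\<ge>1. converges_in_prob weak_topology (random_dtree d) (\<lambda>n. quenched_law) Fbar))"
  using local_limit_at_root local_limit_at_uniform_vertex by blast

end
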